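(* For elements $u<w$ of $W$ with $u\in c_1$ and $w\in c_0$, we have $\mu(u,w)=1$ if $l(w)-l(u)=1$, and $\mu(u,w)=0$ otherwise.
   Context: $W$ is the affine Weyl group of type $\widetilde A_2$: the Coxeter group on $S=\{r,s,t\}$ with $(rs)^3=(st)^3=(rt)^3=1$, with length function $l$ and Bruhat order $\le$. For $u<w$, $\mu(u,w)$ is the coefficient of $q^{(l(w)-l(u)-1)/2}$ in the Kazhdan–Lusztig polynomial $P_{u,w}$. Using Lusztig's $\mathbf a$-function, $W$ has three two-sided cells: $\{e\}$, $c_1=\{w:\mathbf a(w)=1\}$, which is the set of $w\neq e$ having a unique reduced expression, and $c_0=\{w:\mathbf a(w)=3\}=W\setminus(\{e\}\cup c_1)$. *)

theory Defs
  imports Complex_Main "HOL-Library.Poly_Mapping" "HOL-Library.Extended_Nat"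
    "HOL-Computational_Algebra.Polynomial"
begin

section \<open>The affine Weyl group of type $\widetilde A_2$\<close>

datatype gen = GR | GS | GT

inductive cox_eq :: "gen list \<Rightarrow> gen list \<Rightarrow> bool" where
  cox_refl: "cox_eq xs xs"
| cox_sym: "cox_eq xs ys \<Longrightarrow> cox_eq ys xs"
| cox_trans: "cox_eq xs ys \<Longrightarrow> cox_eq ys zs \<Longrightarrow> cox_eq xs zs"
| cox_square: "cox_eq (xs @ [a, a] @ ys) (xs @ ys)"
| cox_cube: "a \<noteq> b \<Longrightarrow> cox_eq (xs @ [a, b, a, b, a, b] @ ys) (xs @ ys)"

lemma cox_eq_equivp: "equivp cox_eq"
  by (rule equivpI)
    (auto intro!: reflpI sympI transpI intro: cox_refl cox_sym cox_trans)

quotient_type weyl = "gen list" / cox_eq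
  by (rule cox_eq_equivp)

lemma cox_eq_append_right: "cox_eq xs ys \<Longrightarrow> cox_eq (xs @ zs) (ys @ zs)"
proof (induction rule: cox_eq.induct)
  case (cox_square xs a ys)
  show ?case using cox_eq.cox_square[of xs a "ys @ zs"] by simp
next
  case (cox_cube a b xs ys)
  then show ?case using cox_eq.cox_cube[of a b xs "ys @ zs"] by simp
qed (auto intro: cox_refl cox_sym cox_trans)

lemma cox_eq_append_left: "cox_eq xs ys \<Longrightarrow> cox_eq (zs @ xs) (zs @ ys)"
proof (induction rule: cox_eq.induct)
  case (cox_square xs a ys)
  show ?case using cox_eq.cox_square[of "zs @ xs" a ys] by simp
next
  case (cox_cube a b xs ys)
  then show ?case using cox_eq.cox_cube[of a b "zs @ xs" ys] by simp
qed (auto intro: cox_refl cox_sym cox_trans)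

lemma cox_eq_rev: "cox_eq xs ys \<Longrightarrow> cox_eq (rev xs) (rev ys)"
proof (induction rule: cox_eq.induct)
  case (cox_square xs a ys)
  show ?case using cox_eq.cox_square[of "rev ys" a "rev xs"] by simp
next
  case (cox_cube a b xs ys)
  then show ?case using cox_eq.cox_cube[of b a "rev ys" "rev xs"] by simp
qed (auto intro: cox_refl cox_sym cox_trans)

instantiation weyl :: monoid_mult
begin

lift_definition one_weyl :: weyl is "[]" .

lift_definition times_weyl :: "weyl \<Rightarrow> weyl \<Rightarrow> weyl" is "(@)"
  by (meson cox_eq_append_left cox_eq_append_right cox_trans)

instance
  by standard (transfer; simp add: cox_refl)+

end

lift_definition winv :: "weyl \<Rightarrow> weyl" is rev
  by (rule cox_eq_rev)

lift_definition word :: "gen list \<Rightarrow> weyl" is "\<lambda>xs. xs" .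

abbreviation simple :: "gen \<Rightarrow> weyl" where
  "simple a \<equiv> word [a]"

lemma winv_left: "winv w * w = 1"
proof transfer
  fix xs show "cox_eq (rev xs @ xs) []"
  proof (induction xs)
    case (Cons a xs)
    have "cox_eq (rev xs @ [a, a] @ xs) (rev xs @ xs)" by (rule cox_square)
    with Cons show ?case by (auto intro: cox_trans)
  qed (simp add: cox_refl)
qed

lemma winv_winv: "winv (winv w) = w"
  by transfer (simp add: cox_refl)

lemma winv_right: "w * winv w = 1"
  using winv_left[of "winv w"] by (simp add: winv_winv)

definition len :: "weyl \<Rightarrow> nat" where
  "len w = (LEAST n. \<exists>xs. word xs = w \<and> length xs = n)"

definition reduced :: "gen list \<Rightarrow> bool" where
  "reduced xs \<longleftrightarrow> length xs = len (word xs)"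

definition reflections :: "weyl set" where
  "reflections = {x * simple a * winv x | x a. True}"

definition bruhat_step :: "weyl \<Rightarrow> weyl \<Rightarrow> bool" where
  "bruhat_step u w \<longleftrightarrow> (\<exists>t\<in>reflections. w = u * t) \<and> len u < len w"

definition bruhat_le :: "weyl \<Rightarrow> weyl \<Rightarrow> bool" where
  "bruhat_le = bruhat_step\<^sup>*\<^sup>*"

definition bruhat_less :: "weyl \<Rightarrow> weyl \<Rightarrow> bool" where
  "bruhat_less u w \<longleftrightarrow> bruhat_le u w \<and> u \<noteq> w"

section \<open>The Hecke algebra\<close>

text \<open>Laurent polynomials over the integers in the indeterminate \<open>v = q\<^sup>1\<^sup>/\<^sup>2\<close>; the key \<open>k\<close> stands
  for \<open>v\<^sup>k\<close>, and the product is the convolution product of finitely supported functions.\<close>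

type_synonym laurent = "int \<Rightarrow>\<^sub>0 int"

definition vpow :: "int \<Rightarrow> laurent" where
  "vpow k = Poly_Mapping.single k 1"

definition laurent_bar :: "laurent \<Rightarrow> laurent" where
  "laurent_bar = Poly_Mapping.map_key uminus"

definition poly_in_q :: "int poly \<Rightarrow> laurent" where
  "poly_in_q p = (\<Sum>i\<le>degree p. Poly_Mapping.single (2 * int i) (coeff p i))"

text \<open>An element of the Hecke algebra is the family of its coordinates in the standard basis
  \<open>T\<^sub>w\<close>.\<close>

type_synonym hecke = "weyl \<Rightarrow>\<^sub>0 laurent"

definition hscale :: "laurent \<Rightarrow> hecke \<Rightarrow> hecke" where
  "hscale a h = Poly_Mapping.map (\<lambda>b. a * b) h"

definition T_basis :: "weyl \<Rightarrow> hecke" where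
  "T_basis w = Poly_Mapping.single w 1"

definition T_simple_mult :: "gen \<Rightarrow> hecke \<Rightarrow> hecke" where
  "T_simple_mult a h = (\<Sum>w\<in>Poly_Mapping.keys h. hscale (Poly_Mapping.lookup h w)
     (if len w < len (simple a * w) then T_basis (simple a * w)
      else hscale (vpow 2) (T_basis (simple a * w)) + hscale (vpow 2 - 1) (T_basis w)))"

definition reduced_word :: "weyl \<Rightarrow> gen list" where
  "reduced_word w = (SOME xs. reduced xs \<and> word xs = w)"

text \<open>The bilinear product with \<open>T\<^sub>x h = T\<^sub>a (T\<^sub>b (\<dots> h))\<close> for a reduced expression \<open>x = a b \<dots>\<close>; by
  the braid relations the result does not depend on the expression chosen.\<close>

definition hmult :: "hecke \<Rightarrow> hecke \<Rightarrow> hecke" where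
  "hmult h h' = (\<Sum>x\<in>Poly_Mapping.keys h.
     hscale (Poly_Mapping.lookup h x) (foldr T_simple_mult (reduced_word x) h'))"

definition T_inverse :: "weyl \<Rightarrow> hecke" where
  "T_inverse w = (THE h. hmult h (T_basis w) = T_basis 1 \<and> hmult (T_basis w) h = T_basis 1)"

definition hecke_bar :: "hecke \<Rightarrow> hecke" where
  "hecke_bar h = (\<Sum>w\<in>Poly_Mapping.keys h.
     hscale (laurent_bar (Poly_Mapping.lookup h w)) (T_inverse (winv w)))"

section \<open>Kazhdan--Lusztig polynomials\<close>

definition kl_element :: "(weyl \<Rightarrow> weyl \<Rightarrow> int poly) \<Rightarrow> weyl \<Rightarrow> hecke" where
  "kl_element P w =
     hscale (vpow (- int (len w))) (\<Sum>y\<in>{y. bruhat_le y w}. hscale (poly_in_q (P y w)) (T_basis y))"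

definition is_kl_family :: "(weyl \<Rightarrow> weyl \<Rightarrow> int poly) \<Rightarrow> bool" where
  "is_kl_family P \<longleftrightarrow>
     (\<forall>w. P w w = 1) \<and>
     (\<forall>y w. \<not> bruhat_le y w \<longrightarrow> P y w = 0) \<and>
     (\<forall>y w. bruhat_less y w \<longrightarrow> 2 * degree (P y w) + 1 \<le> len w - len y) \<and>
     (\<forall>w. hecke_bar (kl_element P w) = kl_element P w)"

definition KL :: "weyl \<Rightarrow> weyl \<Rightarrow> int poly" where
  "KL = (THE P. is_kl_family P)"

text \<open>If \<open>len w - len u\<close> is even, the exponent \<open>(len w - len u - 1) / 2\<close> is not an integer and
  the coefficient is zero.\<close>

definition mu :: "weyl \<Rightarrow> weyl \<Rightarrow> int" where
  "mu u w = (if odd (len w - len u) then coeff (KL u w) ((len w - len u - 1) div 2) else 0)"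

section \<open>Lusztig's a-function and the two-sided cells\<close>

definition C_basis :: "weyl \<Rightarrow> hecke" where
  "C_basis w = kl_element KL w"

definition structure_const :: "weyl \<Rightarrow> weyl \<Rightarrow> weyl \<Rightarrow> laurent" where
  "structure_const x y = Poly_Mapping.lookup (THE h :: weyl \<Rightarrow>\<^sub>0 laurent.
     hmult (C_basis x) (C_basis y) = (\<Sum>z\<in>Poly_Mapping.keys h. hscale (Poly_Mapping.lookup h z) (C_basis z)))"

text \<open>The least \<open>i \<ge> 0\<close> such that \<open>v\<^sup>i h\<^sub>x\<^sub>,\<^sub>y\<^sub>,\<^sub>z\<close> is a polynomial in \<open>v\<close> for all \<open>x\<close> and \<open>y\<close>
  (infinity if there is none).\<close>

definition a_fun :: "weyl \<Rightarrow> enat" where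
  "a_fun z = Inf {enat i | i.
     \<forall>x y. \<forall>k\<in>Poly_Mapping.keys (vpow (int i) * structure_const x y z). 0 \<le> k}"

definition c1 :: "weyl set" where
  "c1 = {w. a_fun w = 1}"

definition c0 :: "weyl set" where
  "c0 = {w. a_fun w = 3}"

end

theory Submission
  imports Defs
begin

text \<open>
  Write \<open>L(w)\<close> and \<open>R(w)\<close> for the left and right descent sets and \<open>p\<^sub>y\<^sub>,\<^sub>w\<close> for the coefficients of
  \<open>C\<^sub>w\<close> in the normalised standard basis; \<open>\<mu>(y, w)\<close> is the coefficient of \<open>v\<^sup>-\<^sup>1\<close> in \<open>p\<^sub>y\<^sub>,\<^sub>w\<close>. If
  \<open>a \<in> L(w) - L(y)\<close>, then \<open>p\<^sub>y\<^sub>,\<^sub>w = v\<^sup>-\<^sup>1 p\<^sub>a\<^sub>y\<^sub>,\<^sub>w\<close>, so \<open>\<mu>(y, w) = 0\<close> unless \<open>w = a y\<close>. For \<open>u \<in> c\<^sub>1\<close> and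
  \<open>w \<in> c\<^sub>0\<close> this leaves the case \<open>L(u) = L(w) = {a}\<close>, \<open>R(u) = R(w) = {e}\<close>. In type \<open>A\<^sub>2\<close> affine
  one then has \<open>w = a m e\<close> with \<open>L(m) = S - {a}\<close>, \<open>R(m) = S - {e}\<close> and \<open>C\<^sub>w = C\<^sub>a C\<^sub>m C\<^sub>e\<close>, so \<open>p\<^sub>u\<^sub>,\<^sub>w\<close>
  is a combination of the \<open>p\<^sub>y\<^sub>,\<^sub>m\<close> with \<open>y\<close> among \<open>u, a u, u e, a u e\<close>. Since \<open>m\<close> has two descents on
  either side while \<open>y\<close> has at most one, these are divisible by powers of \<open>v\<^sup>-\<^sup>1\<close> large enough to
  kill the coefficient.

  The values of the \<open>a\<close>-function are separated as follows. A braided element occurs in some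
  \<open>C\<^sub>x C\<^sub>y\<close> with coefficient \<open>(v + v\<^sup>-\<^sup>1)\<^sup>2\<close>. Conversely, the \<open>C\<^sub>w\<close> with \<open>w\<close> braided span a two-sided
  ideal, modulo which \<open>C\<^sub>x C\<^sub>y\<close> has coefficients in \<open>\<int> + (v + v\<^sup>-\<^sup>1) \<int>\<close>.

  The Hecke algebra acts on itself by left multiplications commuting with right ones, and a map
  commuting with the latter is determined by its value at 1: this gives associativity and the
  independence of the chosen reduced words.
\<close>

section \<open>The Coxeter group\<close>

lemma word_Nil: "word [] = 1"
  by transfer (rule cox_refl)

lemma word_append: "word (xs @ ys) = word xs * word ys"
  by transfer (rule cox_refl)

lemma word_Cons: "word (a # xs) = simple a * word xs"
  using word_append[of "[a]" xs] by simp

text \<open>As \<open>simple a\<close> unfolds to \<open>word [a]\<close>, the previous equation loops as a rewrite rule.\<close>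

lemma word_Cons_Cons: "word (a # b # xs) = simple a * word (b # xs)"
  by (rule word_Cons)

lemma winv_word: "winv (word xs) = word (rev xs)"
  by transfer (rule cox_refl)

lemma word_surj: "\<exists>xs. word xs = w"
  by transfer (auto intro: cox_refl)

lemma word_eq_iff: "word xs = word ys \<longleftrightarrow> cox_eq xs ys"
  by transfer simp

lemma simple_square [simp]: "simple a * simple a = 1"
  using cox_square[of "[]" a "[]"] by (simp add: word_eq_iff word_append[symmetric] word_Nil[symmetric])

lemma simple_cancel [simp]: "simple a * (simple a * w) = w"
  by (simp add: mult.assoc[symmetric])

lemma winv_one [simp]: "winv 1 = 1"
  using winv_word[of "[]"] by (simp add: word_Nil)

lemma winv_simple [simp]: "winv (simple a) = simple a"
  by (simp add: winv_word)

lemma winv_mult: "winv (x * y) = winv y * winv x"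
  by (metis winv_word word_append word_surj rev_append)

lemma winv_cancel [simp]: "winv x * (x * y) = y" "x * (winv x * y) = y"
  by (simp_all add: mult.assoc[symmetric] winv_left winv_right)

declare winv_left [simp] winv_right [simp] winv_winv [simp]

lemma winv_inj [simp]: "winv x = winv y \<longleftrightarrow> x = y"
  by (metis winv_winv)

lemma simple_left_cancel [simp]: "simple a * x = simple a * y \<longleftrightarrow> x = y"
  by (metis simple_cancel)

lemma right_cancel: "x * z = y * z \<longleftrightarrow> x = (y :: weyl)"
  by (metis mult.assoc mult.right_neutral winv_right)

lemma braid: "a \<noteq> b \<Longrightarrow> simple a * (simple b * (simple a * w)) = simple b * (simple a * (simple b * w))"
proof -
  assume "a \<noteq> b"
  then have "word [a,b,a,b,a,b] = 1"
    using cox_cube[of a b "[]" "[]"] by (simp add: word_eq_iff word_Nil[symmetric])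
  then have "word [a,b,a,b,a,b] * (simple b * (simple a * (simple b * w))) = simple b * (simple a * (simple b * w))"
    by simp
  then show ?thesis by (simp add: word_Cons_Cons mult.assoc)
qed

text \<open>The parity of the number of occurrences of \<open>t\<close> among the reflections
  \<open>a\<^sub>1 \<dots> a\<^sub>i\<^sub>-\<^sub>1 a\<^sub>i a\<^sub>i\<^sub>-\<^sub>1 \<dots> a\<^sub>1\<close> attached to a word only depends on the group element; this is
  what yields the strong exchange condition.\<close>

primrec inversion_parity :: "gen list \<Rightarrow> weyl \<Rightarrow> bool" where
  "inversion_parity [] t = False"
| "inversion_parity (a # xs) t = ((t = simple a) \<noteq> inversion_parity xs (simple a * t * simple a))"

text \<open>Conjugation by the prefix turns the reflections attached to the suffix into the
  remaining reflections attached to the whole word.\<close>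

lemma inversion_parity_append:
  "inversion_parity (xs @ ys) t =
     (inversion_parity xs t \<noteq> inversion_parity ys (winv (word xs) * t * word xs))"
proof (induction xs arbitrary: t)
  case (Cons a xs)
  then show ?case by (auto simp: word_Cons[of a xs] winv_mult mult.assoc)
qed (simp add: word_Nil)

lemma mult_eq_iff: "x * (u * y) = z \<longleftrightarrow> u = winv x * (z * winv y)"
  by (metis mult.assoc mult.right_neutral winv_cancel winv_left winv_right)

lemma inversion_parity_cox_eq:
  "cox_eq xs ys \<Longrightarrow> inversion_parity xs t = inversion_parity ys t"
proof (induction arbitrary: t rule: cox_eq.induct)
  case (cox_square xs a ys)
  have N: "inversion_parity ([a,a] @ ys) u = inversion_parity ys u" for u
    using mult_eq_iff[of "simple a" u "simple a" "simple a"] by (auto simp: mult.assoc)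
  show ?case
    by (simp add: inversion_parity_append[of xs] N del: append.simps)
next
  case (cox_cube a b xs ys)
  let ?a = "simple a" and ?b = "simple b"
  have br: "?a * (?b * (?a * w)) = ?b * (?a * (?b * w))" for w
    by (rule braid[OF cox_cube])
  have br1: "?a * (?b * ?a) = ?b * (?a * ?b)"
    using br[of 1] by simp
  \<comment> \<open>The six reflections attached to \<open>[a,b,a,b,a,b]\<close> are
    \<open>a, aba, b, a, aba, b\<close>; each occurs twice, so they cancel in the parity, and the
    total conjugation is trivial.\<close>
  have N: "inversion_parity ([a,b,a,b,a,b] @ ys) u = inversion_parity ys u" for u
    using mult_eq_iff[of ?a u ?a ?b] mult_eq_iff[of "?b * ?a" u "?a * ?b" ?a]
      mult_eq_iff[of "?b * (?a * ?b)" u "?b * (?a * ?b)" ?b]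
      mult_eq_iff[of "?a * ?b" u "?b * ?a" ?a] mult_eq_iff[of ?b u ?b ?b]
    by (auto simp: mult.assoc winv_mult br br1)
  show ?case
    by (simp add: inversion_parity_append[of xs] N del: append.simps)
qed auto

section \<open>Inversions and the strong exchange condition\<close>

definition inversion :: "weyl \<Rightarrow> weyl \<Rightarrow> bool" where
  "inversion w t \<longleftrightarrow> (\<exists>xs. word xs = w \<and> inversion_parity xs t)"

text \<open>Invariance under \<open>cox_eq\<close> makes the choice of the word in
  \<open>inversion\<close> immaterial.\<close>

lemma inversion_word: "inversion (word xs) t = inversion_parity xs t"
  by (auto simp: inversion_def word_eq_iff inversion_parity_cox_eq intro: cox_refl)

lemma inversion_mult: "inversion (x * y) t = (inversion x t \<noteq> inversion y (winv x * t * x))"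
proof -
  obtain xs ys where "x = word xs" "y = word ys" by (metis word_surj)
  then show ?thesis
    using inversion_word[of "xs @ ys"] by (simp add: inversion_word inversion_parity_append word_append)
qed

lemma inversion_one [simp]: "\<not> inversion 1 t"
  using inversion_word[of "[]"] by (simp add: word_Nil)

lemma inversion_simple: "inversion (simple a) t \<longleftrightarrow> t = simple a"
  using inversion_word[of "[a]"] by simp

lemma inversion_winv: "inversion (winv x) t = inversion x (x * t * winv x)"
  using inversion_mult[of "winv x" x t] by simp

lemma reflection_involution: "t \<in> reflections \<Longrightarrow> t * t = 1 \<and> winv t = t"
  by (auto simp: reflections_def mult.assoc winv_mult)

text \<open>Writing \<open>t\<close> as a conjugate of \<open>simple a\<close> by \<open>x\<close>,
  the contributions of \<open>x\<close> and of \<open>winv x\<close> cancel, and the middle letter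
  contributes once.\<close>

lemma inversion_reflection: 
  assumes "t \<in> reflections" shows "inversion t t"
proof -
  obtain x a where t: "t = x * (simple a * winv x)"
    using assms by (auto simp: reflections_def mult.assoc)
  have "inversion t t = (inversion x t \<noteq> (True \<noteq> inversion x (x * (simple a * winv x))))"
    unfolding t by (simp add: inversion_mult inversion_simple inversion_winv mult.assoc)
  then show ?thesis using t by simp
qed

lemma simple_reflection: "simple a \<in> reflections"
  by (force simp: reflections_def intro: exI[of _ 1])

lemma conj_reflection: "t \<in> reflections \<Longrightarrow> x * t * winv x \<in> reflections"
  by (auto simp: reflections_def) (metis mult.assoc winv_mult)

text \<open>Odd parity means that \<open>t\<close> is one of the reflections attached to the word;
  multiplying by it from the left deletes the corresponding letter.\<close>

lemma inversion_parity_deletion: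
  "inversion_parity xs t \<Longrightarrow> \<exists>ys b zs. xs = ys @ b # zs \<and> t * word xs = word (ys @ zs)"
proof (induction xs arbitrary: t)
  case (Cons a xs)
  show ?case
  proof (cases "t = simple a")
    case True
    then have "a # xs = [] @ a # xs \<and> t * word (a # xs) = word ([] @ xs)"
      by (simp add: word_Cons[of a xs])
    then show ?thesis by blast
  next
    case False
    with Cons.prems have "inversion_parity xs (simple a * t * simple a)" by simp
    with Cons.IH obtain ys b zs where "xs = ys @ b # zs"
      and *: "simple a * t * simple a * word xs = word (ys @ zs)" by blast
    moreover have "t * word (a # xs) = word ((a # ys) @ zs)"
      using arg_cong[OF *, of "\<lambda>x. simple a * x"] word_Cons[of a xs] word_Cons[of a "ys @ zs"]
      by (simp add: mult.assoc)
    ultimately show ?thesis by (metis append_Cons)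
  qed
qed simp

subsection \<open>Length\<close>

lemma len_word_le: "len (word xs) \<le> length xs"
  unfolding len_def by (rule Least_le) auto

lemma obtain_reduced: obtains xs where "word xs = w" "length xs = len w"
proof -
  have "\<exists>n xs. word xs = w \<and> length xs = n" using word_surj by blast
  then have "\<exists>xs. word xs = w \<and> length xs = len w" unfolding len_def by (rule LeastI_ex)
  with that show thesis by blast
qed

lemma ex_reduced: "\<exists>xs. word xs = w \<and> length xs = len w"
  by (meson obtain_reduced)

lemma len_mult_le: "len (x * y) \<le> len x + len y"
  by (metis ex_reduced len_word_le word_append length_append)

lemma len_one [simp]: "len 1 = 0"
  using len_word_le[of "[]"] by (simp add: word_Nil)

lemma len_eq_0 [simp]: "len w = 0 \<longleftrightarrow> w = 1"
  by (metis ex_reduced len_one length_0_conv word_Nil)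

lemma len_winv [simp]: "len (winv w) = len w"
proof -
  have "len (winv x) \<le> len x" for x
    by (metis ex_reduced len_word_le winv_word length_rev)
  from this[of w] this[of "winv w"] show ?thesis by simp
qed

lemma inversion_imp_len_less: "inversion w t \<Longrightarrow> len (t * w) < len w"
proof -
  assume "inversion w t"
  obtain xs where xs: "word xs = w" "length xs = len w" by (rule obtain_reduced)
  with \<open>inversion w t\<close> have "inversion_parity xs t" by (metis inversion_word)
  then obtain ys b zs where "xs = ys @ b # zs" "t * word xs = word (ys @ zs)"
    using inversion_parity_deletion by blast
  with xs len_word_le[of "ys @ zs"] show ?thesis by simp
qed

lemma reflection_cancel: "t \<in> reflections \<Longrightarrow> t * (t * w) = w"
  by (simp add: mult.assoc[symmetric] reflection_involution)

text \<open>If \<open>t\<close> is no inversion of \<open>w\<close>, it is one of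
  \<open>t * w\<close>, because it is an inversion of itself; then multiplication by
  \<open>t\<close> shortens \<open>t * w\<close> to \<open>w\<close>.\<close>

lemma inversion_iff_len_less:
  assumes t: "t \<in> reflections" shows "inversion w t \<longleftrightarrow> len (t * w) < len w"
proof
  assume l: "len (t * w) < len w"
  show "inversion w t"
  proof (rule ccontr)
    assume "\<not> inversion w t"
    then have "inversion (t * w) t"
      using inversion_reflection[OF t] reflection_involution[OF t] by (simp add: inversion_mult)
    from inversion_imp_len_less[OF this] l reflection_cancel[OF t] show False by simp
  qed
qed (rule inversion_imp_len_less)

lemma strong_exchange:
  assumes "t \<in> reflections" "len (t * word xs) < len (word xs)"
  shows "\<exists>ys b zs. xs = ys @ b # zs \<and> t * word xs = word (ys @ zs)"
  using assms inversion_parity_deletion by (simp add: inversion_iff_len_less[symmetric] inversion_word)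

lemma len_reflection_neq:
  assumes t: "t \<in> reflections" shows "len (t * w) \<noteq> len w"
proof
  assume eq: "len (t * w) = len w"
  then have "\<not> inversion w t" "\<not> inversion (t * w) t"
    by (simp_all add: inversion_iff_len_less[OF t] reflection_cancel[OF t])
  then show False
    using inversion_reflection[OF t] reflection_involution[OF t] by (simp add: inversion_mult)
qed

lemma len_simple [simp]: "len (simple a) = 1"
  using len_word_le[of "[a]"] len_reflection_neq[OF simple_reflection, of a 1]
  by (simp add: le_Suc_eq)

lemma len_simple_mult: "len (simple a * w) = len w + 1 \<or> len w = len (simple a * w) + 1"
  using len_mult_le[of "simple a" w] len_mult_le[of "simple a" "simple a * w"]
    len_reflection_neq[OF simple_reflection, of a w] by auto

lemma len_mult_simple: "len (w * simple a) = len w + 1 \<or> len w = len (w * simple a) + 1"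
  using len_simple_mult[of a "winv w"] len_winv[of "w * simple a"] by (simp add: winv_mult)

text \<open>The quotient \<open>S\<^sub>3\<close> of the group separates the generators.\<close>

fun swap_others :: "gen \<Rightarrow> gen \<Rightarrow> gen" where
  "swap_others GR GR = GR" | "swap_others GR GS = GT" | "swap_others GR GT = GS"
| "swap_others GS GR = GT" | "swap_others GS GS = GS" | "swap_others GS GT = GR"
| "swap_others GT GR = GS" | "swap_others GT GS = GR" | "swap_others GT GT = GT"

lemma foldr_swap_others_cox_eq: "cox_eq xs ys \<Longrightarrow> foldr swap_others xs = foldr swap_others ys"
proof (induction rule: cox_eq.induct)
  case (cox_square xs a ys)
  have "swap_others a \<circ> swap_others a = id"
    by (rule ext, case_tac x; cases a) auto
  then show ?case by (simp add: fun_eq_iff)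
next
  case (cox_cube a b xs ys)
  have "swap_others a (swap_others b (swap_others a (swap_others b (swap_others a (swap_others b x))))) = x" for x
    using cox_cube by (cases x; cases a; cases b) auto
  then show ?case by (simp add: fun_eq_iff)
qed auto

lemma simple_inj [simp]: "simple a = simple b \<longleftrightarrow> a = b"
proof
  assume "simple a = simple b"
  then have "swap_others a x = swap_others b x" for x
    using foldr_swap_others_cox_eq[of "[a]" "[b]"] by (simp add: word_eq_iff fun_eq_iff)
  from this[of GR] this[of GS] show "a = b" by (cases a; cases b) auto
qed simp

lemma gen_cases_of_distinct: "p \<noteq> q \<Longrightarrow> p \<noteq> r \<Longrightarrow> q \<noteq> r \<Longrightarrow> x = p \<or> x = q \<or> x = (r::gen)"
  by (cases x; cases p; cases q; cases r) auto

lemma obtain_third: obtains r where "r \<noteq> p" "r \<noteq> (q::gen)"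
  by (cases p; cases q) (metis gen.distinct)+

lemma obtain_others: obtains q r where "q \<noteq> p" "r \<noteq> p" "q \<noteq> (r::gen)"
  by (cases p) (metis gen.distinct)+

subsection \<open>Descents\<close>

definition descents :: "weyl \<Rightarrow> gen set" where
  "descents w = {a. len (simple a * w) < len w}"

lemma descents_iff: "a \<in> descents w \<longleftrightarrow> len (simple a * w) < len w"
  by (simp add: descents_def)

lemma len_descent: "a \<in> descents w \<Longrightarrow> len w = len (simple a * w) + 1"
  using len_simple_mult[of a w] by (auto simp: descents_iff)

lemma len_ascent: "a \<notin> descents w \<Longrightarrow> len (simple a * w) = len w + 1"
  using len_simple_mult[of a w] by (auto simp: descents_iff)

lemma descent_mult_iff [simp]: "a \<in> descents (simple a * w) \<longleftrightarrow> a \<notin> descents w"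
  using len_simple_mult[of a w] by (auto simp: descents_iff)

lemma descents_one [simp]: "descents 1 = {}"
  by (auto simp: descents_iff)

lemma descents_nonempty: "w \<noteq> 1 \<Longrightarrow> \<exists>a. a \<in> descents w"
proof -
  assume "w \<noteq> 1"
  obtain xs where xs: "word xs = w" "length xs = len w" by (rule obtain_reduced)
  with \<open>w \<noteq> 1\<close> obtain a ys where "xs = a # ys" by (cases xs) (auto simp: word_Nil)
  then have "simple a * w = word ys" using xs(1) word_Cons[of a ys] by auto
  then have "a \<in> descents w" using len_word_le[of ys] xs \<open>xs = a # ys\<close> by (simp add: descents_iff)
  then show ?thesis ..
qed

section \<open>Elements with two left descents\<close>

lemma exchange_left:
  assumes "q \<in> descents (simple p * v)" "p \<notin> descents v" "q \<noteq> p"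
  shows "\<exists>v'. simple q * (simple p * v) = simple p * v' \<and> len v' + 1 = len v"
proof -
  obtain xs where xs: "word xs = v" "length xs = len v" by (rule obtain_reduced)
  have *: "word (p # xs) = simple p * v" using word_Cons[of p xs] xs by simp
  then obtain ys b zs where d: "p # xs = ys @ b # zs" "simple q * word (p # xs) = word (ys @ zs)"
    using strong_exchange[OF simple_reflection, of q "p # xs"] assms(1) by (auto simp: descents_iff)
  show ?thesis
  proof (cases ys)
    \<comment> \<open>Deleting the leading \<open>p\<close> would force \<open>q = p\<close>, so the
      deleted letter lies inside \<open>v\<close>.\<close>
    case Nil
    then have "simple q * (simple p * v) = v" using d xs word_Cons[of p xs] by simp
    then have "simple q * simple p = 1" by (metis mult.assoc mult.left_neutral right_cancel)
    then have "simple q = simple p" by (metis mult.assoc mult.left_neutral mult.right_neutral simple_square)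
    with assms(3) show ?thesis by simp
  next
    case (Cons c ys')
    then have e: "simple q * (simple p * v) = simple p * word (ys' @ zs)" "len (word (ys' @ zs)) < len v"
      using d * xs word_Cons[of p "ys' @ zs"] len_word_le[of "ys' @ zs"] by auto
    have "len (simple p * v) = len v + 1" "len (simple p * v) = len (simple q * (simple p * v)) + 1"
      using assms len_ascent len_descent by blast+
    with e len_mult_le[of "simple p" "word (ys' @ zs)"] have "len (word (ys' @ zs)) + 1 = len v"
      using len_simple_mult[of p "word (ys' @ zs)"] by auto
    with e show ?thesis by blast
  qed
qed

text \<open>Such an element begins with the longest element of the dihedral group generated by
  \<open>p\<close> and \<open>q\<close>. Two exchanges produce \<open>w = p q u\<close>, and it
  remains to show that \<open>p\<close> is a descent of \<open>u\<close>.\<close>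

lemma two_descents:
  assumes "p \<in> descents w" "q \<in> descents w" "p \<noteq> q"
  obtains y where "w = simple p * (simple q * (simple p * y))" "len w = len y + 3"
proof -
  define v where "v = simple p * w"
  have w: "w = simple p * v" and pv: "p \<notin> descents v" using assms by (simp_all add: v_def)
  obtain v' where v': "simple q * w = simple p * v'" "len v' + 1 = len v"
    using exchange_left[of q p v] assms pv w by auto
  have w2: "w = simple q * (simple p * v')" using v' by (metis simple_cancel)
  have lw: "len w = len v' + 2" using len_ascent[OF pv] w v' by simp
  have lp: "len (simple p * v') = len v' + 1"
    using len_simple_mult[of p v'] len_simple_mult[of q "simple p * v'"] lw
    unfolding w2[symmetric] by linarith
  have qn: "q \<notin> descents (simple p * v')" using lp lw by (simp add: descents_iff w2[symmetric])
  obtain u where u: "simple p * w = simple q * u" "len u + 1 = len (simple p * v')"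
    using exchange_left[of p q "simple p * v'"] assms(1,3) qn w2 by auto
  have wu: "w = simple p * (simple q * u)" using u by (metis simple_cancel)
  have lu: "len u = len v'" using u(2) lp by simp
  \<comment> \<open>Otherwise the braid relation gives \<open>v' = q p u\<close>, and a further
    exchange rewrites this as \<open>p z\<close> with \<open>z\<close> shorter than
    \<open>u\<close>; then \<open>p v' = z\<close> contradicts \<open>lp\<close>.\<close>
  have "p \<in> descents u"
  proof (rule ccontr)
    assume n: "p \<notin> descents u"
    have "simple p * v' = simple q * (simple p * (simple q * u))" using w2 wu by (metis simple_cancel)
    then have "simple p * v' = simple p * (simple q * (simple p * u))" using braid[of q p u] assms(3) by simp
    then have vv: "v' = simple q * (simple p * u)" by simp
    have "len (simple p * u) = len u + 1" using n len_ascent by blast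
    then have "q \<in> descents (simple p * u)"
      using vv lu len_simple_mult[of q "simple p * u"] by (auto simp: descents_iff)
    then obtain z where z: "simple q * (simple p * u) = simple p * z" "len z + 1 = len u"
      using exchange_left[of q p u] n assms(3) by auto
    with vv have "simple p * v' = z" by simp
    with lp z lu show False by simp
  qed
  then have "len u = len (simple p * u) + 1" by (rule len_descent)
  then have "w = simple p * (simple q * (simple p * (simple p * u)))" "len w = len (simple p * u) + 3"
    using wu lw u lp by simp_all
  then show thesis by (rule that)
qed

text \<open>By the braid relation the element also begins with \<open>q p q\<close>, so cancelling
  either first letter leaves length at most \<open>len y + 2\<close>.\<close>

lemma braid_descents:
  assumes "len (simple p * (simple q * (simple p * y))) = len y + 3" "p \<noteq> q"
  shows "p \<in> descents (simple p * (simple q * (simple p * y)))"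
    "q \<in> descents (simple p * (simple q * (simple p * y)))"
proof -
  have "len (simple q * (simple p * y)) \<le> len y + 2" "len (simple p * (simple q * y)) \<le> len y + 2"
    using len_mult_le[of "simple q" "simple p * y"] len_mult_le[of "simple p" y]
      len_mult_le[of "simple p" "simple q * y"] len_mult_le[of "simple q" y] by simp_all
  moreover have "simple q * (simple p * (simple q * (simple p * y))) = simple p * (simple q * y)"
    using braid[of p q y] assms(2) by (metis simple_cancel)
  ultimately show "p \<in> descents (simple p * (simple q * (simple p * y)))"
    "q \<in> descents (simple p * (simple q * (simple p * y)))"
    using assms by (simp_all add: descents_iff)
qed

text \<open>Infinite descent: \<open>v\<close> begins with \<open>p q p\<close>, so \<open>q\<close>
  is a descent of \<open>p v\<close>. If \<open>r\<close> were one too, then \<open>p v\<close>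
  would have the descents \<open>q\<close> and \<open>r\<close> while \<open>p\<close> is a descent
  of \<open>q p v\<close>, which is the same situation for a shorter element.\<close>

lemma no_descent_chain:
  assumes "p \<in> descents v" "q \<in> descents v" "p \<noteq> q" "r \<noteq> p" "r \<noteq> q"
  shows "r \<notin> descents (simple p * v)"
  using assms
proof (induction "len v" arbitrary: v p q r rule: less_induct)
  case less
  show ?case
  proof
    assume r: "r \<in> descents (simple p * v)"
    obtain y where v: "v = simple p * (simple q * (simple p * y))" "len v = len y + 3"
      using two_descents less.prems by metis
    define v' where "v' = simple p * v"
    have v': "v' = simple q * (simple p * y)" using v by (simp add: v'_def)
    have l': "len v = len v' + 1" using less.prems len_descent v'_def by blast
    have "len (simple p * y) \<le> len y + 1" using len_mult_le[of "simple p" y] by simp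
    then have q: "q \<in> descents v'" using v v' l' by (simp add: descents_iff)
    have rv: "r \<in> descents v'" using r v'_def by simp
    obtain y' where y': "v' = simple q * (simple r * (simple q * y'))" "len v' = len y' + 3"
      using two_descents q rv less.prems by metis
    have "simple p * y = simple q * v'" using v' by simp
    moreover have "len (simple p * y) = len y + 1" using v v' l' q len_descent[OF q] by simp
    ultimately have "p \<in> descents (simple q * v')" by (metis descents_iff lessI simple_cancel Suc_eq_plus1)
    moreover have "p \<notin> descents (simple q * v')"
      using less.hyps[of v' q r p] q rv less.prems l' by auto
    ultimately show False by simp
  qed
qed

text \<open>With descents \<open>p\<close> and \<open>r\<close> the element begins with
  \<open>p r p\<close>, so \<open>r\<close> is a descent of \<open>p w\<close>;
  \<open>no_descent_chain\<close> for \<open>p\<close> and \<open>q\<close> excludes this.\<close>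

lemma not_all_descents:
  assumes "p \<in> descents w" "q \<in> descents w" "p \<noteq> q" "r \<noteq> p" "r \<noteq> q"
  shows "r \<notin> descents w"
proof
  assume r: "r \<in> descents w"
  obtain y where w: "w = simple p * (simple r * (simple p * y))" "len w = len y + 3"
    using two_descents assms r by metis
  have "r \<in> descents (simple p * w)"
    using w len_mult_le[of "simple p" y] len_descent[OF assms(1)] by (simp add: descents_iff)
  with no_descent_chain[OF assms] show False by simp
qed

lemma descents_mult_right: 
  assumes "len (x * y) = len x + len y" shows "descents x \<subseteq> descents (x * y)"
proof
  fix a assume "a \<in> descents x"
  then show "a \<in> descents (x * y)"
    using assms len_mult_le[of "simple a * x" y] by (simp add: descents_iff mult.assoc)
qed

subsection \<open>Elements with a braid in some reduced expression\<close>

text \<open>The elements with a unique reduced expression are those that are not \<open>braided\<close>, so that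
  \<open>c\<^sub>0\<close> consists of the braided elements and \<open>c\<^sub>1\<close> of the other ones except 1.\<close>

definition braided :: "weyl \<Rightarrow> bool" where
  "braided w \<longleftrightarrow> (\<exists>x p q y. p \<noteq> q \<and> w = x * word [p, q, p] * y \<and> len w = len x + 3 + len y)"

lemma braidedI:
  "p \<noteq> q \<Longrightarrow> w = x * word [p, q, p] * y \<Longrightarrow> len w = len x + 3 + len y \<Longrightarrow> braided w"
  unfolding braided_def by blast

lemma braided_winv: "braided (winv w) \<longleftrightarrow> braided w"
proof -
  have "braided w \<Longrightarrow> braided (winv w)" for w
  proof -
    assume "braided w"
    then obtain x p q y where w: "p \<noteq> q" "w = x * word [p, q, p] * y" "len w = len x + 3 + len y"
      unfolding braided_def by blast
    have "winv w = winv y * word [p, q, p] * winv x"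
      using w(2) by (simp add: winv_mult winv_word mult.assoc)
    moreover have "len (winv w) = len (winv y) + 3 + len (winv x)" using w(3) by simp
    ultimately show "braided (winv w)" using w(1) by (intro braidedI)
  qed
  from this[of w] this[of "winv w"] show ?thesis by auto
qed

lemma braided_two_descents:
  assumes "p \<in> descents w" "q \<in> descents w" "p \<noteq> q" shows "braided w"
proof -
  obtain y where y: "w = simple p * (simple q * (simple p * y))" "len w = len y + 3"
    using two_descents assms by metis
  have "w = 1 * word [p, q, p] * y" using y by (simp add: word_Cons_Cons mult.assoc)
  then show ?thesis using assms y by (intro braidedI[of p q w 1 y]) simp_all
qed

lemma braided_ascent:
  assumes "braided w" "a \<notin> descents w" shows "braided (simple a * w)"
proof -
  obtain x p q y where w: "p \<noteq> q" "w = x * word [p, q, p] * y" "len w = len x + 3 + len y"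
    using assms unfolding braided_def by blast
  have "len (simple a * x) + 3 + len y = len w + 1"
  proof (rule antisym)
    show "len (simple a * x) + 3 + len y \<le> len w + 1" using w len_mult_le[of "simple a" x] by simp
    have "len w + 1 \<le> len (simple a * x * word [p,q,p]) + len y"
      using len_ascent[OF assms(2)] w len_mult_le[of "simple a * x * word [p,q,p]" y]
      by (simp add: mult.assoc)
    then show "len w + 1 \<le> len (simple a * x) + 3 + len y"
      using len_mult_le[of "simple a * x" "word [p,q,p]"] len_word_le[of "[p,q,p]"] by simp
  qed
  then show ?thesis
    using w len_ascent[OF assms(2)]
    by (intro braidedI[of p q _ "simple a * x" y]) (simp_all add: mult.assoc)
qed

text \<open>The braid is moved to the front by induction on the prefix \<open>x\<close>. A first
  letter of \<open>x\<close> other than \<open>a\<close> is a second descent. If the first letter is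
  \<open>a\<close>, it is removed and the induction hypothesis is applied to the rest.\<close>

lemma braided_cases:
  assumes "braided w" "a \<in> descents w"
  shows "(\<exists>p\<in>descents w. p \<noteq> a) \<or> descents (simple a * w) = - {a}"
proof -
  obtain x p q y where w: "p \<noteq> q" "w = x * word [p, q, p] * y" "len w = len x + 3 + len y"
    using assms unfolding braided_def by blast
  from w assms(2) show ?thesis
  proof (induction "len x" arbitrary: x w a)
    case 0
    then have "x = 1" by simp
    then have "w = simple p * (simple q * (simple p * y))" "len w = len y + 3"
      using 0 by (simp_all add: word_Cons_Cons mult.assoc)
    then have "p \<in> descents w" "q \<in> descents w" using braid_descents[of p q y] 0 by auto
    then show ?case using 0 by metis
  next
    case (Suc n)
    then have "x \<noteq> 1" by auto
    then obtain d where d: "d \<in> descents x" using descents_nonempty by blast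
    show ?case
    proof (cases "d = a")
      case False
      have "d \<in> descents w"
      proof -
        have "len (simple d * w) \<le> len (simple d * x) + 3 + len y"
          using len_mult_le[of "simple d * x * word [p,q,p]" y] len_mult_le[of "simple d * x" "word [p,q,p]"]
            len_word_le[of "[p,q,p]"] Suc.prems by (simp add: mult.assoc)
        then show ?thesis using d Suc.prems by (simp add: descents_iff)
      qed
      with False show ?thesis by auto
    next
      case da: True
      define w' x' where "w' = simple a * w" and "x' = simple a * x"
      have lx: "len x = len x' + 1" "len w = len w' + 1"
        using d da Suc.prems len_descent w'_def x'_def by auto
      have w': "w' = x' * word [p, q, p] * y" "len w' = len x' + 3 + len y"
        using Suc.prems lx by (auto simp: w'_def x'_def mult.assoc)
      have an: "a \<notin> descents w'" using Suc.prems by (simp add: w'_def)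
      have "w' \<noteq> 1" using w' by auto
      then obtain b where b: "b \<in> descents w'" using descents_nonempty by blast
      have ba: "b \<noteq> a" using an b by auto
      from Suc.hyps(1)[of x' w' b] lx Suc.hyps(2) w' b Suc.prems
      have "(\<exists>p\<in>descents w'. p \<noteq> b) \<or> descents (simple b * w') = - {b}" by auto
      then show ?thesis
      proof
        assume "\<exists>p\<in>descents w'. p \<noteq> b"
        then obtain c where c: "c \<in> descents w'" "c \<noteq> b" by auto
        then have "descents w' = - {a}" using b an ba gen_cases_of_distinct[of a b c] by auto
        then show ?thesis by (simp add: w'_def)
      next
        assume "descents (simple b * w') = - {b}"
        then have ad: "a \<in> descents (simple b * w')" using ba by auto
        obtain c where c: "c \<noteq> a" "c \<noteq> b" by (rule obtain_third)
        have cd: "c \<in> descents (simple b * w')" using c \<open>descents (simple b * w') = - {b}\<close> by auto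
        obtain y' where y': "simple b * w' = simple a * (simple c * (simple a * y'))" "len (simple b * w') = len y' + 3"
          using two_descents ad cd c by metis
        \<comment> \<open>Here \<open>b\<close> followed by a braid in \<open>a\<close> and
          \<open>c\<close> comes after the first letter \<open>a\<close>; the initial
          \<open>a b a\<close> turns into \<open>b a b\<close> and exposes \<open>b\<close> as a
          second descent of \<open>w\<close>.\<close>
        have "w = simple a * (simple b * (simple a * (simple c * (simple a * y'))))"
          using y'(1) w'_def by (metis simple_cancel)
        then have "simple b * w = simple a * (simple b * (simple c * (simple a * y')))"
          using braid[of a b] ba by (metis simple_cancel)
        then have "len (simple b * w) \<le> len y' + 4"
          using len_mult_le[of "simple a" "simple b * (simple c * (simple a * y'))"]
            len_mult_le[of "simple b" "simple c * (simple a * y')"]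
            len_mult_le[of "simple c" "simple a * y'"] len_mult_le[of "simple a" y'] by simp
        then have "b \<in> descents w" using y' lx len_descent[OF b] by (simp add: descents_iff)
        then show ?thesis using ba by blast
      qed
    qed
  qed
qed

subsection \<open>Bruhat order\<close>

lemma bruhat_step_len: "bruhat_step u w \<Longrightarrow> len u < len w"
  by (simp add: bruhat_step_def)

lemma bruhat_le_refl [simp]: "bruhat_le w w"
  by (simp add: bruhat_le_def)

lemma bruhat_le_trans: "bruhat_le x y \<Longrightarrow> bruhat_le y z \<Longrightarrow> bruhat_le x z"
  unfolding bruhat_le_def by simp

lemma bruhat_le_len: "bruhat_le u w \<Longrightarrow> u = w \<or> len u < len w"
  unfolding bruhat_le_def
  by (induction rule: rtranclp_induct) (auto dest: bruhat_step_len)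

lemma finite_len_le: "finite {w. len w \<le> n}"
proof (rule finite_subset)
  show "{w. len w \<le> n} \<subseteq> word ` {xs. set xs \<subseteq> {GR, GS, GT} \<and> length xs \<le> n}"
  proof
    fix w assume "w \<in> {w. len w \<le> n}"
    moreover obtain xs where "word xs = w" "length xs = len w" by (rule obtain_reduced)
    moreover have "set xs \<subseteq> {GR, GS, GT}" using gen.exhaust by blast
    ultimately show "w \<in> word ` {xs. set xs \<subseteq> {GR, GS, GT} \<and> length xs \<le> n}" by auto
  qed
  show "finite (word ` {xs. set xs \<subseteq> {GR, GS, GT} \<and> length xs \<le> n})"
    by (intro finite_imageI finite_lists_length_le) simp
qed

lemma finite_bruhat_le: "finite {y. bruhat_le y w}"
  by (rule finite_subset[OF _ finite_len_le[of "len w"]]) (auto dest: bruhat_le_len)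

text \<open>Conjugation by \<open>u\<close> carries the reflection from one side to the
  other.\<close>

lemma bruhat_step_left_iff:
  "bruhat_step u w \<longleftrightarrow> (\<exists>t\<in>reflections. w = t * u) \<and> len u < len w"
proof -
  have "(\<exists>t\<in>reflections. w = u * t) \<longleftrightarrow> (\<exists>t\<in>reflections. w = t * u)"
  proof
    assume "\<exists>t\<in>reflections. w = u * t"
    then obtain t where t: "t \<in> reflections" "w = u * t" by blast
    then have "u * t * winv u \<in> reflections" "w = u * t * winv u * u"
      by (blast intro: conj_reflection) (simp add: t mult.assoc)
    then show "\<exists>t\<in>reflections. w = t * u" by blast
  next
    assume "\<exists>t\<in>reflections. w = t * u"
    then obtain t where t: "t \<in> reflections" "w = t * u" by blast
    then have "winv u * t * winv (winv u) \<in> reflections" "w = u * (winv u * t * winv (winv u))"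
      by (blast intro: conj_reflection) (simp add: t mult.assoc)
    then show "\<exists>t\<in>reflections. w = u * t" by blast
  qed
  then show ?thesis by (simp add: bruhat_step_def)
qed

lemma bruhat_step_winv: "bruhat_step u w \<Longrightarrow> bruhat_step (winv u) (winv w)"
  unfolding bruhat_step_left_iff[of "winv u"] unfolding bruhat_step_def
  using reflection_involution by (auto simp: winv_mult)

lemma bruhat_le_winv: "bruhat_le (winv u) (winv w) \<longleftrightarrow> bruhat_le u w"
proof -
  have "bruhat_le u w \<Longrightarrow> bruhat_le (winv u) (winv w)" for u w
    unfolding bruhat_le_def
    by (induction rule: rtranclp_induct) (auto dest: bruhat_step_winv)
  from this[of u w] this[of "winv u" "winv w"] show ?thesis by auto
qed

lemma bruhat_step_ascent: "a \<notin> descents w \<Longrightarrow> bruhat_step w (simple a * w)"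
  using simple_reflection len_ascent by (auto simp: bruhat_step_left_iff)

text \<open>If multiplication by \<open>a\<close> reverses the order of the lengths, strong exchange
  deletes a letter from a reduced word of \<open>a u\<close>. This has to be the leading
  \<open>a\<close>, since any other deletion would make \<open>w\<close> shorter than
  \<open>u\<close>.\<close>

lemma bruhat_step_simple_mult:
  assumes "bruhat_step u w" shows "simple a * u = w \<or> bruhat_step (simple a * u) (simple a * w)"
proof (cases "len (simple a * u) < len (simple a * w)")
  case True
  then show ?thesis using assms by (auto simp: bruhat_step_def mult.assoc)
next
  case False
  obtain t where t: "t \<in> reflections" "w = u * t" and l: "len u < len w"
    using assms by (auto simp: bruhat_step_def)
  have tw: "t * winv u = winv w" using t reflection_involution by (simp add: winv_mult)
  have "len (simple a * u) \<noteq> len (simple a * w)"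
    using len_reflection_neq[OF t(1), of "winv (simple a * u)"] tw
      len_winv[of "simple a * w"] len_winv[of "simple a * u"]
    by (simp add: winv_mult mult.assoc[symmetric])
  with False have l2: "len (simple a * w) < len (simple a * u)" by simp
  have lu: "len (simple a * u) = len u + 1" using l l2 len_simple_mult[of a u] len_simple_mult[of a w] by auto
  obtain xs where xs: "word xs = u" "length xs = len u" by (rule obtain_reduced)
  \<comment> \<open>The reflection \<open>t\<close> acts on the right of \<open>u\<close>, so strong
    exchange is used for the inverses and the reversed word.\<close>
  have au: "word (rev (a # xs)) = winv (simple a * u)" using xs word_Cons[of a xs] by (metis winv_word)
  have "len (t * word (rev (a # xs))) < len (word (rev (a # xs)))"
    unfolding au using l2 tw len_winv[of "simple a * w"] len_winv[of "simple a * u"]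
    by (simp add: winv_mult mult.assoc[symmetric])
  from strong_exchange[OF t(1) this] obtain ys b zs
    where d: "rev (a # xs) = ys @ b # zs" "t * word (rev (a # xs)) = word (ys @ zs)" by blast
  have aw: "simple a * w = word (rev zs @ rev ys)"
    using d(2) tw unfolding au by (metis (no_types, lifting) mult.assoc rev_append winv_mult winv_winv winv_word)
  have d': "a # xs = rev zs @ b # rev ys" using arg_cong[OF d(1), of rev] by simp
  show ?thesis
  proof (cases "rev zs")
    case Nil
    then have "simple a * w = u" using d' aw xs by simp
    then show ?thesis by auto
  next
    case (Cons c zs')
    then have "w = word (zs' @ rev ys)" using d' aw word_Cons[of a "zs' @ rev ys"] by simp
    then have "len w < len u" using len_word_le[of "zs' @ rev ys"] d' Cons xs by auto
    with l show ?thesis by simp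
  qed
qed

lemma bruhat_le_lift:
  "bruhat_le u w \<Longrightarrow> bruhat_le (simple a * u) w \<or> bruhat_le (simple a * u) (simple a * w)"
  unfolding bruhat_le_def
proof (induction rule: rtranclp_induct)
  case (step x w)
  then show ?case using bruhat_step_simple_mult[OF step(2), of a]
    by (metis rtranclp.rtrancl_into_rtrancl)
qed simp

lemma bruhat_le_ascent:
  assumes "bruhat_le u w" "a \<notin> descents w"
  shows "bruhat_le u (simple a * w)" "bruhat_le (simple a * u) (simple a * w)"
proof -
  have "bruhat_le w (simple a * w)"
    using bruhat_step_ascent[OF assms(2)] by (simp add: bruhat_le_def)
  then show "bruhat_le u (simple a * w)" "bruhat_le (simple a * u) (simple a * w)"
    using assms bruhat_le_lift bruhat_le_trans by blast+
qed

lemma bruhat_le_imp_step: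
  assumes "bruhat_le u w" "len w = len u + 1" shows "bruhat_step u w"
proof -
  obtain x where x: "bruhat_le u x" "bruhat_step x w"
    using assms unfolding bruhat_le_def by (metis rtranclp.cases n_not_Suc_n Suc_eq_plus1)
  then have "x = u" using bruhat_le_len[OF x(1)] bruhat_step_len[OF x(2)] assms by auto
  with x show ?thesis by simp
qed

section \<open>Hecke algebra\<close>

subsection \<open>Laurent polynomials\<close>

lemma lookup_vpow: "Poly_Mapping.lookup (vpow k) n = (1 when n = k)"
  by (simp add: vpow_def lookup_single when_def)

lemma lookup_single_mult:
  fixes p :: laurent
  shows "Poly_Mapping.lookup (Poly_Mapping.single k c * p) n = c * Poly_Mapping.lookup p (n - k)"
proof -
  have "(Poly_Mapping.lookup p q when n = k + q) = (Poly_Mapping.lookup p q when q = n - k)" for q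
    by (auto simp: when_def)
  then show ?thesis
    by (simp add: lookup_mult lookup_single when_mult del: lookup_frag_of)
qed

lemma lookup_vpow_mult: "Poly_Mapping.lookup (vpow k * p) n = Poly_Mapping.lookup p (n - k)"
  by (simp add: vpow_def lookup_single_mult)

lemma lookup_of_int_mult: "Poly_Mapping.lookup (of_int c * p :: laurent) n = c * Poly_Mapping.lookup p n"
  using lookup_single_mult[of 0 c p n] single_of_int[of c, where 'b = int and 'a = int] by simp

lemma vpow_add: "vpow (k + l) = vpow k * vpow l"
  by (simp add: vpow_def mult_single)

lemma vpow_0 [simp]: "vpow 0 = 1"
  by (simp add: vpow_def)

lemma vpow_mult: "vpow k * vpow l = vpow (k + l)"
  by (simp add: vpow_add)

lemma vpow_mult_assoc: "vpow k * (vpow l * p) = vpow (k + l) * p"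
  by (simp add: vpow_add mult.assoc)

lemma lookup_laurent_bar: "Poly_Mapping.lookup (laurent_bar p) k = Poly_Mapping.lookup p (- k)"
  by (simp add: laurent_bar_def Poly_Mapping.map_key.rep_eq)

lemma laurent_bar_add: "laurent_bar (p + q) = laurent_bar p + laurent_bar q"
  by (rule poly_mapping_eqI) (simp add: lookup_laurent_bar lookup_add)

lemma laurent_bar_diff: "laurent_bar (p - q) = laurent_bar p - laurent_bar q"
  by (rule poly_mapping_eqI) (simp add: lookup_laurent_bar lookup_minus)

lemma laurent_bar_0 [simp]: "laurent_bar 0 = 0"
  by (rule poly_mapping_eqI) (simp add: lookup_laurent_bar)

lemma laurent_bar_vpow [simp]: "laurent_bar (vpow k) = vpow (- k)"
  by (rule poly_mapping_eqI) (auto simp: lookup_laurent_bar lookup_vpow when_def)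

lemma laurent_bar_of_int [simp]: "laurent_bar (of_int k) = of_int k"
  by (rule poly_mapping_eqI) (auto simp: lookup_laurent_bar lookup_of_int when_def)

lemma laurent_bar_1 [simp]: "laurent_bar 1 = 1"
  using laurent_bar_of_int[of 1] by simp

lemma single_expansion:
  fixes p :: "'a \<Rightarrow>\<^sub>0 'b::comm_monoid_add"
  shows "p = (\<Sum>k\<in>Poly_Mapping.keys p. Poly_Mapping.single k (Poly_Mapping.lookup p k))"
proof (rule poly_mapping_eqI)
  fix n
  have "(\<Sum>k\<in>Poly_Mapping.keys p. Poly_Mapping.lookup (Poly_Mapping.single k (Poly_Mapping.lookup p k)) n) =
    (\<Sum>k\<in>Poly_Mapping.keys p. if k = n then Poly_Mapping.lookup p k else 0)"
    by (intro sum.cong) (auto simp: lookup_single when_def)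
  then show "Poly_Mapping.lookup p n = Poly_Mapping.lookup (\<Sum>k\<in>Poly_Mapping.keys p. Poly_Mapping.single k (Poly_Mapping.lookup p k)) n"
    by (simp add: lookup_sum in_keys_iff)
qed

lemma laurent_bar_sum: "laurent_bar (sum f A) = (\<Sum>x\<in>A. laurent_bar (f x))"
  by (induction A rule: infinite_finite_induct) (simp_all add: laurent_bar_add)

lemma laurent_bar_single: "laurent_bar (Poly_Mapping.single k c) = Poly_Mapping.single (- k) c"
  by (rule poly_mapping_eqI) (auto simp: lookup_laurent_bar lookup_single when_def)

lemma laurent_bar_mult: "laurent_bar (p * q) = laurent_bar p * laurent_bar q"
proof -
  have "laurent_bar (p * q) = (\<Sum>i\<in>Poly_Mapping.keys p. \<Sum>j\<in>Poly_Mapping.keys q.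
      laurent_bar (Poly_Mapping.single i (Poly_Mapping.lookup p i) * Poly_Mapping.single j (Poly_Mapping.lookup q j)))"
    by (subst single_expansion[of p], subst single_expansion[of q])
       (simp add: sum_product laurent_bar_sum)
  also have "\<dots> = (\<Sum>i\<in>Poly_Mapping.keys p. \<Sum>j\<in>Poly_Mapping.keys q.
      laurent_bar (Poly_Mapping.single i (Poly_Mapping.lookup p i)) * laurent_bar (Poly_Mapping.single j (Poly_Mapping.lookup q j)))"
    by (simp add: mult_single laurent_bar_single)
  also have "\<dots> = laurent_bar (\<Sum>i\<in>Poly_Mapping.keys p. Poly_Mapping.single i (Poly_Mapping.lookup p i)) *
      laurent_bar (\<Sum>j\<in>Poly_Mapping.keys q. Poly_Mapping.single j (Poly_Mapping.lookup q j))"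
    by (simp add: sum_product laurent_bar_sum)
  finally show ?thesis by (simp add: single_expansion[symmetric])
qed

subsection \<open>Semilinear maps\<close>

lemma lookup_hscale [simp]: "Poly_Mapping.lookup (hscale a h) w = a * Poly_Mapping.lookup h w"
  by (auto simp: hscale_def Poly_Mapping.map.rep_eq when_def)

lemma lookup_T_basis: "Poly_Mapping.lookup (T_basis w) y = (1 when y = w)"
  by (auto simp: T_basis_def lookup_single when_def)

lemma hscale_hscale: "hscale a (hscale b h) = hscale (a * b) h"
  by (rule poly_mapping_eqI) (simp add: mult.assoc)

lemma hscale_add: "hscale a (h + h') = hscale a h + hscale a h'"
  by (rule poly_mapping_eqI) (simp add: lookup_add distrib_left)

lemma hscale_diff: "hscale a (h - h') = hscale a h - hscale a h'"
  by (rule poly_mapping_eqI) (simp add: lookup_minus right_diff_distrib)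

lemma hscale_add_left: "hscale (a + b) h = hscale a h + hscale b h"
  by (rule poly_mapping_eqI) (simp add: lookup_add distrib_right)

lemma hscale_1 [simp]: "hscale 1 h = h"
  by (rule poly_mapping_eqI) simp

lemma hscale_0 [simp]: "hscale 0 h = 0" "hscale a 0 = 0"
  by (rule poly_mapping_eqI, simp)+

lemma hscale_sum: "hscale a (sum f A) = (\<Sum>x\<in>A. hscale a (f x))"
  by (induction A rule: infinite_finite_induct) (simp_all add: hscale_add)

text \<open>The twist \<open>\<phi>\<close> is the identity for linear maps and
  \<open>laurent_bar\<close> for maps built from the bar involution, so that both share one set of
  rules.\<close>

definition semilinear :: "(laurent \<Rightarrow> laurent) \<Rightarrow> (hecke \<Rightarrow> hecke) \<Rightarrow> bool" where
  "semilinear \<phi> F \<longleftrightarrow> (\<forall>h h'. F (h + h') = F h + F h') \<and> (\<forall>a h. F (hscale a h) = hscale (\<phi> a) (F h))"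

abbreviation hlinear :: "(hecke \<Rightarrow> hecke) \<Rightarrow> bool" where
  "hlinear \<equiv> semilinear (\<lambda>a. a)"

lemma semilinear_add: "semilinear \<phi> F \<Longrightarrow> F (h + h') = F h + F h'"
  by (simp add: semilinear_def)

lemma semilinear_scale: "semilinear \<phi> F \<Longrightarrow> F (hscale a h) = hscale (\<phi> a) (F h)"
  by (simp add: semilinear_def)

lemma semilinear_0: "semilinear \<phi> F \<Longrightarrow> F 0 = 0"
  using semilinear_add[of \<phi> F 0 0] by simp

lemma semilinear_diff: "semilinear \<phi> F \<Longrightarrow> F (h - h') = F h - F h'"
  using semilinear_add[of \<phi> F "h - h'" h'] by simp

lemma semilinear_sum: "semilinear \<phi> F \<Longrightarrow> F (sum f A) = (\<Sum>x\<in>A. F (f x))"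
  by (induction A rule: infinite_finite_induct) (simp_all add: semilinear_0 semilinear_add)

lemma semilinear_comp:
  "semilinear \<phi> F \<Longrightarrow> semilinear \<psi> G \<Longrightarrow> semilinear (\<lambda>a. \<phi> (\<psi> a)) (\<lambda>h. F (G h))"
  by (simp add: semilinear_def)

lemma hecke_expansion: "h = (\<Sum>w\<in>Poly_Mapping.keys h. hscale (Poly_Mapping.lookup h w) (T_basis w))"
proof -
  have "hscale (Poly_Mapping.lookup h w) (T_basis w) = Poly_Mapping.single w (Poly_Mapping.lookup h w)" for w
    by (rule poly_mapping_eqI) (simp add: lookup_T_basis lookup_single when_def)
  then show ?thesis using single_expansion[of h] by simp
qed

lemma semilinear_eqI:
  assumes "semilinear \<phi> F" "semilinear \<phi> G" "\<And>w. F (T_basis w) = G (T_basis w)"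
  shows "F h = G h"
  by (subst (1 2) hecke_expansion)
     (simp add: semilinear_sum[OF assms(1)] semilinear_sum[OF assms(2)]
       semilinear_scale[OF assms(1)] semilinear_scale[OF assms(2)] assms(3))

text \<open>The common form of \<open>T_simple_mult\<close>, \<open>hmult\<close>,
  \<open>hecke_bar\<close> and \<open>C_comb\<close>, which yields their semilinearity at
  once.\<close>

definition linear_extension :: "(laurent \<Rightarrow> laurent) \<Rightarrow> (weyl \<Rightarrow> hecke) \<Rightarrow> hecke \<Rightarrow> hecke" where
  "linear_extension \<phi> F h = (\<Sum>w\<in>Poly_Mapping.keys h. hscale (\<phi> (Poly_Mapping.lookup h w)) (F w))"

lemma linear_extension_superset:
  assumes "finite A" "Poly_Mapping.keys h \<subseteq> A" "\<phi> 0 = 0"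
  shows "linear_extension \<phi> F h = (\<Sum>w\<in>A. hscale (\<phi> (Poly_Mapping.lookup h w)) (F w))"
  unfolding linear_extension_def using assms
  by (intro sum.mono_neutral_left) (auto simp: in_keys_iff)

lemma semilinear_linear_extension:
  assumes "\<phi> 0 = 0" "\<And>a b. \<phi> (a + b) = \<phi> a + \<phi> b" "\<And>a b. \<phi> (a * b) = \<phi> a * \<phi> b"
  shows "semilinear \<phi> (linear_extension \<phi> F)"
  unfolding semilinear_def
proof (intro conjI allI)
  fix h h' :: hecke
  let ?A = "Poly_Mapping.keys h \<union> Poly_Mapping.keys h'"
  have "Poly_Mapping.keys (h + h') \<subseteq> ?A" by (rule keys_add)
  then show "linear_extension \<phi> F (h + h') = linear_extension \<phi> F h + linear_extension \<phi> F h'"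
    using linear_extension_superset[of ?A _ \<phi> F] assms
    by (simp add: lookup_add hscale_add_left sum.distrib)
next
  fix a and h :: hecke
  have "Poly_Mapping.keys (hscale a h) \<subseteq> Poly_Mapping.keys h" by (auto simp: in_keys_iff)
  then show "linear_extension \<phi> F (hscale a h) = hscale (\<phi> a) (linear_extension \<phi> F h)"
    using linear_extension_superset[of "Poly_Mapping.keys h" _ \<phi> F] assms
    by (simp add: hscale_sum hscale_hscale)
qed

lemma linear_extension_T_basis: "\<phi> 1 = 1 \<Longrightarrow> linear_extension \<phi> F (T_basis w) = F w"
  by (simp add: linear_extension_def T_basis_def)

subsection \<open>Left and right multiplication by generators\<close>

definition T_simple_image :: "gen \<Rightarrow> weyl \<Rightarrow> hecke" where
  "T_simple_image a w = (if len w < len (simple a * w) then T_basis (simple a * w)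
      else hscale (vpow 2) (T_basis (simple a * w)) + hscale (vpow 2 - 1) (T_basis w))"

lemma T_simple_mult_extension: "T_simple_mult a = linear_extension (\<lambda>a. a) (T_simple_image a)"
  by (rule ext) (simp add: T_simple_mult_def linear_extension_def T_simple_image_def)

lemma hlinear_T_simple_mult: "hlinear (T_simple_mult a)"
  unfolding T_simple_mult_extension by (rule semilinear_linear_extension) simp_all

lemma T_simple_mult_ascent: "a \<notin> descents w \<Longrightarrow> T_simple_mult a (T_basis w) = T_basis (simple a * w)"
  by (simp add: T_simple_mult_extension linear_extension_T_basis T_simple_image_def len_ascent)

lemma T_simple_mult_descent:
  "a \<in> descents w \<Longrightarrow> T_simple_mult a (T_basis w) =
     hscale (vpow 2) (T_basis (simple a * w)) + hscale (vpow 2 - 1) (T_basis w)"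
  by (simp add: T_simple_mult_extension linear_extension_T_basis T_simple_image_def descents_iff)

lemma simple_mult_neq [simp]: "simple a * w \<noteq> w" "w \<noteq> simple a * w"
  using len_simple_mult[of a w] by auto

text \<open>Only \<open>T_basis y\<close> and \<open>T_basis (simple a * y)\<close> contribute to
  the coordinate at \<open>y\<close>. In this form identities between such operators can be checked
  coordinate by coordinate.\<close>

lemma lookup_T_simple_mult:
  "Poly_Mapping.lookup (T_simple_mult a h) y =
     (if a \<in> descents y then Poly_Mapping.lookup h (simple a * y) + (vpow 2 - 1) * Poly_Mapping.lookup h y
      else vpow 2 * Poly_Mapping.lookup h (simple a * y))"
proof -
  let ?g = "\<lambda>w. Poly_Mapping.lookup h w * Poly_Mapping.lookup (T_simple_image a w) y"
  have "Poly_Mapping.lookup (T_simple_mult a h) y = (\<Sum>w\<in>Poly_Mapping.keys h. ?g w)"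
    by (simp add: T_simple_mult_extension linear_extension_def lookup_sum)
  also have "\<dots> = (\<Sum>w\<in>{simple a * y, y}. ?g w)"
  proof (rule sum.mono_neutral_cong)
    fix w assume "w \<in> Poly_Mapping.keys h - {simple a * y, y}"
    then have "w \<noteq> y" "y \<noteq> simple a * w" by auto
    then show "?g w = 0" by (simp add: T_simple_image_def lookup_T_basis lookup_add)
  qed (auto simp: in_keys_iff)
  also have "\<dots> = (if a \<in> descents y then Poly_Mapping.lookup h (simple a * y) + (vpow 2 - 1) * Poly_Mapping.lookup h y
      else vpow 2 * Poly_Mapping.lookup h (simple a * y))"
  proof (cases "a \<in> descents y")
    case True
    then show ?thesis using len_descent[OF True]
      by (simp add: T_simple_image_def lookup_T_basis lookup_add mult.commute)
  next
    case False
    then show ?thesis using len_ascent[OF False]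
      by (simp add: T_simple_image_def lookup_T_basis lookup_add mult.commute)
  qed
  finally show ?thesis .
qed

section \<open>The anti-involution inverting the index of the standard basis, and right
  multiplication\<close>

definition hinv :: "hecke \<Rightarrow> hecke" where
  "hinv h = Poly_Mapping.map_key winv h"

lemma lookup_hinv [simp]: "Poly_Mapping.lookup (hinv h) w = Poly_Mapping.lookup h (winv w)"
proof -
  have "inj winv" by (simp add: inj_def)
  then show ?thesis by (simp add: hinv_def Poly_Mapping.map_key.rep_eq)
qed

lemma hinv_hinv [simp]: "hinv (hinv h) = h"
  by (rule poly_mapping_eqI) simp

lemma hlinear_hinv: "hlinear hinv"
  unfolding semilinear_def by (auto intro!: poly_mapping_eqI simp: lookup_add)

lemma hinv_T_basis [simp]: "hinv (T_basis w) = T_basis (winv w)"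
  by (rule poly_mapping_eqI) (auto simp: lookup_T_basis when_def)

definition T_mult_simple :: "gen \<Rightarrow> hecke \<Rightarrow> hecke" where
  "T_mult_simple a h = hinv (T_simple_mult a (hinv h))"

lemma hlinear_T_mult_simple: "hlinear (T_mult_simple a)"
  unfolding T_mult_simple_def
  using semilinear_comp[OF hlinear_hinv semilinear_comp[OF hlinear_T_simple_mult hlinear_hinv]] by simp

lemma winv_simple_winv: "winv (simple a * winv y) = y * simple a"
  by (simp add: winv_mult)

lemma lookup_T_mult_simple:
  "Poly_Mapping.lookup (T_mult_simple a h) y =
     (if a \<in> descents (winv y) then Poly_Mapping.lookup h (y * simple a) + (vpow 2 - 1) * Poly_Mapping.lookup h y
      else vpow 2 * Poly_Mapping.lookup h (y * simple a))"
  by (simp add: T_mult_simple_def lookup_T_simple_mult winv_simple_winv)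

lemma right_descents_iff: "a \<in> descents (winv y) \<longleftrightarrow> len (y * simple a) < len y"
  using len_winv[of "y * simple a"] by (simp add: descents_iff winv_mult)

text \<open>Left multiplication by \<open>a\<close> shortens \<open>w b\<close>, so it deletes a
  letter from a reduced word of \<open>w\<close> followed by \<open>b\<close>. The deleted letter is
  the final \<open>b\<close>, as otherwise \<open>a w\<close> would be shorter than
  \<open>w\<close>.\<close>

lemma simple_mult_eq_mult_simple:
  assumes "a \<notin> descents w" "b \<notin> descents (winv w)" "len (simple a * w * simple b) < len w + 2"
  shows "simple a * w = w * simple b"
proof -
  have l: "len (simple a * w) = len w + 1" "len (w * simple b) = len w + 1"
    using assms len_ascent right_descents_iff[of b w] len_mult_simple[of w b] by auto
  then have l2: "len (simple a * (w * simple b)) < len (w * simple b)"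
    using len_simple_mult[of a "w * simple b"] assms(3) by (auto simp: mult.assoc)
  obtain xs where xs: "word xs = w" "length xs = len w" by (rule obtain_reduced)
  have wb: "word (xs @ [b]) = w * simple b" using xs by (simp add: word_append)
  from strong_exchange[OF simple_reflection, of a "xs @ [b]"] l2
  obtain ys c zs where d: "xs @ [b] = ys @ c # zs" "simple a * (w * simple b) = word (ys @ zs)"
    unfolding wb by blast
  show ?thesis
  proof (cases zs rule: rev_cases)
    case Nil
    then have "simple a * (w * simple b) = w" using d xs by simp
    then show ?thesis by (metis simple_cancel)
  next
    case (snoc zs' e)
    then have "simple a * (w * simple b) = word (ys @ zs') * simple b" "xs = ys @ c # zs'"
      using d by (simp_all add: word_append mult.assoc)
    then have "simple a * w = word (ys @ zs')" by (metis mult.assoc right_cancel)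
    then have "len (simple a * w) < len w" using len_word_le[of "ys @ zs'"] xs \<open>xs = _\<close> by simp
    with l show ?thesis by simp
  qed
qed

text \<open>At each coordinate \<open>w\<close>, either multiplication on one side does not affect
  the descent on the other side, and the two expressions agree term by term, or
  \<open>a w = w b\<close> and both operators involve the same two coordinates.\<close>

lemma T_simple_mult_T_mult_simple:
  "T_simple_mult a (T_mult_simple b h) = T_mult_simple b (T_simple_mult a h)"
proof (rule poly_mapping_eqI)
  fix w
  have L: "len (simple a * w) = len w + 1 \<or> len w = len (simple a * w) + 1"
    "len (w * simple b) = len w + 1 \<or> len w = len (w * simple b) + 1"
    "len (simple a * w * simple b) = len (simple a * w) + 1 \<or> len (simple a * w) = len (simple a * w * simple b) + 1"
    "len (simple a * w * simple b) = len (w * simple b) + 1 \<or> len (w * simple b) = len (simple a * w * simple b) + 1"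
    using len_simple_mult len_mult_simple by (simp_all add: mult.assoc) (metis mult.assoc)
  have D: "a \<in> descents w \<longleftrightarrow> len (simple a * w) < len w"
    "b \<in> descents (winv w) \<longleftrightarrow> len (w * simple b) < len w"
    "a \<in> descents (w * simple b) \<longleftrightarrow> len (simple a * w * simple b) < len (w * simple b)"
    "b \<in> descents (winv (simple a * w)) \<longleftrightarrow> len (simple a * w * simple b) < len (simple a * w)"
    unfolding right_descents_iff by (simp_all only: descents_iff mult.assoc)
  consider (generic) "(a \<in> descents (w * simple b) \<longleftrightarrow> a \<in> descents w)"
      "(b \<in> descents (winv (simple a * w)) \<longleftrightarrow> b \<in> descents (winv w))"
    | (eq) "simple a * w = w * simple b"
  proof (cases "a \<in> descents w"; cases "b \<in> descents (winv w)")
    assume h: "a \<notin> descents w" "b \<notin> descents (winv w)"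
    show thesis
    proof (cases "len (simple a * w * simple b) < len w + 2")
      case True
      then show thesis using that(2) simple_mult_eq_mult_simple h by blast
    next
      case False
      then show thesis using h L unfolding D by (intro that(1)[unfolded D]) arith+
    qed
  next
    assume h: "a \<in> descents w" "b \<in> descents (winv w)"
    show thesis
    proof (cases "len (simple a * w * simple b) = len w")
      case True
      \<comment> \<open>Both letters are ascents of \<open>a w\<close>, so the exchange argument
        applies to that element instead of \<open>w\<close>.\<close>
      let ?w = "simple a * w"
      have "a \<notin> descents ?w" using h by simp
      moreover have "b \<notin> descents (winv ?w)" using True h L unfolding D by arith
      moreover have "len (simple a * ?w * simple b) < len ?w + 2"
        using h L unfolding D by simp
      ultimately have "simple a * ?w = ?w * simple b" by (rule simple_mult_eq_mult_simple)
      then have "w = simple a * (w * simple b)" by (simp add: mult.assoc)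
      then have "simple a * w = w * simple b" by (metis simple_cancel)
      then show thesis by (rule that(2))
    next
      case False
      then show thesis using h L unfolding D by (intro that(1)[unfolded D]) arith+
    qed
  next
    assume h: "a \<in> descents w" "b \<notin> descents (winv w)"
    then show thesis using L unfolding D by (intro that(1)[unfolded D]) arith+
  next
    assume h: "a \<notin> descents w" "b \<in> descents (winv w)"
    then show thesis using L unfolding D by (intro that(1)[unfolded D]) arith+
  qed
  then show "Poly_Mapping.lookup (T_simple_mult a (T_mult_simple b h)) w = Poly_Mapping.lookup (T_mult_simple b (T_simple_mult a h)) w"
  proof cases
    case generic
    then show ?thesis
      by (auto simp: lookup_T_simple_mult lookup_T_mult_simple mult.assoc algebra_simps)
  next
    case eq
    then have wa: "a \<in> descents w \<longleftrightarrow> b \<in> descents (winv w)" unfolding D(1,2) by simp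
    have swb: "simple a * (w * simple b) = w" by (simp add: eq[symmetric])
    have "a \<in> descents (w * simple b) \<longleftrightarrow> a \<notin> descents w" by (simp add: eq[symmetric])
    moreover have "b \<in> descents (winv (simple a * w)) \<longleftrightarrow> b \<notin> descents (winv w)"
      using L unfolding D by (auto simp: eq mult.assoc)
    ultimately show ?thesis using wa swb eq
      by (auto simp: lookup_T_simple_mult lookup_T_mult_simple mult.assoc algebra_simps)
  qed
qed

lemma T_mult_simple_ascent: "a \<notin> descents (winv w) \<Longrightarrow> T_mult_simple a (T_basis w) = T_basis (w * simple a)"
  by (simp add: T_mult_simple_def T_simple_mult_ascent winv_mult)

text \<open>As a right module the algebra is generated by \<open>T_basis 1\<close>: for a right
  descent \<open>a\<close> of \<open>w\<close>, \<open>T_basis w\<close> arises from the shorter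
  \<open>T_basis (w * simple a)\<close> by right multiplication.\<close>

lemma right_module_map_eqI:
  assumes F: "hlinear F" "\<And>a h. F (T_mult_simple a h) = T_mult_simple a (F h)"
    and G: "hlinear G" "\<And>a h. G (T_mult_simple a h) = T_mult_simple a (G h)"
    and 1: "F (T_basis 1) = G (T_basis 1)"
  shows "F h = G h"
proof (rule semilinear_eqI[OF F(1) G(1)])
  show "F (T_basis w) = G (T_basis w)" for w
  proof (induction "len w" arbitrary: w)
    case 0
    then show ?case using 1 by simp
  next
    case (Suc n)
    then have "winv w \<noteq> 1" by (metis len_winv len_one nat.distinct(1))
    then obtain a where a: "a \<in> descents (winv w)" using descents_nonempty by blast
    define x where "x = w * simple a"
    have w: "w = x * simple a" by (simp add: x_def mult.assoc)
    have "len x = n" using Suc(2) a len_descent[OF a] len_winv[of x] by (simp add: x_def winv_mult)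
    moreover have "a \<notin> descents (winv x)" using a by (simp add: x_def winv_mult)
    ultimately show ?case
      using Suc(1) F(2) G(2) T_mult_simple_ascent w by metis
  qed
qed

subsection \<open>The product\<close>

lemma reduced_word: "reduced (reduced_word w)" "word (reduced_word w) = w"
proof -
  have "\<exists>xs. reduced xs \<and> word xs = w" using ex_reduced[of w] by (auto simp: reduced_def)
  then have "reduced (reduced_word w) \<and> word (reduced_word w) = w"
    unfolding reduced_word_def by (rule someI_ex)
  then show "reduced (reduced_word w)" "word (reduced_word w) = w" by auto
qed

lemma hlinear_foldr: "hlinear (foldr T_simple_mult xs)"
proof (induction xs)
  case (Cons a xs)
  from semilinear_comp[OF hlinear_T_simple_mult this] show ?case by (simp add: comp_def)
qed (simp add: semilinear_def)

lemma foldr_T_mult_simple: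
  "foldr T_simple_mult xs (T_mult_simple a h) = T_mult_simple a (foldr T_simple_mult xs h)"
  by (induction xs) (simp_all add: T_simple_mult_T_mult_simple)

lemma foldr_T_basis_1: "reduced xs \<Longrightarrow> foldr T_simple_mult xs (T_basis 1) = T_basis (word xs)"
proof (induction xs)
  case (Cons a xs)
  have "len (word (a # xs)) \<le> len (word xs) + 1"
    using len_mult_le[of "simple a" "word xs"] word_Cons[of a xs] by simp
  then have "reduced xs" "len (simple a * word xs) = len (word xs) + 1"
    using Cons.prems len_word_le[of xs] word_Cons[of a xs] by (simp_all add: reduced_def)
  then show ?case using Cons.IH T_simple_mult_ascent[of a "word xs"] word_Cons[of a xs]
    by (simp add: descents_iff)
qed (simp add: word_Nil)

lemma hmult_extension:
  "hmult h h' = linear_extension (\<lambda>a. a) (\<lambda>x. foldr T_simple_mult (reduced_word x) h') h"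
  by (simp add: hmult_def linear_extension_def)

lemma hlinear_hmult_left: "hlinear (\<lambda>h. hmult h h')"
  unfolding hmult_extension by (rule semilinear_linear_extension) simp_all

lemma hlinear_hmult_right: "hlinear (hmult h)"
  unfolding semilinear_def hmult_def
  by (simp add: semilinear_add[OF hlinear_foldr] semilinear_scale[OF hlinear_foldr] hscale_add
      sum.distrib hscale_sum hscale_hscale mult.commute)

lemma hmult_1_right [simp]: "hmult h (T_basis 1) = h"
  by (simp add: hmult_def foldr_T_basis_1 reduced_word hecke_expansion[symmetric])

lemma hmult_T_mult_simple: "hmult h (T_mult_simple a h') = T_mult_simple a (hmult h h')"
  by (simp add: hmult_def foldr_T_mult_simple semilinear_sum[OF hlinear_T_mult_simple]
      semilinear_scale[OF hlinear_T_mult_simple])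

lemma hmult_1_left [simp]: "hmult (T_basis 1) h = h"
  by (rule right_module_map_eqI[OF hlinear_hmult_right hmult_T_mult_simple])
     (simp_all add: semilinear_def)

text \<open>As functions of \<open>h'\<close> both sides commute with right multiplications, and
  they agree at \<open>T_basis 1\<close>.\<close>

lemma T_simple_mult_hmult: "T_simple_mult a (hmult h h') = hmult (T_simple_mult a h) h'"
proof (rule right_module_map_eqI[of "\<lambda>h'. T_simple_mult a (hmult h h')"])
  show "hlinear (\<lambda>h'. T_simple_mult a (hmult h h'))"
    using semilinear_comp[OF hlinear_T_simple_mult hlinear_hmult_right] by simp
qed (simp_all add: hmult_T_mult_simple T_simple_mult_T_mult_simple hlinear_hmult_right)

lemma hmult_assoc: "hmult (hmult h1 h2) h3 = hmult h1 (hmult h2 h3)"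
proof (rule right_module_map_eqI[of _ "\<lambda>h3. hmult h1 (hmult h2 h3)"])
  show "hlinear (\<lambda>h3. hmult h1 (hmult h2 h3))"
    using semilinear_comp[OF hlinear_hmult_right hlinear_hmult_right] by simp
qed (simp_all add: hmult_T_mult_simple hlinear_hmult_right)

lemma T_basis_simple: "T_basis (simple a) = T_simple_mult a (T_basis 1)"
  by (simp add: T_simple_mult_ascent)

lemma hmult_T_simple: "hmult (T_basis (simple a)) h = T_simple_mult a h"
  by (simp add: T_basis_simple T_simple_mult_hmult[symmetric])

text \<open>Since \<open>hinv\<close> exchanges left and right multiplication by generators,
  conjugating the left-hand product by it gives a map in \<open>h2\<close> that commutes with right
  multiplications.\<close>

lemma hinv_hmult: "hinv (hmult h1 h2) = hmult (hinv h2) (hinv h1)"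
proof -
  have "hmult h1 h2 = hinv (hmult (hinv h2) (hinv h1))"
  proof (rule right_module_map_eqI[OF hlinear_hmult_right hmult_T_mult_simple])
    show "hlinear (\<lambda>h2. hinv (hmult (hinv h2) (hinv h1)))"
      using semilinear_comp[OF hlinear_hinv semilinear_comp[OF hlinear_hmult_left hlinear_hinv]] by simp
  qed (simp_all add: T_mult_simple_def T_simple_mult_hmult)
  then show ?thesis by simp
qed

subsection \<open>The bar involution\<close>

lemma T_simple_mult_square:
  "T_simple_mult a (T_simple_mult a h) = hscale (vpow 2) h + hscale (vpow 2 - 1) (T_simple_mult a h)"
  by (rule poly_mapping_eqI) (simp add: lookup_T_simple_mult lookup_add algebra_simps)

text \<open>Left multiplication by the inverse of \<open>T_basis (simple a)\<close>, obtained by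
  solving the quadratic relation.\<close>

definition T_simple_mult_inv :: "gen \<Rightarrow> hecke \<Rightarrow> hecke" where
  "T_simple_mult_inv a h = hscale (vpow (-2)) (T_simple_mult a h) + hscale (vpow (-2) - 1) h"

lemma hlinear_T_simple_mult_inv: "hlinear (T_simple_mult_inv a)"
  unfolding T_simple_mult_inv_def semilinear_def
  by (simp add: semilinear_add[OF hlinear_T_simple_mult] semilinear_scale[OF hlinear_T_simple_mult]
      hscale_add hscale_hscale mult.commute)

lemma T_simple_mult_inv_right [simp]: "T_simple_mult a (T_simple_mult_inv a h) = h"
  unfolding T_simple_mult_inv_def semilinear_add[OF hlinear_T_simple_mult]
    semilinear_scale[OF hlinear_T_simple_mult] T_simple_mult_square
  by (rule poly_mapping_eqI)
     (simp add: lookup_add algebra_simps vpow_mult vpow_mult_assoc)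

lemma T_simple_mult_inv_left [simp]: "T_simple_mult_inv a (T_simple_mult a h) = h"
  unfolding T_simple_mult_inv_def T_simple_mult_square
  by (rule poly_mapping_eqI)
     (simp add: lookup_add algebra_simps vpow_mult vpow_mult_assoc)

lemma T_simple_mult_inv_hmult: "T_simple_mult_inv a (hmult h h') = hmult (T_simple_mult_inv a h) h'"
  by (simp add: T_simple_mult_inv_def T_simple_mult_hmult semilinear_add[OF hlinear_hmult_left]
      semilinear_scale[OF hlinear_hmult_left])

definition inverse_pair :: "hecke \<Rightarrow> hecke \<Rightarrow> bool" where
  "inverse_pair h h' \<longleftrightarrow> hmult h h' = T_basis 1 \<and> hmult h' h = T_basis 1"

lemma inverse_pair_unique: "inverse_pair h g \<Longrightarrow> inverse_pair h' g \<Longrightarrow> h = h'"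
  unfolding inverse_pair_def by (metis hmult_assoc hmult_1_left hmult_1_right)

lemma T_inverse_eqI: "inverse_pair h (T_basis w) \<Longrightarrow> T_inverse w = h"
  unfolding T_inverse_def
  by (rule the_equality) (auto simp: inverse_pair_def[symmetric] intro: inverse_pair_unique)

lemma inverse_pair_T_basis_ascent:
  assumes "inverse_pair h (T_basis (winv w))" "a \<notin> descents w"
  shows "inverse_pair (T_simple_mult_inv a h) (T_basis (winv (simple a * w)))"
proof -
  have "hinv (T_basis (simple a * w)) = hmult (T_basis (winv w)) (T_basis (simple a))"
    using T_simple_mult_ascent[OF assms(2)] hmult_T_simple[of a "T_basis w"] hinv_hmult[of "T_basis (simple a)" "T_basis w"]
    by simp
  then have T: "T_basis (winv (simple a * w)) = hmult (T_basis (winv w)) (T_basis (simple a))" by simp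
  have inv: "T_simple_mult_inv a h = hmult (T_simple_mult_inv a (T_basis 1)) h" for h
    using T_simple_mult_inv_hmult[of a "T_basis 1" h] by simp
  have l: "hmult (T_simple_mult_inv a h) (hmult (T_basis (winv w)) (T_basis (simple a))) = T_basis 1"
  proof -
    have "hmult h (hmult (T_basis (winv w)) (T_basis (simple a))) = T_basis (simple a)"
      using assms(1) by (simp add: inverse_pair_def hmult_assoc[symmetric])
    then show ?thesis by (simp add: T_simple_mult_inv_hmult[symmetric] T_basis_simple)
  qed
  have r: "hmult (hmult (T_basis (winv w)) (T_basis (simple a))) (T_simple_mult_inv a h) = T_basis 1"
    using assms(1) by (simp add: inverse_pair_def hmult_assoc hmult_T_simple)
  show ?thesis using l r T by (simp add: inverse_pair_def)
qed

lemma inverse_pair_T_inverse: "inverse_pair (T_inverse (winv w)) (T_basis (winv w))"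
proof (induction "len w" arbitrary: w)
  case 0
  have "inverse_pair (T_basis 1) (T_basis 1)" by (simp add: inverse_pair_def)
  then show ?case using 0 T_inverse_eqI by auto
next
  case (Suc n)
  then have "w \<noteq> 1" by auto
  then obtain a where a: "a \<in> descents w" using descents_nonempty by blast
  define x where "x = simple a * w"
  have x: "w = simple a * x" "a \<notin> descents x" "len x = n"
    using a Suc(2) len_descent[OF a] by (simp_all add: x_def)
  have "inverse_pair (T_simple_mult_inv a (T_inverse (winv x))) (T_basis (winv (simple a * x)))"
    using inverse_pair_T_basis_ascent Suc(1) x by blast
  then show ?case using T_inverse_eqI x(1) by auto
qed

lemma semilinear_hecke_bar: "semilinear laurent_bar hecke_bar"
proof -
  have ext: "hecke_bar = linear_extension laurent_bar (\<lambda>w. T_inverse (winv w))"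
    by (rule ext) (simp add: hecke_bar_def linear_extension_def)
  show ?thesis unfolding ext
    by (rule semilinear_linear_extension) (simp_all add: laurent_bar_add laurent_bar_mult)
qed

lemma hecke_bar_T_basis: "hecke_bar (T_basis w) = T_inverse (winv w)"
  by (simp add: hecke_bar_def T_basis_def)

lemma hecke_bar_T_basis_1 [simp]: "hecke_bar (T_basis 1) = T_basis 1"
proof -
  have "inverse_pair (T_basis 1) (T_basis 1)" by (simp add: inverse_pair_def)
  then show ?thesis by (simp add: hecke_bar_T_basis T_inverse_eqI)
qed

lemma hecke_bar_T_basis_ascent:
  "a \<notin> descents w \<Longrightarrow> hecke_bar (T_basis (simple a * w)) = T_simple_mult_inv a (hecke_bar (T_basis w))"
  unfolding hecke_bar_T_basis
  by (rule T_inverse_eqI) (rule inverse_pair_T_basis_ascent[OF inverse_pair_T_inverse])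

text \<open>This is multiplicativity of the bar involution for the left factor
  \<open>T_basis (simple a)\<close>, whose image is its inverse. A descent is reduced to the ascent
  case by passing to \<open>simple a * w\<close>.\<close>

lemma hecke_bar_T_simple_mult: "hecke_bar (T_simple_mult a h) = T_simple_mult_inv a (hecke_bar h)"
proof (rule semilinear_eqI[of laurent_bar "\<lambda>h. hecke_bar (T_simple_mult a h)" "\<lambda>h. T_simple_mult_inv a (hecke_bar h)"])
  show "semilinear laurent_bar (\<lambda>h. hecke_bar (T_simple_mult a h))"
    using semilinear_comp[OF semilinear_hecke_bar hlinear_T_simple_mult] by simp
  show "semilinear laurent_bar (\<lambda>h. T_simple_mult_inv a (hecke_bar h))"
    using semilinear_comp[OF hlinear_T_simple_mult_inv semilinear_hecke_bar] by simp
  show "hecke_bar (T_simple_mult a (T_basis w)) = T_simple_mult_inv a (hecke_bar (T_basis w))" for w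
  proof (cases "a \<in> descents w")
    case False
    then show ?thesis by (simp add: T_simple_mult_ascent hecke_bar_T_basis_ascent)
  next
    case True
    define x where "x = simple a * w"
    have x: "w = simple a * x" "a \<notin> descents x" using True by (simp_all add: x_def)
    then have "hecke_bar (T_basis x) = T_simple_mult a (hecke_bar (T_basis w))"
      by (simp add: hecke_bar_T_basis_ascent)
    then show ?thesis
      using T_simple_mult_descent[OF True] x_def
      by (simp add: semilinear_add[OF semilinear_hecke_bar] semilinear_scale[OF semilinear_hecke_bar]
          T_simple_mult_inv_def laurent_bar_diff)
  qed
qed

lemma hecke_bar_hinv: "hecke_bar (hinv h) = hinv (hecke_bar h)"
proof (rule semilinear_eqI[of laurent_bar "\<lambda>h. hecke_bar (hinv h)" "\<lambda>h. hinv (hecke_bar h)"])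
  show "semilinear laurent_bar (\<lambda>h. hecke_bar (hinv h))"
    using semilinear_comp[OF semilinear_hecke_bar hlinear_hinv] by simp
  show "semilinear laurent_bar (\<lambda>h. hinv (hecke_bar h))"
    using semilinear_comp[OF hlinear_hinv semilinear_hecke_bar] by simp
  show "hecke_bar (hinv (T_basis w)) = hinv (hecke_bar (T_basis w))" for w
  proof -
    have "inverse_pair (hinv (T_inverse (winv w))) (hinv (T_basis (winv w)))"
      using inverse_pair_T_inverse[of w] unfolding inverse_pair_def hinv_hmult[symmetric] by simp
    then show ?thesis by (simp add: hecke_bar_T_basis T_inverse_eqI)
  qed
qed

text \<open>Triangularity of the bar involution: apart from the leading term, the image of
  \<open>T_basis w\<close> involves only elements shorter than \<open>w\<close>.\<close>

lemma lookup_hecke_bar_T_basis: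
  "len w \<le> len y \<Longrightarrow> Poly_Mapping.lookup (hecke_bar (T_basis w)) y = (vpow (- 2 * int (len w)) when y = w)"
proof (induction "len w" arbitrary: w y)
  case 0
  then show ?case by (simp add: lookup_T_basis)
next
  case (Suc n)
  then have "w \<noteq> 1" by auto
  then obtain a where a: "a \<in> descents w" using descents_nonempty by blast
  define x where "x = simple a * w"
  have x: "w = simple a * x" "a \<notin> descents x" "len x = n"
    using a Suc(2) len_descent[OF a] by (simp_all add: x_def)
  let ?h = "hecke_bar (T_basis x)"
  have y0: "Poly_Mapping.lookup ?h y = 0" using Suc(1)[of x y] x Suc.prems Suc(2) by (auto simp: when_def)
  have "Poly_Mapping.lookup (hecke_bar (T_basis w)) y = vpow (-2) * Poly_Mapping.lookup (T_simple_mult a ?h) y"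
    using x y0 by (simp add: hecke_bar_T_basis_ascent T_simple_mult_inv_def lookup_add)
  also have "\<dots> = (vpow (- 2 * int (len w)) when y = w)"
  proof (cases "a \<in> descents y")
    case True
    then have "Poly_Mapping.lookup ?h (simple a * y) = (vpow (- 2 * int (len x)) when simple a * y = x)"
      using Suc x len_descent[OF True] by auto
    moreover have "vpow (-2) * vpow (- 2 * int (len x)) = vpow (- 2 * int (len w))"
      using x(3) Suc(2)[symmetric] by (simp add: vpow_mult)
    moreover have "simple a * y = x \<longleftrightarrow> y = w" using x by auto
    ultimately show ?thesis using True y0
      by (simp add: lookup_T_simple_mult when_def)
  next
    case False
    then have "Poly_Mapping.lookup ?h (simple a * y) = (vpow (- 2 * int (len x)) when simple a * y = x)"
      using Suc x len_ascent[OF False] by auto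
    moreover have "simple a * y \<noteq> x" using False Suc x len_ascent[OF False] by auto
    moreover have "y \<noteq> w" using False a by auto
    ultimately show ?thesis using False by (simp add: lookup_T_simple_mult)
  qed
  finally show ?case .
qed

text \<open>Coordinates in the normalised basis \<open>v\<^sup>-\<^sup>l\<^sup>(\<^sup>y\<^sup>) T\<^sub>y\<close>.\<close>

definition ncoeff :: "hecke \<Rightarrow> weyl \<Rightarrow> laurent" where
  "ncoeff h y = vpow (int (len y)) * Poly_Mapping.lookup h y"

lemma ncoeff_add: "ncoeff (h + h') y = ncoeff h y + ncoeff h' y"
  by (simp add: ncoeff_def lookup_add distrib_left)

lemma ncoeff_diff: "ncoeff (h - h') y = ncoeff h y - ncoeff h' y"
  by (simp add: ncoeff_def lookup_minus right_diff_distrib)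

lemma ncoeff_scale: "ncoeff (hscale a h) y = a * ncoeff h y"
  by (simp add: ncoeff_def mult.left_commute)

lemma ncoeff_sum: "ncoeff (sum f A) y = (\<Sum>x\<in>A. ncoeff (f x) y)"
  by (simp add: ncoeff_def lookup_sum sum_distrib_left)

lemma lookup_eq_ncoeff: "Poly_Mapping.lookup h y = vpow (- int (len y)) * ncoeff h y"
  by (simp add: ncoeff_def vpow_mult_assoc)

lemma ncoeff_eqI: "(\<And>y. ncoeff h y = ncoeff h' y) \<Longrightarrow> h = h'"
  by (rule poly_mapping_eqI) (simp add: lookup_eq_ncoeff)

lemma ncoeff_0 [simp]: "ncoeff 0 y = 0"
  by (simp add: ncoeff_def)

lemma ncoeff_T_basis_1: "ncoeff (T_basis 1) y = (1 when y = 1)"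
  by (simp add: ncoeff_def lookup_T_basis when_def)

lemma ncoeff_hinv: "ncoeff (hinv h) y = ncoeff h (winv y)"
  by (simp add: ncoeff_def)

section \<open>Multiplication by \<open>v^-1 (T_a + 1)\<close> and bar-invariant elements\<close>

definition C_simple_mult :: "gen \<Rightarrow> hecke \<Rightarrow> hecke" where
  "C_simple_mult a h = hscale (vpow (-1)) (T_simple_mult a h + h)"

lemma ncoeff_C_simple_mult:
  "ncoeff (C_simple_mult a h) y =
     ncoeff h (simple a * y) + vpow (if a \<in> descents y then 1 else -1) * ncoeff h y"
proof (cases "a \<in> descents y")
  case True
  then show ?thesis using len_descent[OF True]
    by (simp add: ncoeff_def C_simple_mult_def lookup_T_simple_mult lookup_add vpow_mult_assoc
        distrib_left left_diff_distrib right_diff_distrib add.commute)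
next
  case False
  then show ?thesis using len_ascent[OF False]
    by (simp add: ncoeff_def C_simple_mult_def lookup_T_simple_mult lookup_add vpow_mult_assoc
        distrib_left left_diff_distrib right_diff_distrib add.commute)
qed

lemma hlinear_C_simple_mult: "hlinear (C_simple_mult a)"
  unfolding C_simple_mult_def semilinear_def
  by (simp add: semilinear_add[OF hlinear_T_simple_mult] semilinear_scale[OF hlinear_T_simple_mult]
      hscale_add hscale_hscale mult.commute)

lemma C_simple_mult_hmult: "C_simple_mult a (hmult h h') = hmult (C_simple_mult a h) h'"
  by (simp add: C_simple_mult_def T_simple_mult_hmult semilinear_add[OF hlinear_hmult_left]
      semilinear_scale[OF hlinear_hmult_left])

lemma hecke_bar_C_simple_mult: "hecke_bar (C_simple_mult a h) = C_simple_mult a (hecke_bar h)"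
  unfolding C_simple_mult_def semilinear_scale[OF semilinear_hecke_bar]
    semilinear_add[OF semilinear_hecke_bar] hecke_bar_T_simple_mult T_simple_mult_inv_def
  by (rule poly_mapping_eqI) (simp add: lookup_add vpow_mult_assoc distrib_left left_diff_distrib right_diff_distrib)

lemma C_simple_mult_square:
  "C_simple_mult a (C_simple_mult a h) = hscale (vpow 1 + vpow (-1)) (C_simple_mult a h)"
  unfolding C_simple_mult_def semilinear_scale[OF hlinear_T_simple_mult]
    semilinear_add[OF hlinear_T_simple_mult] T_simple_mult_square
  by (rule poly_mapping_eqI) (simp add: lookup_add vpow_mult_assoc distrib_left distrib_right left_diff_distrib right_diff_distrib)

text \<open>At an element \<open>y\<close> of maximal length in the support, triangularity makes the
  normalised coordinate itself bar-invariant. Having negative exponents only, it is zero, which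
  contradicts the choice of \<open>y\<close>.\<close>

lemma bar_invariant_eq_0:
  assumes bar: "hecke_bar h = h" and neg: "\<And>y k. k \<ge> 0 \<Longrightarrow> Poly_Mapping.lookup (ncoeff h y) k = 0"
  shows "h = 0"
proof (rule ccontr)
  assume "h \<noteq> 0"
  then have ne: "Poly_Mapping.keys h \<noteq> {}" by (metis keys_zero hecke_expansion sum.empty)
  define n where "n = Max (len ` Poly_Mapping.keys h)"
  have "n \<in> len ` Poly_Mapping.keys h" unfolding n_def using ne by (intro Max_in) auto
  then obtain y where y: "y \<in> Poly_Mapping.keys h" "len y = n" by auto
  have le: "len w \<le> n" if "w \<in> Poly_Mapping.keys h" for w
    unfolding n_def using that by (intro Max_ge) auto
  have "Poly_Mapping.lookup (hecke_bar h) y = (\<Sum>w\<in>Poly_Mapping.keys h. laurent_bar (Poly_Mapping.lookup h w) * Poly_Mapping.lookup (hecke_bar (T_basis w)) y)"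
    unfolding hecke_bar_T_basis by (simp add: hecke_bar_def lookup_sum)
  also have "\<dots> = (\<Sum>w\<in>Poly_Mapping.keys h. if w = y then laurent_bar (Poly_Mapping.lookup h w) * vpow (- 2 * int n) else 0)"
    using le y by (intro sum.cong) (auto simp: lookup_hecke_bar_T_basis when_def)
  also have "\<dots> = laurent_bar (Poly_Mapping.lookup h y) * vpow (- 2 * int n)"
    using y(1) by simp
  finally have e: "Poly_Mapping.lookup h y = laurent_bar (Poly_Mapping.lookup h y) * vpow (- 2 * int n)" using bar by simp
  have "laurent_bar (ncoeff h y) = vpow (- int n) * laurent_bar (Poly_Mapping.lookup h y)"
    using y by (simp add: ncoeff_def laurent_bar_mult)
  also have "\<dots> = vpow (int n) * (laurent_bar (Poly_Mapping.lookup h y) * vpow (- 2 * int n))"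
    by (simp add: mult.commute[of "laurent_bar _"] vpow_mult_assoc)
  also have "\<dots> = ncoeff h y" using e y by (simp add: ncoeff_def)
  finally have b: "laurent_bar (ncoeff h y) = ncoeff h y" .
  have "ncoeff h y = 0"
  proof (rule poly_mapping_eqI)
    fix k
    have "Poly_Mapping.lookup (ncoeff h y) k = Poly_Mapping.lookup (ncoeff h y) (- k)"
      using b lookup_laurent_bar by metis
    then show "Poly_Mapping.lookup (ncoeff h y) k = Poly_Mapping.lookup 0 k"
      using neg[of k y] neg[of "- k" y] by (cases "k \<ge> 0") auto
  qed
  then have "Poly_Mapping.lookup h y = 0" by (simp add: lookup_eq_ncoeff)
  with y show False by (simp add: in_keys_iff)
qed

section \<open>The Kazhdan--Lusztig basis\<close>

text \<open>The last condition says that \<open>v\<^sup>l\<^sup>(\<^sup>w\<^sup>)\<^sup>-\<^sup>l\<^sup>(\<^sup>y\<^sup>)\<close> times the coefficient is a polynomial in \<open>q = v\<^sup>2\<close>.\<close>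

definition is_kl_element :: "weyl \<Rightarrow> hecke \<Rightarrow> bool" where
  "is_kl_element w C \<longleftrightarrow> hecke_bar C = C \<and> ncoeff C w = 1 \<and>
     (\<forall>y. ncoeff C y \<noteq> 0 \<longrightarrow> bruhat_le y w) \<and>
     (\<forall>y k. y \<noteq> w \<longrightarrow> 0 \<le> k \<longrightarrow> Poly_Mapping.lookup (ncoeff C y) k = 0) \<and>
     (\<forall>y k. Poly_Mapping.lookup (ncoeff C y) k \<noteq> 0 \<longrightarrow>
        int (len y) - int (len w) \<le> k \<and> even (k - (int (len y) - int (len w))))"

lemma is_kl_elementD:
  assumes "is_kl_element w C"
  shows "hecke_bar C = C" "ncoeff C w = 1" "ncoeff C y \<noteq> 0 \<Longrightarrow> bruhat_le y w"
    "y \<noteq> w \<Longrightarrow> 0 \<le> k \<Longrightarrow> Poly_Mapping.lookup (ncoeff C y) k = 0"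
    "Poly_Mapping.lookup (ncoeff C y) k \<noteq> 0 \<Longrightarrow>
        int (len y) - int (len w) \<le> k \<and> even (k - (int (len y) - int (len w)))"
  using assms unfolding is_kl_element_def by blast+

lemma is_kl_element_unique: "is_kl_element w C \<Longrightarrow> is_kl_element w C' \<Longrightarrow> C = C'"
proof -
  assume C: "is_kl_element w C" and C': "is_kl_element w C'"
  have "C - C' = 0"
  proof (rule bar_invariant_eq_0)
    show "hecke_bar (C - C') = C - C'"
      using is_kl_elementD(1)[OF C] is_kl_elementD(1)[OF C'] by (simp add: semilinear_diff[OF semilinear_hecke_bar])
    fix y and k :: int assume "k \<ge> 0"
    then show "Poly_Mapping.lookup (ncoeff (C - C') y) k = 0"
      using is_kl_elementD(2,4)[OF C] is_kl_elementD(2,4)[OF C']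
      by (cases "y = w") (simp_all add: ncoeff_diff lookup_minus)
  qed
  then show ?thesis by simp
qed

lemma is_kl_element_len_zero:
  "is_kl_element w C \<Longrightarrow> len w \<le> len y \<Longrightarrow> y \<noteq> w \<Longrightarrow> ncoeff C y = 0"
  using is_kl_elementD(3)[of w C y] bruhat_le_len[of y w] by auto

text \<open>The index set of the correction terms in the product of
  \<open>C_basis (simple a)\<close> and \<open>C_basis w\<close> for an ascent \<open>a\<close>.
  Elements whose coefficient \<open>mu_coeff\<close> is zero are kept and contribute
  nothing.\<close>

definition kl_lower :: "gen \<Rightarrow> weyl \<Rightarrow> weyl set" where
  "kl_lower a w = {z. bruhat_le z w \<and> z \<noteq> w \<and> a \<in> descents z}"

lemma finite_kl_lower: "finite (kl_lower a w)"
  by (rule finite_subset[OF _ finite_bruhat_le[of w]]) (auto simp: kl_lower_def)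

text \<open>The product is bar-invariant with leading coefficient 1, but it may have constant terms
  at smaller \<open>y\<close> with descent \<open>a\<close>, coming from \<open>v\<close> times the
  coefficient of \<open>v^-1\<close>. Subtracting the multiples \<open>m z\<close> of
  \<open>K z\<close> removes exactly these.\<close>

lemma is_kl_element_ascent:
  assumes K: "\<And>z. len z \<le> len w \<Longrightarrow> is_kl_element z (K z)" and a: "a \<notin> descents w"
  defines "m \<equiv> \<lambda>z. Poly_Mapping.lookup (ncoeff (K w) z) (-1)"
  shows "is_kl_element (simple a * w)
    (C_simple_mult a (K w) - (\<Sum>z\<in>kl_lower a w. hscale (of_int (m z)) (K z)))" (is "is_kl_element ?w ?C")
proof -
  let ?Z = "kl_lower a w"
  have KZ: "is_kl_element z (K z)" if "z \<in> ?Z" for z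
    using K that bruhat_le_len[of z w] by (auto simp: kl_lower_def)
  have Kw: "is_kl_element w (K w)" using K by simp
  have lw: "len ?w = len w + 1" using a by (rule len_ascent)
  have nc: "ncoeff ?C y = ncoeff (K w) (simple a * y) + vpow (if a \<in> descents y then 1 else -1) * ncoeff (K w) y
     - (\<Sum>z\<in>?Z. of_int (m z) * ncoeff (K z) y)" for y
    by (simp add: ncoeff_diff ncoeff_C_simple_mult ncoeff_sum ncoeff_scale)
  have lk: "Poly_Mapping.lookup (ncoeff ?C y) k = Poly_Mapping.lookup (ncoeff (K w) (simple a * y)) k
     + Poly_Mapping.lookup (ncoeff (K w) y) (if a \<in> descents y then k - 1 else k + 1)
     - (\<Sum>z\<in>?Z. m z * Poly_Mapping.lookup (ncoeff (K z) y) k)" for y k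
    by (simp add: nc lookup_minus lookup_add lookup_sum lookup_of_int_mult lookup_vpow_mult)
  have "hecke_bar ?C = ?C"
  proof -
    have "hecke_bar ?C = C_simple_mult a (hecke_bar (K w)) - (\<Sum>z\<in>?Z. hscale (of_int (m z)) (hecke_bar (K z)))"
      by (simp add: semilinear_diff[OF semilinear_hecke_bar] semilinear_sum[OF semilinear_hecke_bar]
          semilinear_scale[OF semilinear_hecke_bar] hecke_bar_C_simple_mult)
    also have "\<dots> = ?C" using is_kl_elementD(1)[OF Kw] is_kl_elementD(1)[OF KZ] by simp
    finally show ?thesis .
  qed
  moreover have "ncoeff ?C ?w = 1"
  proof -
    have "ncoeff (K w) ?w = 0" using is_kl_element_len_zero[OF Kw] lw by simp
    moreover have "ncoeff (K z) ?w = 0" if "z \<in> ?Z" for z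
    proof -
      have "len z < len ?w" using that lw bruhat_le_len[of z w] by (auto simp: kl_lower_def)
      then show ?thesis using is_kl_element_len_zero[OF KZ[OF that], of ?w] by force
    qed
    ultimately show ?thesis using is_kl_elementD(2)[OF Kw] by (simp add: nc)
  qed
  moreover have "bruhat_le y ?w" if "ncoeff ?C y \<noteq> 0" for y
  proof -
    have "ncoeff (K w) (simple a * y) \<noteq> 0 \<or> ncoeff (K w) y \<noteq> 0 \<or> (\<exists>z\<in>?Z. ncoeff (K z) y \<noteq> 0)"
    proof (rule ccontr)
      assume n: "\<not> ?thesis"
      then have "(\<Sum>z\<in>?Z. of_int (m z) * ncoeff (K z) y) = 0" by (intro sum.neutral) auto
      with n that show False unfolding nc by simp
    qed
    then show ?thesis
    proof (elim disjE bexE)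
      assume "ncoeff (K w) (simple a * y) \<noteq> 0"
      then have "bruhat_le (simple a * y) w" using is_kl_elementD(3)[OF Kw] by blast
      from bruhat_le_ascent(2)[OF this a] show ?thesis by simp
    next
      assume "ncoeff (K w) y \<noteq> 0"
      then show ?thesis using is_kl_elementD(3)[OF Kw] bruhat_le_ascent(1)[OF _ a] by blast
    next
      fix z assume z: "z \<in> ?Z" "ncoeff (K z) y \<noteq> 0"
      then have "bruhat_le y z" using is_kl_elementD(3)[OF KZ] by blast
      moreover have "bruhat_le z w" using z by (simp add: kl_lower_def)
      ultimately show ?thesis using bruhat_le_ascent(1)[OF _ a] bruhat_le_trans by blast
    qed
  qed
  moreover have "Poly_Mapping.lookup (ncoeff ?C y) k = 0" if y: "y \<noteq> ?w" and k: "0 \<le> k" for y k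
  proof -
    \<comment> \<open>In nonnegative degree \<open>K z\<close> has a single nonzero coefficient, the
      constant 1 at \<open>z\<close>, so only \<open>z = y\<close> and \<open>k = 0\<close>
      survive.\<close>
    have "(\<Sum>z\<in>?Z. m z * Poly_Mapping.lookup (ncoeff (K z) y) k) = (\<Sum>z\<in>?Z. if z = y then (if k = 0 then m y else 0) else 0)"
    proof (rule sum.cong)
      fix z assume z: "z \<in> ?Z"
      show "m z * Poly_Mapping.lookup (ncoeff (K z) y) k = (if z = y then (if k = 0 then m y else 0) else 0)"
        using is_kl_elementD(2,4)[OF KZ[OF z]] k by (auto simp: lookup_one when_def)
    qed simp
    also have "\<dots> = (if y \<in> ?Z \<and> k = 0 then m y else 0)"
      using finite_kl_lower by simp
    finally have S: "(\<Sum>z\<in>?Z. m z * Poly_Mapping.lookup (ncoeff (K z) y) k) = (if y \<in> ?Z \<and> k = 0 then m y else 0)" .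
    have ay: "simple a * y \<noteq> w" using y by auto
    have f: "Poly_Mapping.lookup (ncoeff (K w) (simple a * y)) k = 0" using is_kl_elementD(4)[OF Kw ay k] .
    show ?thesis
    proof (cases "a \<in> descents y")
      case True
      then have yw: "y \<noteq> w" using a by auto
      \<comment> \<open>Degree 0 of the product reads off degree -1 of \<open>K w\<close>; outside
        \<open>?Z\<close> that coordinate is zero by the support condition.\<close>
      have "Poly_Mapping.lookup (ncoeff (K w) y) (k - 1) = (if y \<in> ?Z \<and> k = 0 then m y else 0)"
      proof (cases "k = 0")
        case k0: True
        show ?thesis
        proof (cases "y \<in> ?Z")
          case False
          then have "\<not> bruhat_le y w" using True yw by (simp add: kl_lower_def)
          then have "ncoeff (K w) y = 0" using is_kl_elementD(3)[OF Kw] by blast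
          then show ?thesis using False by simp
        qed (simp add: k0 m_def)
      qed (use is_kl_elementD(4)[OF Kw yw, of "k - 1"] k in simp)
      then show ?thesis using f S True unfolding lk by simp
    next
      case False
      then have "y \<notin> ?Z" by (simp add: kl_lower_def)
      moreover have "Poly_Mapping.lookup (ncoeff (K w) y) (k + 1) = 0"
        using is_kl_elementD(2)[OF Kw] is_kl_elementD(4)[OF Kw, of y "k + 1"] k
        by (cases "y = w") (auto simp: lookup_one when_def)
      ultimately show ?thesis using f S False unfolding lk by simp
    qed
  qed
  moreover have "int (len y) - int (len ?w) \<le> k \<and> even (k - (int (len y) - int (len ?w)))"
    if nz: "Poly_Mapping.lookup (ncoeff ?C y) k \<noteq> 0" for y k
  proof -
    let ?k = "if a \<in> descents y then k - 1 else k + 1"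
    have "Poly_Mapping.lookup (ncoeff (K w) (simple a * y)) k \<noteq> 0 \<or> Poly_Mapping.lookup (ncoeff (K w) y) ?k \<noteq> 0
       \<or> (\<exists>z\<in>?Z. m z * Poly_Mapping.lookup (ncoeff (K z) y) k \<noteq> 0)"
    proof (rule ccontr)
      assume n: "\<not> ?thesis"
      then have "(\<Sum>z\<in>?Z. m z * Poly_Mapping.lookup (ncoeff (K z) y) k) = 0" by (intro sum.neutral) auto
      with n nz show False unfolding lk by simp
    qed
    then show ?thesis
    proof (elim disjE bexE)
      assume "Poly_Mapping.lookup (ncoeff (K w) (simple a * y)) k \<noteq> 0"
      from is_kl_elementD(5)[OF Kw this] lw len_simple_mult[of a y] show ?thesis
        by (elim disjE) (simp_all, presburger+)
    next
      assume "Poly_Mapping.lookup (ncoeff (K w) y) ?k \<noteq> 0"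
      from is_kl_elementD(5)[OF Kw this] lw show ?thesis
        by (cases "a \<in> descents y") (simp_all, presburger+)
    next
      fix z assume z: "z \<in> ?Z" "m z * Poly_Mapping.lookup (ncoeff (K z) y) k \<noteq> 0"
      \<comment> \<open>A nonzero \<open>m z\<close> forces \<open>len w - len z\<close> to be odd
        and positive, so the bound and the parity relative to \<open>z\<close> carry over to
        \<open>simple a * w\<close>.\<close>
      then have "Poly_Mapping.lookup (ncoeff (K w) z) (-1) \<noteq> 0" "Poly_Mapping.lookup (ncoeff (K z) y) k \<noteq> 0"
        by (auto simp: m_def)
      from is_kl_elementD(5)[OF Kw this(1)] is_kl_elementD(5)[OF KZ[OF z(1)] this(2)] lw
      show ?thesis by simp
    qed
  qed
  ultimately show ?thesis unfolding is_kl_element_def by blast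
qed

lemma is_kl_element_one: "is_kl_element 1 (T_basis 1)"
  unfolding is_kl_element_def by (auto simp: ncoeff_T_basis_1 when_def lookup_one)

lemma is_kl_element_exists: "\<exists>C. is_kl_element w C"
proof (induction "len w" arbitrary: w rule: less_induct)
  case less
  show ?case
  proof (cases "w = 1")
    case True
    then show ?thesis using is_kl_element_one by blast
  next
    case False
    then obtain a where a: "a \<in> descents w" using descents_nonempty by blast
    define x where "x = simple a * w"
    have x: "w = simple a * x" "a \<notin> descents x" "len x < len w"
      using a len_descent[OF a] by (simp_all add: x_def)
    define K where "K z = (SOME C. is_kl_element z C)" for z
    have "is_kl_element z (K z)" if "len z \<le> len x" for z
      unfolding K_def using less[of z] that x(3) by (auto intro: someI_ex)
    from is_kl_element_ascent[of x K, OF this x(2)] x(1) show ?thesis by auto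
  qed
qed

subsection \<open>Kazhdan--Lusztig polynomials\<close>

lemma lookup_poly_in_q:
  "Poly_Mapping.lookup (poly_in_q p) k = (if 0 \<le> k \<and> even k then coeff p (nat (k div 2)) else 0)"
proof -
  have "Poly_Mapping.lookup (poly_in_q p) k = (\<Sum>i\<le>degree p. if 2 * int i = k then coeff p i else 0)"
    unfolding poly_in_q_def lookup_sum by (intro sum.cong) (auto simp: lookup_single when_def)
  also have "\<dots> = (if 0 \<le> k \<and> even k then coeff p (nat (k div 2)) else 0)"
  proof (cases "0 \<le> k \<and> even k")
    case True
    then have e: "2 * int i = k \<longleftrightarrow> i = nat (k div 2)" for i by auto
    show ?thesis using True unfolding e by (simp add: coeff_eq_0)
  next
    case False
    then have "2 * int i \<noteq> k" for i by auto
    then show ?thesis using False by auto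
  qed
  finally show ?thesis .
qed

lemma poly_in_q_0 [simp]: "poly_in_q 0 = 0"
  by (simp add: poly_in_q_def)

lemma kl_family_0: "is_kl_family P \<Longrightarrow> \<not> bruhat_le y w \<Longrightarrow> P y w = 0"
  by (simp add: is_kl_family_def)

lemma lookup_kl_element:
  assumes "\<And>y. \<not> bruhat_le y w \<Longrightarrow> P y w = 0"
  shows "Poly_Mapping.lookup (kl_element P w) y = vpow (- int (len w)) * poly_in_q (P y w)"
proof -
  have "(\<Sum>x\<in>{y. bruhat_le y w}. poly_in_q (P x w) * Poly_Mapping.lookup (T_basis x) y) =
    (\<Sum>x\<in>{y. bruhat_le y w}. if x = y then poly_in_q (P x w) else 0)"
    by (intro sum.cong) (auto simp: lookup_T_basis when_def)
  also have "\<dots> = (if bruhat_le y w then poly_in_q (P y w) else 0)"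
    using finite_bruhat_le by simp
  also have "\<dots> = poly_in_q (P y w)"
    using assms by simp
  finally show ?thesis by (simp add: kl_element_def lookup_sum)
qed

lemma ncoeff_kl_element:
  assumes "\<And>y. \<not> bruhat_le y w \<Longrightarrow> P y w = 0"
  shows "ncoeff (kl_element P w) y = vpow (int (len y) - int (len w)) * poly_in_q (P y w)"
  using lookup_kl_element[of w P y] assms by (simp add: ncoeff_def vpow_mult_assoc)

text \<open>After the shift by \<open>len y - len w\<close>, the degree bound on
  \<open>P y w\<close> says that no nonnegative exponent occurs.\<close>

lemma kl_family_element:
  assumes P: "is_kl_family P" shows "is_kl_element w (kl_element P w)"
proof -
  have nc: "ncoeff (kl_element P w) y = vpow (int (len y) - int (len w)) * poly_in_q (P y w)" for y
    by (rule ncoeff_kl_element) (rule kl_family_0[OF P])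
  have lk: "Poly_Mapping.lookup (ncoeff (kl_element P w) y) k = 
    Poly_Mapping.lookup (poly_in_q (P y w)) (k - (int (len y) - int (len w)))" for y k
    by (simp add: nc lookup_vpow_mult)
  have "ncoeff (kl_element P w) w = 1"
    using P unfolding is_kl_family_def nc
    by (intro poly_mapping_eqI) (auto simp: lookup_poly_in_q lookup_one when_def)
  moreover have le: "bruhat_le y w" if "ncoeff (kl_element P w) y \<noteq> 0" for y
    using that kl_family_0[OF P] unfolding nc by fastforce
  moreover have "Poly_Mapping.lookup (ncoeff (kl_element P w) y) k = 0" if "y \<noteq> w" "0 \<le> k" for y k
  proof (cases "bruhat_le y w")
    case True
    then have "len y < len w" using bruhat_le_len that by blast
    moreover have "2 * degree (P y w) + 1 \<le> len w - len y"
      using P True that unfolding is_kl_family_def by (auto simp: bruhat_less_def)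
    ultimately have "2 * int (degree (P y w)) + 1 \<le> k - (int (len y) - int (len w))"
      using \<open>0 \<le> k\<close> by linarith
    moreover have "d < nat (e div 2)" if "2 * int d + 1 \<le> e" "even e" for d e
      using that by (auto elim!: evenE)
    ultimately have "degree (P y w) < nat ((k - (int (len y) - int (len w))) div 2)"
      if "even (k - (int (len y) - int (len w)))"
      using that by blast
    then show ?thesis unfolding lk lookup_poly_in_q by (auto simp: coeff_eq_0)
  next
    case False
    then have "ncoeff (kl_element P w) y = 0" using le by blast
    then show ?thesis by simp
  qed
  ultimately show ?thesis
    using P unfolding is_kl_element_def is_kl_family_def lk by (auto simp: lookup_poly_in_q split: if_splits)
qed

lemma poly_in_q_inj: "poly_in_q p = poly_in_q r \<Longrightarrow> p = r"
proof (rule poly_eqI)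
  fix n assume "poly_in_q p = poly_in_q r"
  then have "Poly_Mapping.lookup (poly_in_q p) (2 * int n) = Poly_Mapping.lookup (poly_in_q r) (2 * int n)" by simp
  then show "coeff p n = coeff r n" by (simp add: lookup_poly_in_q)
qed

lemma vpow_cancel: "vpow k * p = vpow k * q \<longleftrightarrow> p = q"
  by (metis add.right_inverse mult_1 vpow_0 vpow_mult_assoc add.commute)

lemma kl_family_unique: "is_kl_family P \<Longrightarrow> is_kl_family Q \<Longrightarrow> P = Q"
proof (intro ext)
  fix y w assume PQ: "is_kl_family P" "is_kl_family Q"
  then have "kl_element P w = kl_element Q w" using kl_family_element is_kl_element_unique by blast
  then have "vpow (- int (len w)) * poly_in_q (P y w) = vpow (- int (len w)) * poly_in_q (Q y w)"
    using lookup_kl_element[of w P y, OF kl_family_0[OF PQ(1)]]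
      lookup_kl_element[of w Q y, OF kl_family_0[OF PQ(2)]] by metis
  then show "P y w = Q y w" using vpow_cancel poly_in_q_inj by blast
qed

lemma kl_family_exists: "\<exists>P. is_kl_family P"
proof -
  define K where "K w = (SOME C. is_kl_element w C)" for w
  have K: "is_kl_element w (K w)" for w
    unfolding K_def using is_kl_element_exists by (rule someI_ex)
  define c where "c y w i = Poly_Mapping.lookup (ncoeff (K w) y) (2 * int i + (int (len y) - int (len w)))" for y w i
  \<comment> \<open>The cut-off at \<open>len w\<close> loses nothing: for larger \<open>i\<close>
    the exponent in \<open>c y w i\<close> is positive, so the coefficient is zero.\<close>
  define P where "P y w = (\<Sum>i\<le>len w. monom (c y w i) i)" for y w
  have coeff_P: "coeff (P y w) i = c y w i" for y w i
  proof (cases "i \<le> len w")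
    case False
    then have "c y w i = 0" unfolding c_def
      using is_kl_elementD(2)[OF K[of w]] is_kl_elementD(4)[OF K[of w], of y]
      by (cases "y = w") (auto simp: lookup_one when_def)
    then show ?thesis using False by (simp add: P_def coeff_sum)
  qed (simp add: P_def coeff_sum)
  have PqK: "poly_in_q (P y w) = vpow (int (len w) - int (len y)) * ncoeff (K w) y" for y w
  proof (rule poly_mapping_eqI)
    fix k
    let ?k = "k + (int (len y) - int (len w))"
    have "Poly_Mapping.lookup (ncoeff (K w) y) ?k = (if 0 \<le> k \<and> even k then c y w (nat (k div 2)) else 0)"
      using is_kl_elementD(5)[OF K[of w], of y ?k] unfolding c_def by auto
    then show "Poly_Mapping.lookup (poly_in_q (P y w)) k = Poly_Mapping.lookup (vpow (int (len w) - int (len y)) * ncoeff (K w) y) k"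
      unfolding lookup_poly_in_q lookup_vpow_mult coeff_P
      by (simp add: algebra_simps)
  qed
  have P0: "P y w = 0" if "\<not> bruhat_le y w" for y w
  proof (rule poly_eqI)
    have "ncoeff (K w) y = 0" using that is_kl_elementD(3)[OF K] by blast
    then show "coeff (P y w) n = coeff 0 n" for n by (simp add: coeff_P c_def)
  qed
  have kl: "kl_element P w = K w" for w
    by (rule ncoeff_eqI) (simp add: ncoeff_kl_element P0 PqK vpow_mult_assoc)
  have "P w w = 1" for w
    by (rule poly_eqI) (auto simp: coeff_P c_def is_kl_elementD(2)[OF K] lookup_one when_def coeff_1)
  moreover have "2 * degree (P y w) + 1 \<le> len w - len y" if yw: "bruhat_less y w" for y w
  proof (cases "P y w = 0")
    case True
    then show ?thesis using yw bruhat_le_len[of y w] by (auto simp: bruhat_less_def)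
  next
    case False
    then have "c y w (degree (P y w)) \<noteq> 0" by (metis coeff_P leading_coeff_0_iff)
    then have "2 * int (degree (P y w)) + (int (len y) - int (len w)) < 0"
      unfolding c_def using is_kl_elementD(4)[OF K[of w]] yw unfolding bruhat_less_def by (meson not_less)
    then show ?thesis by linarith
  qed
  moreover have "hecke_bar (kl_element P w) = kl_element P w" for w
    using is_kl_elementD(1)[OF K] by (simp add: kl)
  ultimately have "is_kl_family P" using P0 unfolding is_kl_family_def by blast
  then show ?thesis by blast
qed

lemma is_kl_family_KL: "is_kl_family KL"
proof -
  obtain P where P: "is_kl_family P" using kl_family_exists by blast
  have "KL = P" unfolding KL_def
    by (rule the_equality[where P = is_kl_family and a = P, OF P kl_family_unique[OF _ P]])
  with P show ?thesis by simp
qed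

lemma C_basis: "is_kl_element w (C_basis w)"
  unfolding C_basis_def by (rule kl_family_element[OF is_kl_family_KL])

lemma C_basis_eqI: "is_kl_element w C \<Longrightarrow> C_basis w = C"
  using C_basis is_kl_element_unique by blast

section \<open>Normalised coefficients and the numbers mu\<close>

definition kl_coeff :: "weyl \<Rightarrow> weyl \<Rightarrow> laurent" where
  "kl_coeff y w = ncoeff (C_basis w) y"

definition mu_coeff :: "weyl \<Rightarrow> weyl \<Rightarrow> int" where
  "mu_coeff y w = Poly_Mapping.lookup (kl_coeff y w) (-1)"

lemma kl_coeff_self [simp]: "kl_coeff w w = 1"
  unfolding kl_coeff_def by (rule is_kl_elementD(2)[OF C_basis])

lemma kl_coeff_neg: "y \<noteq> w \<Longrightarrow> 0 \<le> k \<Longrightarrow> Poly_Mapping.lookup (kl_coeff y w) k = 0"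
  unfolding kl_coeff_def by (rule is_kl_elementD(4)[OF C_basis])

lemma kl_coeff_len_zero: "len w \<le> len y \<Longrightarrow> y \<noteq> w \<Longrightarrow> kl_coeff y w = 0"
  unfolding kl_coeff_def by (rule is_kl_element_len_zero[OF C_basis])

text \<open>Since \<open>kl_coeff u w\<close> is \<open>poly_in_q (KL u w)\<close> shifted by
  \<open>len u - len w\<close>, its exponent -1 corresponds to \<open>len w - len u - 1\<close>. As
  \<open>poly_in_q\<close> has even exponents only, the wrong parity gives the default value 0 of
  \<open>mu\<close>.\<close>

lemma mu_eq_mu_coeff:
  assumes "len u < len w" shows "mu u w = mu_coeff u w"
proof -
  have lk: "mu_coeff u w = Poly_Mapping.lookup (poly_in_q (KL u w)) (int (len w) - int (len u) - 1)"
  proof -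
    have e: "-1 - (int (len u) - int (len w)) = int (len w) - int (len u) - 1" by simp
    have "ncoeff (kl_element KL w) u = vpow (int (len u) - int (len w)) * poly_in_q (KL u w)"
      by (rule ncoeff_kl_element) (rule kl_family_0[OF is_kl_family_KL])
    then show ?thesis unfolding mu_coeff_def kl_coeff_def C_basis_def
      by (simp add: lookup_vpow_mult e del: diff_diff_eq2)
  qed
  define n where "n = len w - len u - 1"
  have n: "int (len w) - int (len u) - 1 = int n" "odd (len w - len u) \<longleftrightarrow> even n"
    using assms by (auto simp: n_def)
  have "nat (int n div 2) = n div 2" by (metis nat_int of_nat_numeral zdiv_int)
  then show ?thesis unfolding lk n(1) lookup_poly_in_q mu_def n(2) by (simp add: n_def)
qed

lemma kl_lower_mu: "z \<in> kl_lower a w \<Longrightarrow> z \<noteq> w" "z \<in> kl_lower a w \<Longrightarrow> a \<in> descents z"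
  by (simp_all add: kl_lower_def)

lemma kl_lower_len: "z \<in> kl_lower a w \<Longrightarrow> len z < len w"
  using bruhat_le_len[of z w] by (auto simp: kl_lower_def)

lemma C_simple_mult_ascent:
  assumes "a \<notin> descents w"
  shows "C_simple_mult a (C_basis w) = C_basis (simple a * w) +
    (\<Sum>z\<in>kl_lower a w. hscale (of_int (mu_coeff z w)) (C_basis z))"
  using C_basis_eqI[OF is_kl_element_ascent[of w C_basis a, OF C_basis assms]]
  by (simp add: mu_coeff_def kl_coeff_def)

text \<open>By the recursion \<open>C_basis w\<close> is a product with left factor
  \<open>C_basis (simple a)\<close> minus shorter terms with descent \<open>a\<close>. The first
  part is an eigenvector because the operator squares to a multiple of itself, the others by
  induction.\<close>

lemma C_simple_mult_descent:
  "a \<in> descents w \<Longrightarrow> C_simple_mult a (C_basis w) = hscale (vpow 1 + vpow (-1)) (C_basis w)"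
proof (induction "len w" arbitrary: w rule: less_induct)
  case less
  define x where "x = simple a * w"
  have x: "w = simple a * x" "a \<notin> descents x" "len x < len w"
    using less.prems len_descent[OF less.prems] by (simp_all add: x_def)
  let ?S = "\<Sum>z\<in>kl_lower a x. hscale (of_int (mu_coeff z x)) (C_basis z)"
  have Cw: "C_basis w = C_simple_mult a (C_basis x) - ?S"
    using C_simple_mult_ascent[OF x(2)] x(1) by simp
  have "C_simple_mult a ?S = (\<Sum>z\<in>kl_lower a x. hscale (of_int (mu_coeff z x)) (C_simple_mult a (C_basis z)))"
    by (simp add: semilinear_sum[OF hlinear_C_simple_mult] semilinear_scale[OF hlinear_C_simple_mult])
  also have "\<dots> = (\<Sum>z\<in>kl_lower a x. hscale (of_int (mu_coeff z x)) (hscale (vpow 1 + vpow (-1)) (C_basis z)))"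
  proof (rule sum.cong)
    fix z assume z: "z \<in> kl_lower a x"
    then have "len z < len w" using kl_lower_len x(3) by fastforce
    then show "hscale (of_int (mu_coeff z x)) (C_simple_mult a (C_basis z)) =
      hscale (of_int (mu_coeff z x)) (hscale (vpow 1 + vpow (-1)) (C_basis z))"
      using less.hyps[of z] kl_lower_mu(2)[OF z] by simp
  qed simp
  also have "\<dots> = hscale (vpow 1 + vpow (-1)) ?S"
    by (simp add: hscale_sum hscale_hscale mult.commute)
  finally show ?case unfolding Cw
    by (simp add: semilinear_diff[OF hlinear_C_simple_mult] C_simple_mult_square hscale_diff)
qed

text \<open>Compare the coordinates at \<open>y\<close> on both sides of the eigenvector equation
  \<open>C_simple_mult_descent\<close>.\<close>

lemma kl_coeff_ascent:
  assumes "a \<in> descents w" "a \<notin> descents y"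
  shows "kl_coeff y w = vpow (-1) * kl_coeff (simple a * y) w"
proof -
  have "ncoeff (C_simple_mult a (C_basis w)) y = (vpow 1 + vpow (-1)) * kl_coeff y w"
    using C_simple_mult_descent[OF assms(1)] by (simp add: ncoeff_scale kl_coeff_def)
  then have "kl_coeff (simple a * y) w = vpow 1 * kl_coeff y w"
    using assms(2) by (simp add: ncoeff_C_simple_mult kl_coeff_def distrib_right)
  then show ?thesis by (simp add: vpow_mult_assoc)
qed

lemma mu_coeff_eq_0_if_descent:
  assumes "a \<in> descents w" "a \<notin> descents y" "simple a * y \<noteq> w"
  shows "mu_coeff y w = 0"
  using kl_coeff_neg[OF assms(3), of 0] by (simp add: mu_coeff_def kl_coeff_ascent[OF assms(1,2)] lookup_vpow_mult)

lemma C_basis_winv: "C_basis (winv w) = hinv (C_basis w)"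
proof (rule C_basis_eqI)
  show "is_kl_element (winv w) (hinv (C_basis w))"
    unfolding is_kl_element_def
  proof (intro conjI allI impI)
    show "hecke_bar (hinv (C_basis w)) = hinv (C_basis w)"
      by (simp add: hecke_bar_hinv is_kl_elementD(1)[OF C_basis])
    show "ncoeff (hinv (C_basis w)) (winv w) = 1"
      by (simp add: ncoeff_hinv is_kl_elementD(2)[OF C_basis])
    fix y assume "ncoeff (hinv (C_basis w)) y \<noteq> 0"
    then have "bruhat_le (winv y) w" using is_kl_elementD(3)[OF C_basis] by (simp add: ncoeff_hinv)
    then show "bruhat_le y (winv w)" using bruhat_le_winv[of "winv y" w] by simp
  next
    fix y and k :: int assume "y \<noteq> winv w" "0 \<le> k"
    moreover from this have "winv y \<noteq> w" by auto
    ultimately show "Poly_Mapping.lookup (ncoeff (hinv (C_basis w)) y) k = 0"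
      using is_kl_elementD(4)[OF C_basis, of "winv y" w k] by (auto simp: ncoeff_hinv)
  next
    fix y and k :: int assume "Poly_Mapping.lookup (ncoeff (hinv (C_basis w)) y) k \<noteq> 0"
    then show "int (len y) - int (len (winv w)) \<le> k" "even (k - (int (len y) - int (len (winv w))))"
      using is_kl_elementD(5)[OF C_basis, of w "winv y" k] by (auto simp: ncoeff_hinv)
  qed
qed

lemma kl_coeff_winv: "kl_coeff (winv y) (winv w) = kl_coeff y w"
  by (simp add: kl_coeff_def C_basis_winv ncoeff_hinv)

text \<open>The Kazhdan-Lusztig polynomial is 1 in length difference one. Take a left descent
  \<open>a\<close> of \<open>w\<close>: if it is an ascent of \<open>u\<close>, then
  \<open>w = a u\<close> by lifting; otherwise \<open>a\<close> is removed from both, and all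
  correction terms vanish at \<open>u\<close> for reasons of length.\<close>

lemma kl_coeff_bruhat_step:
  "bruhat_step u w \<Longrightarrow> len w = len u + 1 \<Longrightarrow> kl_coeff u w = vpow (-1)"
proof (induction "len w" arbitrary: u w rule: less_induct)
  case less
  have "w \<noteq> 1" using less.prems by auto
  then obtain a where a: "a \<in> descents w" using descents_nonempty by blast
  show ?case
  proof (cases "a \<in> descents u")
    case False
    have "simple a * u = w"
      using bruhat_step_simple_mult[OF less.prems(1), of a] bruhat_step_len[of "simple a * u" "simple a * w"]
        len_descent[OF a] len_ascent[OF False] less.prems(2) by auto
    then show ?thesis using kl_coeff_ascent[OF a False] by simp
  next
    case True
    define x where "x = simple a * w"
    have x: "w = simple a * x" "a \<notin> descents x" "len w = len x + 1"
      using a len_descent[OF a] by (simp_all add: x_def)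
    have lu: "len u = len (simple a * u) + 1" by (rule len_descent[OF True])
    have "simple a * u \<noteq> w" using lu less.prems(2) by auto
    then have "bruhat_step (simple a * u) x"
      using bruhat_step_simple_mult[OF less.prems(1), of a] x_def by simp
    then have IH: "kl_coeff (simple a * u) x = vpow (-1)"
      using less.hyps[of x "simple a * u"] x lu less.prems(2) by simp
    have ux: "kl_coeff u x = 0"
      using kl_coeff_len_zero[of x u] x less.prems(2) True by auto
    have "kl_coeff u z = 0" if "z \<in> kl_lower a x" for z
      using kl_coeff_len_zero[of z u] kl_lower_len[OF that] x less.prems(2) by auto
    then have "kl_coeff u w = ncoeff (C_simple_mult a (C_basis x)) u"
      using C_simple_mult_ascent[OF x(2)] x(1)
      by (simp add: ncoeff_add ncoeff_sum ncoeff_scale kl_coeff_def)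
    also have "\<dots> = vpow (-1)"
      using IH ux by (simp add: ncoeff_C_simple_mult kl_coeff_def)
    finally show ?thesis .
  qed
qed

lemma mu_coeff_len_1: "bruhat_le u w \<Longrightarrow> len w = len u + 1 \<Longrightarrow> mu_coeff u w = 1"
  using kl_coeff_bruhat_step bruhat_le_imp_step by (simp add: mu_coeff_def lookup_vpow)

subsection \<open>Coordinates in the Kazhdan--Lusztig basis\<close>

text \<open>The argument is read as a family of coordinates in the Kazhdan-Lusztig basis, not as an
  element of the algebra; \<open>C_coord\<close> is the inverse map.\<close>

definition C_comb :: "hecke \<Rightarrow> hecke" where
  "C_comb = linear_extension (\<lambda>a. a) C_basis"

lemma hlinear_C_comb: "hlinear C_comb"
  unfolding C_comb_def by (rule semilinear_linear_extension) simp_all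

lemma C_comb_T_basis [simp]: "C_comb (T_basis w) = C_basis w"
  by (simp add: C_comb_def linear_extension_T_basis)

text \<open>Triangularity: at a longest element of the support no other basis element
  contributes.\<close>

lemma C_comb_eq_0:
  assumes "C_comb h = 0" shows "h = 0"
proof (rule ccontr)
  assume "h \<noteq> 0"
  then have ne: "Poly_Mapping.keys h \<noteq> {}" by (metis keys_zero hecke_expansion sum.empty)
  define n where "n = Max (len ` Poly_Mapping.keys h)"
  have "n \<in> len ` Poly_Mapping.keys h" unfolding n_def using ne by (intro Max_in) auto
  then obtain y where y: "y \<in> Poly_Mapping.keys h" "len y = n" by auto
  have le: "len w \<le> n" if "w \<in> Poly_Mapping.keys h" for w
    unfolding n_def using that by (intro Max_ge) auto
  have "ncoeff (C_comb h) y = (\<Sum>w\<in>Poly_Mapping.keys h. Poly_Mapping.lookup h w * kl_coeff y w)"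
    by (simp add: C_comb_def linear_extension_def ncoeff_sum ncoeff_scale kl_coeff_def)
  also have "\<dots> = (\<Sum>w\<in>Poly_Mapping.keys h. if w = y then Poly_Mapping.lookup h w else 0)"
    using le y by (intro sum.cong) (auto simp: kl_coeff_len_zero)
  also have "\<dots> = Poly_Mapping.lookup h y" using y by simp
  finally show False using assms y by (simp add: in_keys_iff)
qed

lemma C_comb_inj: "C_comb h = C_comb h' \<longleftrightarrow> h = h'"
  using C_comb_eq_0[of "h - h'"] by (auto simp: semilinear_diff[OF hlinear_C_comb])

text \<open>By induction on length, since \<open>T_basis w\<close> and the rescaled
  \<open>C_basis w\<close> differ by a combination of shorter \<open>T_basis\<close>
  elements.\<close>

lemma C_comb_surj: "\<exists>h. C_comb h = g"
proof -
  have lin: "(\<exists>h. C_comb h = (\<Sum>w\<in>A. hscale (c w) (f w)))" if "\<And>w. w \<in> A \<Longrightarrow> \<exists>h. C_comb h = f w" for A :: "weyl set" and c f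
  proof -
    from that obtain H where "\<And>w. w \<in> A \<Longrightarrow> C_comb (H w) = f w" by metis
    then have "C_comb (\<Sum>w\<in>A. hscale (c w) (H w)) = (\<Sum>w\<in>A. hscale (c w) (f w))"
      by (simp add: semilinear_sum[OF hlinear_C_comb] semilinear_scale[OF hlinear_C_comb])
    then show ?thesis by blast
  qed
  have T: "\<exists>h. C_comb h = T_basis w" for w
  proof (induction "len w" arbitrary: w rule: less_induct)
    case less
    let ?D = "hscale (vpow (int (len w))) (C_basis w) - T_basis w"
    have k: "len y < len w" if "y \<in> Poly_Mapping.keys ?D" for y
    proof (rule ccontr)
      assume "\<not> len y < len w"
      then have "kl_coeff y w = (1 when y = w)" using kl_coeff_len_zero[of w y] by (cases "y = w") auto
      then have "Poly_Mapping.lookup ?D y = 0"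
        by (simp add: lookup_minus lookup_T_basis lookup_eq_ncoeff[of "C_basis w"] kl_coeff_def[symmetric] vpow_mult_assoc when_def)
      with that show False by (simp add: in_keys_iff)
    qed
    from lin[of "Poly_Mapping.keys ?D" T_basis] less k
    obtain h where "C_comb h = (\<Sum>y\<in>Poly_Mapping.keys ?D. hscale (Poly_Mapping.lookup ?D y) (T_basis y))" by blast
    then have "C_comb h = ?D" by (simp flip: hecke_expansion)
    then have "C_comb (hscale (vpow (int (len w))) (T_basis w) - h) = T_basis w"
      by (simp add: semilinear_diff[OF hlinear_C_comb] semilinear_scale[OF hlinear_C_comb])
    then show ?case by blast
  qed
  show ?thesis by (subst hecke_expansion[of g]) (rule lin[OF T])
qed

definition C_coord :: "hecke \<Rightarrow> hecke" where
  "C_coord g = (THE h. C_comb h = g)"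

lemma C_comb_C_coord [simp]: "C_comb (C_coord g) = g"
  unfolding C_coord_def by (rule theI') (metis C_comb_surj C_comb_inj)

lemma C_coord_C_comb [simp]: "C_coord (C_comb h) = h"
  using C_comb_C_coord C_comb_inj by blast

lemma C_coord_C_basis [simp]: "C_coord (C_basis w) = T_basis w"
  using C_coord_C_comb[of "T_basis w"] by simp

lemma hlinear_C_coord: "hlinear C_coord"
  unfolding semilinear_def
proof (intro conjI allI)
  fix h h' a
  show "C_coord (h + h') = C_coord h + C_coord h'"
    by (subst C_comb_inj[symmetric]) (simp add: semilinear_add[OF hlinear_C_comb])
  show "C_coord (hscale a h) = hscale a (C_coord h)"
    by (subst C_comb_inj[symmetric]) (simp add: semilinear_scale[OF hlinear_C_comb])
qed

lemma structure_const_eq: "structure_const x y = Poly_Mapping.lookup (C_coord (hmult (C_basis x) (C_basis y)))"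
  unfolding structure_const_def C_coord_def C_comb_def linear_extension_def by (simp add: eq_commute)

lemma C_basis_expansion: "h = (\<Sum>w\<in>Poly_Mapping.keys (C_coord h). hscale (Poly_Mapping.lookup (C_coord h) w) (C_basis w))"
  using C_comb_C_coord[of h] by (simp add: C_comb_def linear_extension_def)

section \<open>Rigid and braided elements\<close>

definition rigid :: "weyl \<Rightarrow> bool" where
  "rigid w \<longleftrightarrow> w \<noteq> 1 \<and> \<not> braided w"

lemma rigid_winv: "rigid (winv w) \<longleftrightarrow> rigid w"
  unfolding rigid_def braided_winv by (metis winv_one winv_inj)

lemma rigid_descents: "rigid w \<Longrightarrow> a \<in> descents w \<Longrightarrow> descents w = {a}"
  using braided_two_descents by (auto simp: rigid_def)

lemma obtain_rigid_descent:
  assumes "rigid w" obtains a where "descents w = {a}"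
  using assms rigid_descents descents_nonempty unfolding rigid_def by metis

lemma braided_not_one: "braided w \<Longrightarrow> w \<noteq> 1"
  by (auto simp: braided_def)

lemma not_braided_descent: "\<not> braided w \<Longrightarrow> a \<in> descents w \<Longrightarrow> \<not> braided (simple a * w)"
  using braided_ascent[of "simple a * w" a] by auto

lemma right_descents_mult_left:
  assumes "len (x * y) = len x + len y" shows "descents (winv y) \<subseteq> descents (winv (x * y))"
  using descents_mult_right[of "winv y" "winv x"] assms len_winv[of "x * y"] by (simp add: winv_mult)

lemma right_descents_left_descent:
  assumes "a \<in> descents w" shows "descents (winv (simple a * w)) \<subseteq> descents (winv w)"
  using right_descents_mult_left[of "simple a" "simple a * w"] len_descent[OF assms] by simp

lemma descents_right_descent:
  assumes "a \<in> descents (winv w)" shows "descents (w * simple a) \<subseteq> descents w"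
  using right_descents_left_descent[OF assms] by (simp add: winv_mult)

lemma len_right_descent: "a \<in> descents (winv w) \<Longrightarrow> len w = len (w * simple a) + 1"
  using len_descent[of a "winv w"] len_winv[of "w * simple a"] by (simp add: winv_mult)

lemma descents_simple [simp]: "descents (simple p) = {p}"
proof -
  have "r = p" if "r \<in> descents (simple p)" for r
  proof -
    have "simple r * simple p = 1" using that by (simp add: descents_iff)
    then have "simple p = simple r" by (metis mult.right_neutral simple_cancel)
    then show ?thesis by simp
  qed
  then show ?thesis by (auto simp: descents_iff)
qed

text \<open>The element \<open>y\<close> is minimal in its coset under the dihedral group generated
  by \<open>p\<close> and \<open>q\<close>, so each letter of \<open>p q p\<close> adds to its
  length. A premature descent would let \<open>two_descents\<close> produce a reduction of
  \<open>q y\<close>.\<close>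

lemma braid_ascents:
  assumes "p \<noteq> q" "p \<notin> descents y" "q \<notin> descents y"
  shows "q \<notin> descents (simple p * y)" "p \<notin> descents (simple q * (simple p * y))"
    "len (simple p * (simple q * (simple p * y))) = len y + 3"
proof -
  have lp: "len (simple p * y) = len y + 1" by (rule len_ascent[OF assms(2)])
  show q: "q \<notin> descents (simple p * y)"
  proof
    assume "q \<in> descents (simple p * y)"
    moreover have "p \<in> descents (simple p * y)" using assms(2) by simp
    ultimately obtain z where z: "simple p * y = simple p * (simple q * (simple p * z))" "len (simple p * y) = len z + 3"
      using two_descents assms(1) by metis
    have "simple q * y = simple p * z" using z(1) by simp
    then have "len (simple q * y) < len y" using len_mult_le[of "simple p" z] z(2) lp by simp
    then show False using assms(3) by (simp add: descents_iff)
  qed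
  have lq: "len (simple q * (simple p * y)) = len y + 2" using len_ascent[OF q] lp by simp
  show p: "p \<notin> descents (simple q * (simple p * y))"
  proof
    assume "p \<in> descents (simple q * (simple p * y))"
    moreover have "q \<in> descents (simple q * (simple p * y))" using q by simp
    ultimately obtain z where z: "simple q * (simple p * y) = simple q * (simple p * (simple q * z))"
        "len (simple q * (simple p * y)) = len z + 3"
      using two_descents assms(1) by metis
    have "simple q * y = z" using z(1) by simp
    then have "len (simple q * y) < len y" using z(2) lq by simp
    then show False using assms(3) by (simp add: descents_iff)
  qed
  show "len (simple p * (simple q * (simple p * y))) = len y + 3" using len_ascent[OF p] lq by simp
qed

section \<open>Vanishing of \<open>mu_coeff\<close> from rigid to braided elements\<close>

lemma kl_coeff_pos: "0 < k \<Longrightarrow> Poly_Mapping.lookup (kl_coeff y w) k = 0"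
  using kl_coeff_neg[of y w k] by (cases "y = w") (auto simp: lookup_one when_def)

text \<open>Each of the three ascents from \<open>y\<close> to \<open>p q p y\<close> costs a factor
  \<open>v^-1\<close>.\<close>

lemma kl_coeff_braid_ascent:
  assumes "p \<noteq> q" "p \<in> descents w" "q \<in> descents w" "p \<notin> descents y" "q \<notin> descents y"
  shows "kl_coeff y w = vpow (-3) * kl_coeff (simple p * (simple q * (simple p * y))) w"
  using kl_coeff_ascent[OF assms(2,4)] kl_coeff_ascent[OF assms(3) braid_ascents(1)[OF assms(1,4,5)]]
    kl_coeff_ascent[OF assms(2) braid_ascents(2)[OF assms(1,4,5)]]
  by (simp add: vpow_mult_assoc)

text \<open>Shifted by 3, the degree becomes positive, where every \<open>kl_coeff\<close>
  vanishes.\<close>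

lemma kl_coeff_braid_ascent_zero:
  assumes "p \<noteq> q" "p \<in> descents w" "q \<in> descents w" "p \<notin> descents y" "q \<notin> descents y" "-2 \<le> k"
  shows "Poly_Mapping.lookup (kl_coeff y w) k = 0"
  using assms(6) by (simp add: kl_coeff_braid_ascent[OF assms(1-5)] lookup_vpow_mult kl_coeff_pos)

text \<open>All correction terms vanish. A candidate \<open>z\<close> has the descent
  \<open>a\<close>, hence lacks a descent \<open>r\<close> of \<open>m\<close>, as no element has
  all three. So \<open>mu_coeff z m\<close> is zero unless \<open>z = r m\<close>, and
  \<open>no_descent_chain\<close> denies the descent \<open>a\<close> to \<open>r m\<close>.\<close>

lemma C_simple_mult_two_descents:
  assumes p: "p \<in> descents m" and q: "q \<in> descents m" and pq: "p \<noteq> q" and a: "a \<notin> descents m"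
  shows "C_simple_mult a (C_basis m) = C_basis (simple a * m)"
proof -
  have ne: "a \<noteq> p" "a \<noteq> q" using assms by auto
  have "mu_coeff z m = 0" if z: "z \<in> kl_lower a m" for z
  proof -
    have az: "a \<in> descents z" using z by (simp add: kl_lower_def)
    then obtain r r' where r: "r \<in> descents m" "r' \<in> descents m" "r \<noteq> r'" "r \<notin> descents z" "a \<noteq> r" "a \<noteq> r'"
      using not_all_descents[of a z p q] p q pq ne by metis
    moreover have "simple r * z \<noteq> m"
    proof
      assume "simple r * z = m"
      then have "z = simple r * m" by auto
      then show False using no_descent_chain[OF r(1,2,3), of a] r az by auto
    qed
    ultimately show ?thesis using mu_coeff_eq_0_if_descent by blast
  qed
  then show ?thesis using C_simple_mult_ascent[OF a] by simp
qed

lemma kl_coeff_two_descents: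
  assumes "p \<in> descents m" "q \<in> descents m" "p \<noteq> q" "a \<notin> descents m"
  shows "kl_coeff y (simple a * m) =
    kl_coeff (simple a * y) m + vpow (if a \<in> descents y then 1 else -1) * kl_coeff y m"
  using ncoeff_C_simple_mult[of a "C_basis m" y] C_simple_mult_two_descents[OF assms]
  by (simp add: kl_coeff_def)

lemma mu_coeff_winv: "mu_coeff (winv y) (winv w) = mu_coeff y w"
  by (simp add: mu_coeff_def kl_coeff_winv)

lemma mu_coeff_rigid_braided_core:
  assumes u: "rigid u" and w: "braided w" and len: "len w \<noteq> len u + 1"
    and Du: "descents u = {a}" "descents w = {a}"
    and Ru: "descents (winv u) = {e}" "descents (winv w) = {e}"
  shows "mu_coeff u w = 0"
proof -
  obtain b c where bc: "b \<noteq> a" "c \<noteq> a" "b \<noteq> c" by (rule obtain_others)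
  obtain f g where fg: "f \<noteq> e" "g \<noteq> e" "f \<noteq> g" by (rule obtain_others)
  define m1 where "m1 = simple a * w"
  have w_eq: "w = simple a * m1" by (simp add: m1_def)
  have lm1: "len w = len m1 + 1" using len_descent[of a w] Du by (simp add: m1_def)
  \<comment> \<open>The only descent of \<open>w\<close> is \<open>a\<close>, which leaves the
    second alternative of \<open>braided_cases\<close>.\<close>
  have Dm1: "descents m1 = - {a}" using braided_cases[OF w, of a] Du by (auto simp: m1_def)
  then have d1: "b \<in> descents m1" "c \<in> descents m1" "a \<notin> descents m1" using bc by auto
  have m1: "braided m1" using braided_two_descents d1 bc by blast
  have "descents (winv m1) \<subseteq> {e}" using right_descents_left_descent[of a w] Du Ru by (simp add: m1_def)
  moreover have "winv m1 \<noteq> 1" using braided_not_one m1 braided_winv by blast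
  ultimately have Rm1: "descents (winv m1) = {e}" using descents_nonempty by blast
  define m where "m = m1 * simple e"
  have m1_eq: "winv m1 = simple e * winv m" by (simp add: m_def winv_mult)
  have Rm: "descents (winv m) = - {e}"
    using braided_cases[of "winv m1" e] m1 Rm1 by (auto simp: braided_winv m_def winv_mult)
  then have r: "f \<in> descents (winv m)" "g \<in> descents (winv m)" "e \<notin> descents (winv m)" using fg by auto
  have lm: "len m1 = len m + 1" using len_right_descent[of e m1] Rm1 by (simp add: m_def)
  have m: "braided m" using braided_two_descents[OF r(1,2)] fg braided_winv by blast
  have Dm: "descents m \<subseteq> - {a}" using descents_right_descent[of e m1] Rm1 Dm1 by (simp add: m_def)
  have d: "b \<in> descents m" "c \<in> descents m"
  proof -
    obtain x where x: "x \<in> descents m" using descents_nonempty[OF braided_not_one[OF m]] by blast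
    have xa: "x \<noteq> a" using x Dm by auto
    \<comment> \<open>If \<open>x m\<close> had all descents other than \<open>x\<close>, then
      \<open>a\<close> would be among them and would remain a descent of \<open>x m1\<close>,
      although \<open>m1\<close> has the two descents \<open>x\<close> and \<open>x'\<close> other
      than \<open>a\<close>. Hence removing \<open>e\<close> keeps both descents \<open>b\<close>
      and \<open>c\<close>.\<close>
    have "descents (simple x * m) \<noteq> - {x}"
    proof
      assume *: "descents (simple x * m) = - {x}"
      have lx: "len m = len (simple x * m) + 1" by (rule len_descent[OF x])
      have x1: "x \<in> descents m1" using xa Dm1 by auto
      have e1: "simple x * m1 = (simple x * m) * simple e" by (simp add: m_def mult.assoc)
      have "len (simple x * m1) = len (simple x * m) + 1" using len_descent[OF x1] lm lx by simp
      then have "a \<in> descents (simple x * m1)"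
        using descents_mult_right[of "simple x * m" "simple e"] * xa unfolding e1 by auto
      moreover obtain x' where "x' \<noteq> a" "x' \<noteq> x" by (rule obtain_third)
      moreover have "x' \<in> descents m1" using \<open>x' \<noteq> a\<close> Dm1 by auto
      ultimately show False using no_descent_chain[OF x1, of x' a] xa by auto
    qed
    then obtain y where y: "y \<in> descents m" "y \<noteq> x" using braided_cases[OF m x] by blast
    have "y \<noteq> a" using y Dm by auto
    then show "b \<in> descents m" "c \<in> descents m"
      using x xa y bc gen_cases_of_distinct[of a x y b] gen_cases_of_distinct[of a x y c] by auto
  qed
  \<comment> \<open>The mirror image of \<open>kl_coeff_two_descents\<close>, obtained by passing to
    inverses.\<close>
  have right: "kl_coeff y m1 = kl_coeff (y * simple e) m + vpow (if e \<in> descents (winv y) then 1 else -1) * kl_coeff y m" for y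
  proof -
    have "kl_coeff y m1 = kl_coeff (winv y) (simple e * winv m)" by (simp add: m1_eq[symmetric] kl_coeff_winv)
    also have "\<dots> = kl_coeff (simple e * winv y) (winv m) + vpow (if e \<in> descents (winv y) then 1 else -1) * kl_coeff (winv y) (winv m)"
      by (rule kl_coeff_two_descents[OF r(1,2) fg(3) r(3)])
    also have "kl_coeff (simple e * winv y) (winv m) = kl_coeff (y * simple e) m"
      using kl_coeff_winv[of "y * simple e" m] by (simp add: winv_mult)
    finally show ?thesis by (simp add: kl_coeff_winv)
  qed
  define u' where "u' = simple a * u"
  have lu: "len u = len u' + 1" using len_descent[of a u] Du by (simp add: u'_def)
  have "kl_coeff u w = kl_coeff u' m1 + vpow 1 * kl_coeff u m1"
    using kl_coeff_two_descents[OF d1(1,2) bc(3) d1(3), of u] Du by (simp add: w_eq u'_def)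
  also have "\<dots> = (kl_coeff (u' * simple e) m + vpow (if e \<in> descents (winv u') then 1 else -1) * kl_coeff u' m)
      + vpow 1 * (kl_coeff (u * simple e) m + vpow 1 * kl_coeff u m)"
    unfolding right using Ru by simp
  \<comment> \<open>The powers of \<open>v\<close> in front shift degree -1 to the degrees shown;
    the last term has collected \<open>v\<close> from both sides.\<close>
  finally have mu: "mu_coeff u w = Poly_Mapping.lookup (kl_coeff (u' * simple e) m) (-1)
      + Poly_Mapping.lookup (kl_coeff u' m) (if e \<in> descents (winv u') then -2 else 0)
      + Poly_Mapping.lookup (kl_coeff (u * simple e) m) (-2) + Poly_Mapping.lookup (kl_coeff u m) (-3)"
    by (simp add: mu_coeff_def lookup_add lookup_vpow_mult distrib_left)
  \<comment> \<open>As \<open>e\<close> is a right descent of \<open>u\<close>, removing it creates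
    no left descent, so \<open>b\<close> and \<open>c\<close> are ascents of
    \<open>u e\<close>.\<close>
  have t3: "Poly_Mapping.lookup (kl_coeff (u * simple e) m) (-2) = 0"
    using kl_coeff_braid_ascent_zero[OF bc(3) d, of "u * simple e" "-2"] descents_right_descent[of e u] Du Ru bc by auto
  have t4: "Poly_Mapping.lookup (kl_coeff u m) (-3) = 0"
  proof -
    \<comment> \<open>Degree -3 is one too low for the general bound: it is the constant term of the
      coefficient at \<open>b c b u\<close>. This vanishes because \<open>b c b u\<close> keeps the
      right descent \<open>e\<close> of \<open>u\<close> and so differs from
      \<open>m\<close>.\<close>
    let ?x = "simple b * (simple c * (simple b * u))"
    have nd: "b \<notin> descents u" "c \<notin> descents u" using Du bc by auto
    have x_eq: "?x = simple b * simple c * simple b * u" by (simp add: mult.assoc)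
    have "len ?x = len u + 3" using braid_ascents(3)[OF bc(3) nd] .
    moreover have "len (simple b * simple c * simple b) \<le> 3"
      using len_mult_le[of "simple b * simple c" "simple b"] len_mult_le[of "simple b" "simple c"] by simp
    ultimately have "len ?x = len (simple b * simple c * simple b) + len u"
      using len_mult_le[of "simple b * simple c * simple b" u] unfolding x_eq by linarith
    then have "e \<in> descents (winv ?x)"
      using right_descents_mult_left[of "simple b * simple c * simple b" u] Ru unfolding x_eq by auto
    then have "?x \<noteq> m" using r(3) by auto
    then show ?thesis
      using kl_coeff_neg[of ?x m 0] by (simp add: kl_coeff_braid_ascent[OF bc(3) d nd] lookup_vpow_mult)
  qed
  show ?thesis
  proof (cases "u' = 1")
    case True
    \<comment> \<open>For \<open>u' = 1\<close> the letter \<open>e\<close> is no right descent of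
      \<open>u'\<close>, so the second term is taken in degree 0 and vanishes since \<open>m\<close>
      is not 1.\<close>
    then have ua: "u = simple a" by (metis simple_cancel mult.right_neutral u'_def)
    then have ea: "e = a" using Ru by simp
    have "Poly_Mapping.lookup (kl_coeff (u' * simple e) m) (-1) = 0"
      using kl_coeff_braid_ascent_zero[OF bc(3) d, of "simple a" "-1"] bc True ea by simp
    moreover have "Poly_Mapping.lookup (kl_coeff u' m) 0 = 0"
      using kl_coeff_neg[of 1 m 0] True braided_not_one[OF m] by auto
    ultimately show ?thesis using mu t3 t4 True by simp
  next
    case False
    then have u': "rigid u'" using u not_braided_descent[of u a] Du by (auto simp: rigid_def u'_def)
    have "descents (winv u') \<subseteq> {e}" using right_descents_left_descent[of a u] Du Ru by (simp add: u'_def)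
    moreover have "winv u' \<noteq> 1" using False by (metis winv_one winv_inj)
    ultimately have Ru': "descents (winv u') = {e}" using descents_nonempty by blast
    \<comment> \<open>This uses the two right descents \<open>f\<close> and \<open>g\<close> of
      \<open>m\<close>, which are right ascents of \<open>u'\<close>.\<close>
    have t2: "Poly_Mapping.lookup (kl_coeff u' m) (-2) = 0"
      using kl_coeff_braid_ascent_zero[OF fg(3) r(1,2), of "winv u'" "-2"] Ru' fg by (auto simp: kl_coeff_winv)
    let ?y = "u' * simple e"
    have ly: "len u' = len ?y + 1" using len_right_descent[of e u'] Ru' by simp
    have "\<not> braided ?y"
      using not_braided_descent[of "winv u'" e] u' Ru' braided_winv[of ?y] by (simp add: rigid_def braided_winv winv_mult)
    then obtain p where p: "p \<in> descents m" "p \<notin> descents ?y"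
      using braided_two_descents bc(3) d by blast
    \<comment> \<open>Both \<open>m\<close> and \<open>?y\<close> are shorter by 2 than
      \<open>w\<close> and \<open>u\<close>, so the hypothesis on the length difference is
      inherited.\<close>
    have "simple p * ?y \<noteq> m"
      using len_ascent[OF p(2)] len ly lu lm lm1 by auto
    then have "mu_coeff ?y m = 0" using mu_coeff_eq_0_if_descent[OF p] by blast
    then show ?thesis using mu t2 t3 t4 Ru' by (simp add: mu_coeff_def)
  qed
qed

lemma mu_coeff_rigid_braided:
  assumes u: "rigid u" and w: "braided w" and len: "len w \<noteq> len u + 1"
  shows "mu_coeff u w = 0"
proof -
  have key: "mu_coeff x y = 0 \<or> descents y = descents x"
    if x: "rigid x" and y: "braided y" and l: "len y \<noteq> len x + 1" for x y
  proof (cases "\<exists>a. a \<in> descents y \<and> a \<notin> descents x")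
    case True
    then obtain a where a: "a \<in> descents y" "a \<notin> descents x" by blast
    have "simple a * x \<noteq> y" using l len_ascent[OF a(2)] by auto
    then show ?thesis using mu_coeff_eq_0_if_descent a by blast
  next
    case False
    obtain a where "descents x = {a}" using obtain_rigid_descent x .
    moreover obtain b where "b \<in> descents y" using descents_nonempty braided_not_one y by blast
    ultimately have "descents y = descents x" using False by auto
    then show ?thesis ..
  qed
  obtain a where a: "descents u = {a}" using obtain_rigid_descent u .
  obtain e where e: "descents (winv u) = {e}" using obtain_rigid_descent u rigid_winv by blast
  have "mu_coeff u w = 0 \<or> descents (winv w) = descents (winv u)"
    using key[of "winv u" "winv w"] u w len by (simp add: rigid_winv braided_winv mu_coeff_winv)
  then show ?thesis using mu_coeff_rigid_braided_core[OF u w len a _ e] key[OF u w len] a e by auto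
qed

section \<open>The ideal of the braided elements\<close>

definition braided_span :: "hecke set" where
  "braided_span = {h. \<forall>z. \<not> braided z \<longrightarrow> Poly_Mapping.lookup (C_coord h) z = 0}"

lemma lookup_C_coord_add: "Poly_Mapping.lookup (C_coord (h + h')) z = Poly_Mapping.lookup (C_coord h) z + Poly_Mapping.lookup (C_coord h') z"
  by (simp add: semilinear_add[OF hlinear_C_coord] lookup_add)

lemma lookup_C_coord_scale: "Poly_Mapping.lookup (C_coord (hscale a h)) z = a * Poly_Mapping.lookup (C_coord h) z"
  by (simp add: semilinear_scale[OF hlinear_C_coord])

lemma lookup_C_coord_C_basis: "Poly_Mapping.lookup (C_coord (C_basis w)) z = (1 when z = w)"
  by (simp add: lookup_T_basis)

lemma braided_span_add: "h \<in> braided_span \<Longrightarrow> h' \<in> braided_span \<Longrightarrow> h + h' \<in> braided_span"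
  by (simp add: braided_span_def lookup_C_coord_add)

lemma braided_span_scale: "h \<in> braided_span \<Longrightarrow> hscale a h \<in> braided_span"
  by (simp add: braided_span_def lookup_C_coord_scale)

lemma braided_span_0: "0 \<in> braided_span"
  by (simp add: braided_span_def semilinear_0[OF hlinear_C_coord])

lemma braided_span_sum: "(\<And>x. x \<in> A \<Longrightarrow> f x \<in> braided_span) \<Longrightarrow> sum f A \<in> braided_span"
  by (induction A rule: infinite_finite_induct) (auto intro: braided_span_add braided_span_0)

lemma C_basis_braided: "braided w \<Longrightarrow> C_basis w \<in> braided_span"
  unfolding braided_span_def by (auto simp: lookup_C_coord_C_basis when_def simp del: C_coord_C_basis)

text \<open>For an ascent \<open>a\<close> of \<open>w\<close>, a correction term \<open>z\<close>
  that is not braided has \<open>a\<close> as its only descent. Any descent \<open>r\<close> of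
  \<open>w\<close> is then an ascent of \<open>z\<close>, so \<open>mu_coeff z w\<close> is zero
  unless \<open>r z = w\<close>, and this is impossible.\<close>

lemma C_simple_mult_braided:
  assumes w: "braided w" shows "C_simple_mult a (C_basis w) \<in> braided_span"
proof (cases "a \<in> descents w")
  case True
  then show ?thesis by (simp add: C_simple_mult_descent braided_span_scale C_basis_braided w)
next
  case False
  have "hscale (of_int (mu_coeff z w)) (C_basis z) \<in> braided_span" if z: "z \<in> kl_lower a w" for z
  proof (cases "braided z")
    case False
    have az: "a \<in> descents z" using z by (simp add: kl_lower_def)
    then have "z \<noteq> 1" by auto
    then have Dz: "descents z = {a}" using rigid_descents az False by (simp add: rigid_def)
    obtain r where r: "r \<in> descents w" using descents_nonempty[OF braided_not_one[OF w]] by blast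
    have ra: "r \<noteq> a" using r \<open>a \<notin> descents w\<close> by auto
    have "simple r * z \<noteq> w"
    proof
      assume "simple r * z = w"
      then have zr: "z = simple r * w" by auto
      \<comment> \<open>The complement of \<open>r\<close> has two elements but \<open>z\<close> has
        one descent, so \<open>braided_cases\<close> gives \<open>w\<close> a second descent
        \<open>p\<close>. Then \<open>w\<close> begins with \<open>r p r\<close>, and
        \<open>p\<close> is a descent of \<open>z\<close> different from \<open>a\<close>.\<close>
      have "descents (simple r * w) \<noteq> - {r}"
      proof
        assume "descents (simple r * w) = - {r}"
        then have "- {r} = {a}" using Dz zr by simp
        moreover obtain x where "x \<noteq> r" "x \<noteq> a" by (rule obtain_third)
        ultimately show False by blast
      qed
      then obtain p where p: "p \<in> descents w" "p \<noteq> r" using braided_cases[OF w r] by blast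
      obtain y where y: "w = simple r * (simple p * (simple r * y))" "len w = len y + 3"
        using two_descents[OF r p(1)] p(2) by metis
      have "simple p * z = simple r * y" using y(1) zr by simp
      then have "p \<in> descents z"
        using len_mult_le[of "simple r" y] y(2) len_descent[OF r] zr by (simp add: descents_iff)
      then show False using Dz p(1) \<open>a \<notin> descents w\<close> by auto
    qed
    then have "mu_coeff z w = 0" using mu_coeff_eq_0_if_descent[OF r] Dz ra by auto
    then show ?thesis by (simp add: braided_span_0)
  qed (simp add: braided_span_scale C_basis_braided)
  then show ?thesis
    using C_simple_mult_ascent[OF False] braided_ascent[OF w False]
    by (simp add: braided_span_add C_basis_braided braided_span_sum)
qed

lemma C_simple_mult_expansion:
  "C_simple_mult a h = (\<Sum>w\<in>Poly_Mapping.keys (C_coord h). hscale (Poly_Mapping.lookup (C_coord h) w) (C_simple_mult a (C_basis w)))"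
  by (subst C_basis_expansion[of h])
     (simp only: semilinear_sum[OF hlinear_C_simple_mult] semilinear_scale[OF hlinear_C_simple_mult])

lemma C_simple_mult_braided_span:
  assumes "h \<in> braided_span" shows "C_simple_mult a h \<in> braided_span"
proof -
  have "braided w" if "w \<in> Poly_Mapping.keys (C_coord h)" for w
    using assms that by (auto simp: braided_span_def in_keys_iff)
  then show ?thesis
    by (subst C_simple_mult_expansion) (simp add: braided_span_sum braided_span_scale C_simple_mult_braided)
qed

lemma T_simple_mult_braided_span:
  assumes "h \<in> braided_span" shows "T_simple_mult a h \<in> braided_span"
proof -
  have "T_simple_mult a h = hscale (vpow 1) (C_simple_mult a h) + hscale (-1) h"
    by (rule poly_mapping_eqI)
       (simp add: C_simple_mult_def lookup_add vpow_mult_assoc)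
  then show ?thesis using assms by (simp add: braided_span_add braided_span_scale C_simple_mult_braided_span)
qed

lemma hmult_braided_span_right:
  assumes "h \<in> braided_span" shows "hmult g h \<in> braided_span"
proof -
  have "foldr T_simple_mult xs h \<in> braided_span" for xs
    by (induction xs) (simp_all add: assms T_simple_mult_braided_span)
  then show ?thesis unfolding hmult_def by (intro braided_span_sum braided_span_scale)
qed

lemma C_coord_hinv: "C_coord (hinv h) = hinv (C_coord h)"
proof -
  have "C_comb (hinv g) = hinv (C_comb g)" for g
  proof (rule semilinear_eqI[of "\<lambda>a. a" "\<lambda>g. C_comb (hinv g)" "\<lambda>g. hinv (C_comb g)"])
    show "hlinear (\<lambda>g. C_comb (hinv g))" using semilinear_comp[OF hlinear_C_comb hlinear_hinv] by simp
    show "hlinear (\<lambda>g. hinv (C_comb g))" using semilinear_comp[OF hlinear_hinv hlinear_C_comb] by simp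
  qed (simp add: C_basis_winv)
  from this[of "C_coord h"] show ?thesis by (metis C_comb_C_coord C_coord_C_comb)
qed

lemma hinv_braided_span: "h \<in> braided_span \<Longrightarrow> hinv h \<in> braided_span"
  by (simp add: braided_span_def C_coord_hinv braided_winv)

lemma hmult_braided_span_left:
  assumes "h \<in> braided_span" shows "hmult h g \<in> braided_span"
  using hinv_braided_span[OF hmult_braided_span_right[OF hinv_braided_span[OF assms], of "hinv g"]]
  by (simp add: hinv_hmult)

section \<open>Structure constants at rigid elements\<close>

text \<open>Modulo \<open>braided_span\<close>, these are the integer combinations of the
  \<open>C_basis z\<close> with \<open>z\<close> not braided and \<open>a\<close> a left descent of
  \<open>z\<close>.\<close>

definition integral_span :: "gen \<Rightarrow> hecke set" where
  "integral_span a = {h. \<forall>z. \<not> braided z \<longrightarrow> (\<exists>n. Poly_Mapping.lookup (C_coord h) z = of_int n)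
     \<and> (Poly_Mapping.lookup (C_coord h) z \<noteq> 0 \<longrightarrow> a \<in> descents z)}"

lemma integral_span_add:
  assumes "h \<in> integral_span a" "h' \<in> integral_span a" shows "h + h' \<in> integral_span a"
  unfolding integral_span_def
proof (intro CollectI allI impI conjI)
  fix z assume z: "\<not> braided z"
  then obtain n n' where "Poly_Mapping.lookup (C_coord h) z = of_int n" "Poly_Mapping.lookup (C_coord h') z = of_int n'"
    using assms unfolding integral_span_def by blast
  then have "Poly_Mapping.lookup (C_coord (h + h')) z = of_int (n + n')" by (simp add: lookup_C_coord_add)
  then show "\<exists>n. Poly_Mapping.lookup (C_coord (h + h')) z = of_int n" ..
  assume "Poly_Mapping.lookup (C_coord (h + h')) z \<noteq> 0"
  then have "Poly_Mapping.lookup (C_coord h) z \<noteq> 0 \<or> Poly_Mapping.lookup (C_coord h') z \<noteq> 0"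
    by (auto simp: lookup_C_coord_add)
  then show "a \<in> descents z" using assms z unfolding integral_span_def by blast
qed

lemma integral_span_scale:
  assumes "h \<in> integral_span a" shows "hscale (of_int k) h \<in> integral_span a"
  unfolding integral_span_def
proof (intro CollectI allI impI conjI)
  fix z assume z: "\<not> braided z"
  then obtain n where "Poly_Mapping.lookup (C_coord h) z = of_int n"
    using assms unfolding integral_span_def by blast
  then have "Poly_Mapping.lookup (C_coord (hscale (of_int k) h)) z = of_int (k * n)" by (simp add: lookup_C_coord_scale)
  then show "\<exists>n. Poly_Mapping.lookup (C_coord (hscale (of_int k) h)) z = of_int n" ..
  assume "Poly_Mapping.lookup (C_coord (hscale (of_int k) h)) z \<noteq> 0"
  then have "Poly_Mapping.lookup (C_coord h) z \<noteq> 0" by (auto simp: lookup_C_coord_scale)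
  then show "a \<in> descents z" using assms z unfolding integral_span_def by blast
qed

lemma braided_span_integral: "h \<in> braided_span \<Longrightarrow> h \<in> integral_span a"
  unfolding braided_span_def integral_span_def by (auto intro: exI[of _ 0])

lemma integral_span_sum:
  "(\<And>x. x \<in> A \<Longrightarrow> f x \<in> integral_span a) \<Longrightarrow> sum f A \<in> integral_span a"
  by (induction A rule: infinite_finite_induct)
     (auto intro: integral_span_add braided_span_integral braided_span_0)

lemma C_basis_integral: "a \<in> descents w \<Longrightarrow> C_basis w \<in> integral_span a"
  unfolding integral_span_def
  by (auto simp: lookup_C_coord_C_basis when_def simp del: C_coord_C_basis intro: exI[of _ 1] exI[of _ 0])

lemma integral_span_cases:
  assumes "h \<in> integral_span d" "w \<in> Poly_Mapping.keys (C_coord h)"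
  obtains "braided w" | n where "rigid w" "descents w = {d}" "Poly_Mapping.lookup (C_coord h) w = of_int n"
proof (cases "braided w")
  case False
  then obtain n where "Poly_Mapping.lookup (C_coord h) w = of_int n" and d: "d \<in> descents w"
    using assms unfolding integral_span_def in_keys_iff by blast
  moreover have "rigid w" using False d by (auto simp: rigid_def)
  moreover have "descents w = {d}" using rigid_descents[OF \<open>rigid w\<close> d] .
  ultimately show thesis using that(2) by blast
qed (rule that(1))

text \<open>A rigid \<open>w\<close> in the expansion has \<open>d\<close> as its only descent, so
  \<open>a\<close> is an ascent, and the product consists of basis elements with descent
  \<open>a\<close> and integer coefficients.\<close>

lemma C_simple_mult_integral:
  assumes h: "h \<in> integral_span d" and ad: "a \<noteq> d"
  shows "C_simple_mult a h \<in> integral_span a"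
proof (subst C_simple_mult_expansion, rule integral_span_sum)
  fix w assume w: "w \<in> Poly_Mapping.keys (C_coord h)"
  from h w show "hscale (Poly_Mapping.lookup (C_coord h) w) (C_simple_mult a (C_basis w)) \<in> integral_span a"
  proof (cases rule: integral_span_cases)
    case 1
    then show ?thesis by (intro braided_span_integral braided_span_scale C_simple_mult_braided)
  next
    case (2 n)
    then have a: "a \<notin> descents w" using ad by auto
    have "C_simple_mult a (C_basis w) \<in> integral_span a"
      unfolding C_simple_mult_ascent[OF a]
      by (intro integral_span_add integral_span_sum integral_span_scale C_basis_integral)
         (use a in \<open>auto simp: kl_lower_def\<close>)
    then show ?thesis unfolding 2(3) by (rule integral_span_scale)
  qed
qed

text \<open>\<open>v + v\<^sup>-\<^sup>1\<close> enters only once: the factor arises when the last letter of \<open>x\<close> meets the first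
  letter of \<open>y\<close> in \<open>C\<^sub>x C\<^sub>y\<close>.\<close>

definition quantum_span :: "gen \<Rightarrow> hecke set" where
  "quantum_span a = {g + hscale (vpow 1 + vpow (-1)) h | g h. g \<in> integral_span a \<and> h \<in> integral_span a}"

lemma integral_quantum_span:
  assumes "h \<in> integral_span a" shows "h \<in> quantum_span a"
proof -
  have "h = h + hscale (vpow 1 + vpow (-1)) 0" by simp
  then show ?thesis
    unfolding quantum_span_def using assms braided_span_integral[OF braided_span_0] by blast
qed

lemma quantum_span_add:
  assumes "h \<in> quantum_span a" "h' \<in> quantum_span a" shows "h + h' \<in> quantum_span a"
proof -
  obtain g k g' k' where "h = g + hscale (vpow 1 + vpow (-1)) k" "h' = g' + hscale (vpow 1 + vpow (-1)) k'"
    and i: "g \<in> integral_span a" "k \<in> integral_span a" "g' \<in> integral_span a" "k' \<in> integral_span a"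
    using assms unfolding quantum_span_def by blast
  then have "h + h' = (g + g') + hscale (vpow 1 + vpow (-1)) (k + k')" by (simp add: hscale_add)
  then show ?thesis unfolding quantum_span_def using i integral_span_add by blast
qed

lemma quantum_span_scale:
  assumes "h \<in> quantum_span a" shows "hscale (of_int n) h \<in> quantum_span a"
proof -
  obtain g k where "h = g + hscale (vpow 1 + vpow (-1)) k"
    and i: "g \<in> integral_span a" "k \<in> integral_span a"
    using assms unfolding quantum_span_def by blast
  then have "hscale (of_int n) h = hscale (of_int n) g + hscale (vpow 1 + vpow (-1)) (hscale (of_int n) k)"
    by (simp add: hscale_add hscale_hscale mult.commute)
  then show ?thesis unfolding quantum_span_def using i integral_span_scale by blast
qed

lemma quantum_span_sum:
  "(\<And>x. x \<in> A \<Longrightarrow> f x \<in> quantum_span a) \<Longrightarrow> sum f A \<in> quantum_span a"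
  by (induction A rule: infinite_finite_induct)
     (auto intro: quantum_span_add integral_quantum_span braided_span_integral braided_span_0)

lemma C_simple_mult_integral_quantum:
  assumes h: "h \<in> integral_span d" shows "C_simple_mult a h \<in> quantum_span a"
proof (cases "a = d")
  case False
  then show ?thesis using integral_quantum_span C_simple_mult_integral h by blast
next
  case True
  show ?thesis
  proof (subst C_simple_mult_expansion, rule quantum_span_sum)
    fix w assume w: "w \<in> Poly_Mapping.keys (C_coord h)"
    from h w show "hscale (Poly_Mapping.lookup (C_coord h) w) (C_simple_mult a (C_basis w)) \<in> quantum_span a"
    proof (cases rule: integral_span_cases)
      case 1
      then show ?thesis by (intro integral_quantum_span braided_span_integral braided_span_scale C_simple_mult_braided)
    next
      case (2 n)
      then have a: "a \<in> descents w" using True by auto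
      have "C_simple_mult a (C_basis w) = 0 + hscale (vpow 1 + vpow (-1)) (C_basis w)"
        by (simp add: C_simple_mult_descent[OF a])
      then have "C_simple_mult a (C_basis w) \<in> quantum_span a"
        unfolding quantum_span_def using C_basis_integral[OF a] braided_span_integral[OF braided_span_0] by blast
      then show ?thesis unfolding 2(3) by (rule quantum_span_scale)
    qed
  qed
qed

lemma C_simple_mult_quantum:
  assumes "h \<in> quantum_span d" "a \<noteq> d" shows "C_simple_mult a h \<in> quantum_span a"
proof -
  obtain g k where "h = g + hscale (vpow 1 + vpow (-1)) k"
    and i: "g \<in> integral_span d" "k \<in> integral_span d"
    using assms unfolding quantum_span_def by blast
  then have "C_simple_mult a h = C_simple_mult a g + hscale (vpow 1 + vpow (-1)) (C_simple_mult a k)"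
    by (simp add: semilinear_add[OF hlinear_C_simple_mult] semilinear_scale[OF hlinear_C_simple_mult])
  then show ?thesis unfolding quantum_span_def using i C_simple_mult_integral assms(2) by blast
qed

section \<open>Products of basis elements modulo the ideal\<close>

lemma C_basis_1 [simp]: "C_basis 1 = T_basis 1"
  by (rule C_basis_eqI[OF is_kl_element_one])

lemma C_basis_simple: "C_basis (simple a) = C_simple_mult a (T_basis 1)"
proof -
  have "kl_lower a 1 = {}" using kl_lower_len[of _ a 1] by auto
  then show ?thesis using C_simple_mult_ascent[of a 1] by simp
qed

text \<open>This is \<open>C_simple_mult_ascent\<close> solved for its leading term; it drives the
  induction on the left factor.\<close>

lemma hmult_C_basis_ascent:
  assumes "a \<notin> descents w"
  shows "hmult (C_basis (simple a * w)) h = C_simple_mult a (hmult (C_basis w) h) +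
    (\<Sum>z\<in>kl_lower a w. hscale (of_int (- mu_coeff z w)) (hmult (C_basis z) h))"
proof -
  have "C_basis (simple a * w) = C_simple_mult a (C_basis w) +
    (\<Sum>z\<in>kl_lower a w. hscale (of_int (- mu_coeff z w)) (C_basis z))"
  proof -
    have "hscale (of_int (- n)) h = - hscale (of_int n) h" for n h
      by (rule poly_mapping_eqI) simp
    then show ?thesis using C_simple_mult_ascent[OF assms] by (simp add: sum_negf)
  qed
  then show ?thesis
    by (simp add: semilinear_add[OF hlinear_hmult_left] semilinear_sum[OF hlinear_hmult_left]
        semilinear_scale[OF hlinear_hmult_left] C_simple_mult_hmult del: of_int_minus)
qed

text \<open>Write \<open>x = a y\<close>. If \<open>y\<close> is not 1, it is rigid with a single
  descent other than \<open>a\<close>, so multiplication by the first letter creates no further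
  factor \<open>v + v^-1\<close>. The correction terms are braided, hence in the ideal, or shorter
  rigid elements with descent \<open>a\<close>.\<close>

lemma hmult_rigid_integral:
  "rigid x \<Longrightarrow> a \<in> descents x \<Longrightarrow> h \<in> integral_span d \<Longrightarrow> hmult (C_basis x) h \<in> quantum_span a"
proof (induction "len x" arbitrary: x a rule: less_induct)
  case less
  define y where "y = simple a * x"
  have y: "x = simple a * y" "a \<notin> descents y" "len y < len x"
    using less.prems len_descent[of a x] by (simp_all add: y_def)
  show ?case
  proof (cases "y = 1")
    case True
    then have "x = simple a" using y by simp
    then have "hmult (C_basis x) h = C_simple_mult a h" by (simp add: C_basis_simple C_simple_mult_hmult[symmetric])
    then show ?thesis using C_simple_mult_integral_quantum less.prems by simp
  next
    case False
    have ry: "rigid y" using not_braided_descent[of x a] less.prems False by (simp add: rigid_def y_def)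
    then obtain b where b: "descents y = {b}" by (rule obtain_rigid_descent)
    have ab: "a \<noteq> b" using b y by auto
    have "hmult (C_basis y) h \<in> quantum_span b" using less.hyps[OF y(3) ry] b less.prems by simp
    then have 1: "C_simple_mult a (hmult (C_basis y) h) \<in> quantum_span a" using C_simple_mult_quantum ab by blast
    have 2: "hmult (C_basis z) h \<in> quantum_span a" if z: "z \<in> kl_lower a y" for z
    proof (cases "braided z")
      case True
      then show ?thesis
        by (intro integral_quantum_span braided_span_integral hmult_braided_span_left C_basis_braided)
    next
      case False
      have "a \<in> descents z" "len z < len x" using z kl_lower_len[OF z] y by (auto simp: kl_lower_def)
      moreover have "rigid z" using False calculation by (auto simp: rigid_def)
      ultimately show ?thesis using less.hyps less.prems by blast
    qed
    show ?thesis unfolding y(1) hmult_C_basis_ascent[OF y(2)]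
      by (intro quantum_span_add quantum_span_sum quantum_span_scale 1 2)
  qed
qed

text \<open>Braided factors give 0 by the ideal property, and rigid ones are covered by
  \<open>hmult_rigid_integral\<close>. As 1 has no descents, its coefficient vanishes in
  \<open>quantum_span\<close>.\<close>

lemma structure_const_not_braided:
  assumes z: "\<not> braided z"
  shows "x = 1 \<and> structure_const x y z = (1 when z = y) \<or> y = 1 \<and> structure_const x y z = (1 when z = x)
    \<or> (\<exists>m n. structure_const x y z = of_int m + (vpow 1 + vpow (-1)) * of_int n) \<and> (z = 1 \<longrightarrow> structure_const x y z = 0)"
proof -
  consider "x = 1" | "y = 1" | "braided x \<or> braided y" | "rigid x" "rigid y"
    unfolding rigid_def by blast
  then show ?thesis
  proof cases
    case 1
    then show ?thesis by (simp add: structure_const_eq lookup_T_basis)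
  next
    case 2
    then show ?thesis by (simp add: structure_const_eq lookup_T_basis)
  next
    case 3
    then have "hmult (C_basis x) (C_basis y) \<in> braided_span"
      using hmult_braided_span_left hmult_braided_span_right C_basis_braided by blast
    then have "structure_const x y z = 0" using z by (simp add: structure_const_eq braided_span_def)
    then show ?thesis by (auto intro: exI[of _ 0])
  next
    case 4
    obtain a d where "descents x = {a}" "descents y = {d}" using 4 obtain_rigid_descent by metis
    then have "hmult (C_basis x) (C_basis y) \<in> quantum_span a"
      using 4 hmult_rigid_integral C_basis_integral by blast
    then obtain g h where gh: "hmult (C_basis x) (C_basis y) = g + hscale (vpow 1 + vpow (-1)) h"
      "g \<in> integral_span a" "h \<in> integral_span a" unfolding quantum_span_def by blast
    then have s: "structure_const x y z = Poly_Mapping.lookup (C_coord g) z + (vpow 1 + vpow (-1)) * Poly_Mapping.lookup (C_coord h) z"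
      by (simp add: structure_const_eq lookup_C_coord_add lookup_C_coord_scale)
    obtain m n where "Poly_Mapping.lookup (C_coord g) z = of_int m" "Poly_Mapping.lookup (C_coord h) z = of_int n"
      using gh z unfolding integral_span_def by blast
    moreover have "Poly_Mapping.lookup (C_coord g) 1 = 0" "Poly_Mapping.lookup (C_coord h) 1 = 0" if "z = 1"
      using gh(2,3) z that unfolding integral_span_def by fastforce+
    ultimately show ?thesis using s by auto
  qed
qed

section \<open>Bounds for the a-function\<close>

lemma a_fun_le:
  assumes "\<And>x y k. k < - int i \<Longrightarrow> Poly_Mapping.lookup (structure_const x y z) k = 0"
  shows "a_fun z \<le> enat i"
  unfolding a_fun_def
proof (rule Inf_lower, intro CollectI exI conjI allI ballI)
  fix x y k assume "k \<in> Poly_Mapping.keys (vpow (int i) * structure_const x y z)"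
  then have "Poly_Mapping.lookup (structure_const x y z) (k - int i) \<noteq> 0" by (simp add: in_keys_iff lookup_vpow_mult)
  then show "0 \<le> k" using assms[of "k - int i" x y] by force
qed simp

lemma a_fun_ge:
  assumes "Poly_Mapping.lookup (structure_const x y z) (- int n) \<noteq> 0"
  shows "enat n \<le> a_fun z"
  unfolding a_fun_def
proof (rule Inf_greatest)
  fix j assume "j \<in> {enat i |i. \<forall>x y. \<forall>k\<in>Poly_Mapping.keys (vpow (int i) * structure_const x y z). 0 \<le> k}"
  then obtain i where i: "j = enat i" "\<And>k. k \<in> Poly_Mapping.keys (vpow (int i) * structure_const x y z) \<Longrightarrow> 0 \<le> k"
    by blast
  have "int i - int n \<in> Poly_Mapping.keys (vpow (int i) * structure_const x y z)"
    using assms by (simp add: in_keys_iff lookup_vpow_mult)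
  from i(2)[OF this] show "enat n \<le> j" using i(1) by simp
qed

lemma a_fun_not_braided:
  assumes "\<not> braided z" shows "a_fun z \<le> 1"
proof -
  have "Poly_Mapping.lookup (structure_const x y z) k = 0" if k: "k < - int 1" for x y k
  proof -
    have "Poly_Mapping.lookup (of_int m + (vpow 1 + vpow (-1)) * of_int n) k = 0" for m n
    proof -
      have "(vpow 1 + vpow (-1)) * of_int n = of_int n * vpow 1 + of_int n * vpow (-1)"
        by (simp add: distrib_left mult.commute)
      then show ?thesis using k by (simp add: lookup_add lookup_of_int lookup_of_int_mult lookup_vpow when_def)
    qed
    moreover have "Poly_Mapping.lookup ((1::laurent) when P) k = 0" for P
      using k by (cases P) (simp_all add: lookup_one when_def)
    ultimately show ?thesis using structure_const_not_braided[OF assms, of x y] by (metis lookup_zero)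
  qed
  from a_fun_le[of 1 z, OF this] show ?thesis by (simp add: one_enat_def)
qed

lemma a_fun_one: "a_fun 1 = 0"
proof -
  have nb: "\<not> braided 1" using braided_not_one by blast
  have "Poly_Mapping.lookup (structure_const x y 1) k = 0" if k: "k < - int 0" for x y k
  proof -
    have "Poly_Mapping.lookup ((1::laurent) when P) k = 0" for P
      using k by (cases P) (simp_all add: lookup_one when_def)
    then show ?thesis using structure_const_not_braided[OF nb, of x y] by (metis lookup_zero)
  qed
  from a_fun_le[of 0 1, OF this] show ?thesis by (simp add: zero_enat_def[symmetric])
qed

lemma C_basis_simple_simple:
  assumes "p \<noteq> q" shows "C_basis (simple q * simple p) = C_simple_mult q (C_simple_mult p (T_basis 1))"
proof -
  have "kl_lower q (simple p) = {}" using kl_lower_len[of _ q "simple p"] by (fastforce simp: kl_lower_def)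
  then show ?thesis using C_simple_mult_ascent[of q "simple p"] assms by (simp add: C_basis_simple)
qed

text \<open>No correction terms survive: \<open>z\<close> has length at most 1 and descent
  \<open>a\<close>, while two descents require length 3. So \<open>q\<close> is an ascent of
  \<open>z\<close>, and \<open>q z = q p\<close> would mean that \<open>z\<close> is
  \<open>simple p\<close>, without descent \<open>a\<close>.\<close>

lemma C_basis_coxeter:
  assumes "p \<noteq> q" "a \<noteq> p" "a \<noteq> q"
  shows "C_basis (simple a * (simple q * simple p)) =
    C_simple_mult a (C_simple_mult q (C_simple_mult p (T_basis 1)))"
proof -
  let ?x = "simple q * simple p"
  have lx: "len ?x = 2" using len_ascent[of q "simple p"] assms by simp
  have q: "q \<in> descents ?x" using assms by (auto simp: descents_iff lx)
  have a: "a \<notin> descents ?x"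
  proof
    assume "a \<in> descents ?x"
    then obtain z where "len ?x = len z + 3" using two_descents[OF _ q] assms by metis
    then show False using lx by simp
  qed
  have "mu_coeff z ?x = 0" if z: "z \<in> kl_lower a ?x" for z
  proof -
    have az: "a \<in> descents z" and lz: "len z < 2" using z kl_lower_len[OF z] lx by (auto simp: kl_lower_def)
    have "q \<notin> descents z"
    proof
      assume "q \<in> descents z"
      then obtain y where "len z = len y + 3" using two_descents[OF az] assms by metis
      then show False using lz by simp
    qed
    moreover have "simple q * z \<noteq> ?x" using az assms by auto
    ultimately show ?thesis using mu_coeff_eq_0_if_descent[OF q] by blast
  qed
  then show ?thesis using C_simple_mult_ascent[OF a] C_basis_simple_simple[OF assms(1)] by simp
qed

lemma a_fun_braided:
  assumes u: "braided u" shows "2 \<le> a_fun u"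
proof -
  let ?v = "vpow 1 + vpow (-1)"
  obtain a where a: "a \<in> descents u" using descents_nonempty[OF braided_not_one[OF u]] by blast
  have "\<exists>x y. hmult (C_basis x) (C_basis y) = hscale (?v * ?v) (C_basis u)"
  proof (cases "\<exists>p\<in>descents u. p \<noteq> a")
    case True
    then obtain p where p: "p \<in> descents u" "p \<noteq> a" by blast
    \<comment> \<open>Both letters of the left factor are descents of \<open>u\<close>, and each
      contributes one factor \<open>v + v^-1\<close>.\<close>
    have "hmult (C_basis (simple a * simple p)) (C_basis u) = hscale (?v * ?v) (C_basis u)"
      unfolding C_basis_simple_simple[OF p(2)] C_simple_mult_hmult[symmetric]
      by (simp add: C_simple_mult_descent[OF p(1)] C_simple_mult_descent[OF a]
          semilinear_scale[OF hlinear_C_simple_mult] hscale_hscale)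
    then show ?thesis by blast
  next
    case False
    define m where "m = simple a * u"
    have m: "descents m = - {a}" using braided_cases[OF u a] False by (auto simp: m_def)
    obtain p q where pq: "p \<noteq> a" "q \<noteq> a" "p \<noteq> q" by (rule obtain_others)
    have d: "p \<in> descents m" "q \<in> descents m" "a \<notin> descents m" using m pq by auto
    have um: "C_basis u = C_simple_mult a (C_basis m)"
      using C_simple_mult_two_descents[OF d(1,2) pq(3) d(3)] by (simp add: m_def)
    \<comment> \<open>The letters \<open>p\<close> and \<open>q\<close> are descents of
      \<open>m\<close> and contribute the two factors; the last letter \<open>a\<close> then turns
      \<open>C_basis m\<close> into \<open>C_basis u\<close>.\<close>
    have "hmult (C_basis (simple a * (simple q * simple p))) (C_basis m) = hscale (?v * ?v) (C_basis u)"
      unfolding C_basis_coxeter[OF pq(3) pq(1,2)[symmetric]] C_simple_mult_hmult[symmetric]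
      by (simp add: C_simple_mult_descent[OF d(1)] C_simple_mult_descent[OF d(2)] um
          semilinear_scale[OF hlinear_C_simple_mult] hscale_hscale)
    then show ?thesis by blast
  qed
  then obtain x y where "hmult (C_basis x) (C_basis y) = hscale (?v * ?v) (C_basis u)" by blast
  then have "structure_const x y u = ?v * ?v"
    by (simp add: structure_const_eq lookup_C_coord_scale lookup_T_basis)
  also have "\<dots> = vpow 2 + 2 + vpow (-2)"
    by (simp add: distrib_left distrib_right vpow_mult)
  finally have "Poly_Mapping.lookup (structure_const x y u) (- int 2) = 1"
    by (simp add: lookup_add lookup_vpow when_def lookup_numeral)
  from a_fun_ge[of x y u 2] this show ?thesis by (simp add: numeral_eq_enat)
qed

theorem theorem4p8:
  fixes u w :: weyl
  assumes "bruhat_less u w" and "u \<in> c1" and "w \<in> c0"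
  shows "(len w - len u = 1 \<longrightarrow> mu u w = 1) \<and> (len w - len u \<noteq> 1 \<longrightarrow> mu u w = 0)"
proof -
  have le: "bruhat_le u w" and l: "len u < len w"
    using assms(1) bruhat_le_len by (auto simp: bruhat_less_def)
  have au: "a_fun u = 1" and aw: "a_fun w = 3" using assms by (simp_all add: c1_def c0_def)
  \<comment> \<open>The value 1 of the a-function lies strictly between its value 0 at 1 and the
    lower bound 2 on braided elements.\<close>
  have "rigid u" unfolding rigid_def
  proof
    show "u \<noteq> 1" using au a_fun_one by auto
    show "\<not> braided u" using au a_fun_braided[of u] by (auto simp: one_enat_def numeral_eq_enat)
  qed
  \<comment> \<open>The value 3 exceeds the upper bound 1 valid for elements that are not
    braided.\<close>
  moreover have "braided w"
    using aw a_fun_not_braided[of w] by (auto simp: one_enat_def numeral_eq_enat)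
  ultimately show ?thesis
    using mu_coeff_rigid_braided[of u w] mu_coeff_len_1[OF le] l by (auto simp: mu_eq_mu_coeff)
qed

end
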